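(* Let $T>0$ be fixed, let $\frac12<\gamma\le 1$, let $u^0\in H^\gamma(\mathbb{T})$, and let $u\in C([0,T];H^\gamma(\mathbb{T}))$ be the solution of the cubic nonlinear Schrödinger equation $i\partial_t u+\partial_{xx}u=|u|^2u$ on $\mathbb{T}$ with $u(0,\cdot)=u^0$. For a step size $\tau>0$ and an integer $N\ge1$, let $u^n_{\tau,N}$, $n\ge 0$, be the numerical solution defined by $u^0_{\tau,N}=P_NI_{2N}u^0$ and $u^{n+1}_{\tau,N}=\Phi_{\tau,N}(u^n_{\tau,N})$, with $P_N$, $I_{2N}$ and $\Phi_{\tau,N}$ as defined in the context. Then for every $\varepsilon>0$ there exist constants $\tau_0>0$ and $C>0$ such that for every step size $0<\tau\le\tau_0$, every integer $N\ge1$, and every integer $n\ge0$ with $0\le n\tau\le T$, writing $t_n=n\tau$, $$\|u(t_n,\cdot)-u^n_{\tau,N}\|_{L^2(\mathbb{T})}\le C\tau^{\frac32\gamma-\frac12-\varepsilon}+CN^{-\gamma}.$$ Here $\tau_0$ depends only on $T$ and $\|u\|_{L^\infty((0,T);H^\gamma)}$, and $C$ depends only on $T$, $\|u\|_{L^\infty((0,T);H^\gamma)}$ and $\varepsilon$.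
   Context: $\mathbb{T}=(0,2\pi)$ is the one-dimensional torus ($2\pi$-periodic functions); all functions are complex valued. Fourier coefficients: $\hat f_k=\frac1{2\pi}\int_{\mathbb{T}}e^{-ikx}f(x)\,dx$, $k\in\mathbb{Z}$. The norm of $H^s(\mathbb{T})$ is $\|f\|_{H^s}^2=2\pi\sum_{k\in\mathbb{Z}}(1+k^2)^s|\hat f_k|^2$. The exponent $\gamma$ is fixed, so constants may depend on it. The solution $u$ exists uniquely in $C([0,T];H^\gamma(\mathbb{T}))$ (known global well-posedness for $\gamma\ge0$) and satisfies Duhamel's formula $u(t)=e^{it\partial_x^2}u^0-i\int_0^t e^{i(t-s)\partial_x^2}\big[|u(s)|^2u(s)\big]ds$, where $e^{it\partial_x^2}$ is the Fourier multiplier $\widehat{(e^{it\partial_x^2}f)}_k=e^{-itk^2}\hat f_k$. Operators: $\partial_x^{-1}$ is defined by $\widehat{(\partial_x^{-1}f)}_k=(ik)^{-1}\hat f_k$ if $k\ne0$ and $\widehat{(\partial_x^{-1}f)}_0=0$. $P_0f=\hat f_0$ is the zero mode (a number, also regarded as a constant function). For an integer $N\ge1$, $\widehat{(P_Nf)}_k=\hat f_k$ if $|k|\le N$ and $=0$ if $|k|>N$. $S_N$ is the space of $f\in L^2(\mathbb{T})$ with $\hat f_k=0$ for $|k|>N$. $I_{2N}$ is the $(4N+1)$-point trigonometric interpolation operator: $I_{2N}f(x)=\sum_{k=-2N}^{2N}e^{ikx}\tilde f_k$ with $\tilde f_k=\frac1{4N+1}\sum_{n=-2N}^{2N}e^{-ikx_n}f(x_n)$,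 $x_n=\frac{2\pi n}{4N+1}$ (for $f\in H^\gamma$, $\gamma>\frac12$, point values are those of the continuous representative). The numerical flow $\Phi_{\tau,N}:S_N\to S_N$ is $$\begin{aligned}\Phi_{\tau,N}(f)={}&e^{i\tau\partial_x^2}f+\tfrac12\partial_x^{-1}P_N\Big[\big(e^{-i\tau\partial_x^2}\partial_x^{-1}\bar f\big)\cdot e^{i\tau\partial_x^2}P_N\big(f^2\big)\Big]-\tfrac12e^{i\tau\partial_x^2}\partial_x^{-1}P_N\Big[\big(\partial_x^{-1}\bar f\big)\cdot P_N\big(f^2\big)\Big]\\ &-i\tau P_0\Big[\bar f\cdot P_N\big(f^2\big)\Big]-i\tau\Big[e^{i\tau\partial_x^2}P_N\big(f^2\big)-P_0(f^2)\Big]\cdot P_0(\bar f)\\ &+\tfrac12e^{i\tau\partial_x^2}P_N\Big[\bar f\cdot e^{-i\tau\partial_x^2}P_N\Big(\big(e^{i\tau\partial_x^2}\partial_x^{-1}f\big)^2\Big)\Big]-\tfrac12e^{i\tau\partial_x^2}P_N\Big[\bar f\cdot P_N\Big(\big(\partial_x^{-1}f\big)^2\Big)\Big]\\ &+i\tau e^{i\tau\partial_x^2}P_N\Big[\bar f\cdot P_N\big(f^2\big)\Big]-2i\tau\, e^{i\tau\partial_x^2}P_N\big[\bar f\cdot P_Nf\big]\cdot P_0(f)+i\tau\, e^{i\tau\partial_x^2}P_N\bar f\cdot\big(P_0(f)\big)^2.\end{aligned}$$ *)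

theory Defs
  imports "HOL-Analysis.Analysis" "HOL-Probability.Essential_Supremum"
begin

text \<open>
  Functions on the torus are \<open>2\<pi>\<close>-periodic functions \<open>real \<Rightarrow> complex\<close>; elements of
  \<open>L\<^sup>2\<close> and \<open>H\<^sup>s\<close> are represented by arbitrary Borel representatives, and equality of
  such elements is equality almost everywhere.
\<close>

definition fourier_coeff :: "(real \<Rightarrow> complex) \<Rightarrow> int \<Rightarrow> complex" where
  "fourier_coeff f k =
     1 / (2 * pi) * (LINT x:{0..2*pi}|lborel. exp (- (\<i> * of_int k * of_real x)) * f x)"

definition torus_L2_norm :: "(real \<Rightarrow> complex) \<Rightarrow> real" where
  "torus_L2_norm f = sqrt (LINT x:{0..2*pi}|lborel. (cmod (f x))\<^sup>2)"

text \<open>Only for \<open>s \<ge> 0\<close> is this the Sobolev space (for \<open>s < 0\<close> distributions that are not functions in \<open>L\<^sup>2\<close> are missing).\<close>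

definition torus_Hs :: "real \<Rightarrow> (real \<Rightarrow> complex) set" where
  "torus_Hs s = {f. f \<in> borel_measurable borel \<and> (\<forall>x. f (x + 2 * pi) = f x) \<and>
     set_integrable lborel {0..2*pi} (\<lambda>x. (cmod (f x))\<^sup>2) \<and>
     (\<lambda>k::int. (1 + (of_int k)\<^sup>2) powr s * (cmod (fourier_coeff f k))\<^sup>2) summable_on UNIV}"

definition torus_Hs_norm :: "real \<Rightarrow> (real \<Rightarrow> complex) \<Rightarrow> real" where
  "torus_Hs_norm s f =
     sqrt (2 * pi * (\<Sum>\<^sub>\<infinity>k::int. (1 + (of_int k)\<^sup>2) powr s * (cmod (fourier_coeff f k))\<^sup>2))"

text \<open>The norm of \<open>L\<^sup>\<infinity>((0,T); H\<^sup>s)\<close>.\<close>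

definition Linf_Hs_norm :: "real \<Rightarrow> real \<Rightarrow> (real \<Rightarrow> real \<Rightarrow> complex) \<Rightarrow> ereal" where
  "Linf_Hs_norm s T u =
     esssup (restrict_space lborel {0<..<T}) (\<lambda>t. ereal (torus_Hs_norm s (u t)))"

text \<open>
  Fourier multipliers, given by their Fourier series. The infinite sum is the sum of an
  absolutely convergent series; below, multipliers with bounded symbols are only applied to
  functions with absolutely summable Fourier coefficients (trigonometric polynomials, and
  elements of \<open>H\<^sup>\<gamma>\<close> with \<open>\<gamma> > 1/2\<close>), so that the value is the continuous function with
  Fourier coefficients \<open>m k * fourier_coeff f k\<close>.
\<close>

definition fourier_mult :: "(int \<Rightarrow> complex) \<Rightarrow> (real \<Rightarrow> complex) \<Rightarrow> real \<Rightarrow> complex" where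
  "fourier_mult m f x =
     (\<Sum>\<^sub>\<infinity>k::int. m k * fourier_coeff f k * exp (\<i> * of_int k * of_real x))"

text \<open>\<open>schroedinger_group t\<close> is \<open>e\<^bsup>it\<partial>\<^sub>x\<^sub>x\<^esup>\<close>, \<open>dx_inv\<close> is \<open>\<partial>\<^sub>x\<^sup>-\<^sup>1\<close>.\<close>

definition schroedinger_group :: "real \<Rightarrow> (real \<Rightarrow> complex) \<Rightarrow> real \<Rightarrow> complex" where
  "schroedinger_group t = fourier_mult (\<lambda>k. exp (- (\<i> * of_real t * (of_int k)\<^sup>2)))"

definition dx_inv :: "(real \<Rightarrow> complex) \<Rightarrow> real \<Rightarrow> complex" where
  "dx_inv = fourier_mult (\<lambda>k. if k = 0 then 0 else inverse (\<i> * of_int k))"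

definition low_pass :: "nat \<Rightarrow> (real \<Rightarrow> complex) \<Rightarrow> real \<Rightarrow> complex" where
  "low_pass N = fourier_mult (\<lambda>k. if \<bar>k\<bar> \<le> int N then 1 else 0)"

definition zero_mode :: "(real \<Rightarrow> complex) \<Rightarrow> complex" where
  "zero_mode f = fourier_coeff f 0"

definition continuous_rep :: "(real \<Rightarrow> complex) \<Rightarrow> real \<Rightarrow> complex" where
  "continuous_rep f = (THE g. continuous_on UNIV g \<and> (\<forall>x. g (x + 2 * pi) = g x) \<and>
     (AE x in lborel. g x = f x))"

text \<open>
  Trigonometric interpolation at the \<open>2M+1\<close> points \<open>2\<pi>n/(2M+1)\<close>, \<open>\<bar>n\<bar> \<le> M\<close>;
  point values are those of the continuous representative.
\<close>

definition trig_interp :: "nat \<Rightarrow> (real \<Rightarrow> complex) \<Rightarrow> real \<Rightarrow> complex" where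
  "trig_interp M f x =
     (\<Sum>k = - int M..int M. exp (\<i> * of_int k * of_real x) *
        (1 / (2 * of_nat M + 1) *
          (\<Sum>n = - int M..int M.
             let x\<^sub>n = 2 * pi * of_int n / (2 * real M + 1)
             in exp (- (\<i> * of_int k * of_real x\<^sub>n)) * continuous_rep f x\<^sub>n)))"

text \<open>
  The solution of the Cauchy problem \<open>i\<partial>\<^sub>tu + \<partial>\<^sub>x\<^sub>xu = \<bar>u\<bar>\<^sup>2u\<close>, \<open>u(0) = u0\<close> in
  \<open>C([0,T]; H\<^sup>\<gamma>)\<close>, in the sense of Duhamel's formula. For \<open>\<gamma> > 1/2\<close> the integrand of the
  \<open>H\<^sup>\<gamma>\<close>-valued Duhamel integral is continuous in \<open>(s,x)\<close>, so that integral is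
  computed pointwise in \<open>x\<close>. Values \<open>u t\<close> with \<open>t\<close> outside \<open>[0,T]\<close> are irrelevant.
\<close>

definition nls_solution ::
    "real \<Rightarrow> real \<Rightarrow> (real \<Rightarrow> complex) \<Rightarrow> (real \<Rightarrow> real \<Rightarrow> complex) \<Rightarrow> bool" where
  "nls_solution \<gamma> T u0 u \<longleftrightarrow>
     u0 \<in> torus_Hs \<gamma> \<and>
     (\<forall>t\<in>{0..T}. u t \<in> torus_Hs \<gamma>) \<and>
     (\<forall>t\<in>{0..T}. ((\<lambda>s. torus_Hs_norm \<gamma> (\<lambda>x. u s x - u t x)) \<longlongrightarrow> 0) (at t within {0..T})) \<and>
     (AE x in lborel. u 0 x = u0 x) \<and>
     (\<forall>t\<in>{0..T}. AE x in lborel.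
        u t x = schroedinger_group t u0 x -
          \<i> * integral {0..t} (\<lambda>s.
            schroedinger_group (t - s) (\<lambda>y. of_real ((cmod (u s y))\<^sup>2) * u s y) x))"

definition num_flow :: "real \<Rightarrow> nat \<Rightarrow> (real \<Rightarrow> complex) \<Rightarrow> real \<Rightarrow> complex" where
  "num_flow \<tau> N f =
     (let S = schroedinger_group;
          D = dx_inv;
          P = low_pass N;
          P0 = zero_mode;
          fbar = (\<lambda>y. cnj (f y));
          fsq = (\<lambda>y. (f y)\<^sup>2)
      in (\<lambda>x.
          S \<tau> f x
        + 1/2 * D (P (\<lambda>y. S (-\<tau>) (D fbar) y * S \<tau> (P fsq) y)) x
        - 1/2 * S \<tau> (D (P (\<lambda>y. D fbar y * P fsq y))) x
        - \<i> * \<tau> * P0 (\<lambda>y. fbar y * P fsq y)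
        - \<i> * \<tau> * (S \<tau> (P fsq) x - P0 fsq) * P0 fbar
        + 1/2 * S \<tau> (P (\<lambda>y. fbar y * S (-\<tau>) (P (\<lambda>z. (S \<tau> (D f) z)\<^sup>2)) y)) x
        - 1/2 * S \<tau> (P (\<lambda>y. fbar y * P (\<lambda>z. (D f z)\<^sup>2) y)) x
        + \<i> * \<tau> * S \<tau> (P (\<lambda>y. fbar y * P fsq y)) x
        - 2 * \<i> * \<tau> * S \<tau> (P (\<lambda>y. fbar y * P f y)) x * P0 f
        + \<i> * \<tau> * S \<tau> (P fbar) x * (P0 f)\<^sup>2))"

primrec num_solution :: "real \<Rightarrow> nat \<Rightarrow> (real \<Rightarrow> complex) \<Rightarrow> nat \<Rightarrow> real \<Rightarrow> complex" where
  "num_solution \<tau> N u0 0 = low_pass N (trig_interp (2 * N) u0)"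
| "num_solution \<tau> N u0 (Suc n) = num_flow \<tau> N (num_solution \<tau> N u0 n)"

end

theory Submission
  imports Defs
begin

text \<open>
  On the Fourier side the cubic nonlinearity is a sum over \<open>i + j + l = k\<close>, and in the twisted
  unknown \<open>exp (\<i> t k\<^sup>2) u\<^sub>k\<close> each term carries the phase factor \<open>exp (\<i> (A + B))\<close> with \<open>A = 2 s k i\<close> and
  \<open>B = 2 s j l\<close>. One step of the scheme is exactly Duhamel's formula with the twisted unknown frozen at
  the beginning of the step, all frequencies truncated at \<open>N\<close>, and the phase factor replaced by
  \<open>exp (\<i> A) + exp (\<i> B) - 1\<close>. Per unit time, freezing costs \<open>\<tau>\<close> and truncation costs \<open>N powr - \<gamma>\<close>; the phase
  error \<open>(exp (\<i> A) - 1) (exp (\<i> B) - 1)\<close> is \<open>O(\<tau> powr (2 \<alpha>))\<close> times \<open>\<bar>k i j l\<bar> powr \<alpha>\<close>, and Schur's test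
  bounds the resulting trilinear form from \<open>H\<^sup>\<gamma>\<close> to \<open>L\<^sup>2\<close> as soon as \<open>4 \<alpha> < 3 \<gamma> - 1\<close>. This is the origin of
  the order \<open>3 \<gamma> / 2 - 1 / 2 - \<epsilon>\<close>.

  Stability in \<open>L\<^sup>2\<close> needs a bound of the numerical solution in the Wiener algebra. For large \<open>N\<close> it follows
  from a bootstrap on the \<open>l\<^sup>1\<close> error, because in \<open>l\<^sup>1\<close> all local errors are small with some positive power of
  \<open>\<tau>\<close> and \<open>1 / N\<close>. For the remaining finitely many \<open>N\<close> it follows from the mass, which a single step
  increases by at most \<open>O(\<tau>\<^sup>2)\<close>.
\<close>

section \<open>Absolutely convergent Fourier series\<close>

text \<open>The factor exp (\<i> (A + B)) couples all the frequencies in one denominator when it is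
  integrated in time. Each of exp (\<i> A) and exp (\<i> B) alone separates: 2 k i = k^2 + i^2 - (j
  + l)^2 and 2 j l = (j + l)^2 - j^2 - l^2, so their integrals are products of \<open>dx_inv\<close>
  and \<open>schroedinger_group\<close> applied to single factors. Where the denominators vanish,
  the scheme has its zero-mode terms with the factor \<tau>. The obstacle is that \<tau> and N are
  independent and a single \<open>\<tau>\<^sub>0\<close> must serve all N and all \<epsilon>. The
  sharp rate holds in l^2, but there the cubic term is Lipschitz only with an l^1 bound of the
  numerical solution. A second rate, far from sharp and depending on \<gamma> alone, is therefore
  proved in l^1, for the sole purpose of supplying this radius. It is void for small N, where the
  truncation error does not decrease with \<tau>; the mass takes over there because on finitely many
  modes all norms are equivalent. Constants may depend on the solution only through its norm, so
  each of them is a function of \<gamma>, T, m and possibly \<alpha>.\<close>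

definition wave :: "int \<Rightarrow> real \<Rightarrow> complex" where
  "wave k x = exp (\<i> * of_int k * of_real x)"

text \<open>The coefficient sequences of the Wiener algebra. For them Fourier series are pointwise
  sums, products of functions are convolutions, and all sums may be rearranged.\<close>

abbreviation l1 :: "('a \<Rightarrow> 'b::real_normed_vector) \<Rightarrow> bool" where
  "l1 c \<equiv> (\<lambda>k. norm (c k)) summable_on UNIV"

abbreviation l1_norm :: "('a \<Rightarrow> 'b::real_normed_vector) \<Rightarrow> real" where
  "l1_norm c \<equiv> \<Sum>\<^sub>\<infinity>k. norm (c k)"

definition FS :: "(int \<Rightarrow> complex) \<Rightarrow> real \<Rightarrow> complex" where
  "FS c x = (\<Sum>\<^sub>\<infinity>k. c k * wave k x)"

lemma norm_wave [simp]: "norm (wave k x) = 1"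
  by (simp add: wave_def norm_exp_eq_Re)

lemma wave_0 [simp]: "wave 0 x = 1"
  by (simp add: wave_def)

lemma wave_mult: "wave j x * wave k x = wave (j + k) x"
  by (simp add: wave_def exp_add [symmetric] algebra_simps)

lemma cnj_wave: "cnj (wave k x) = wave (- k) x"
  by (simp add: wave_def exp_cnj)

lemma wave_cis: "wave k x = cis (of_int k * x)"
  by (simp add: wave_def cis_conv_exp mult_ac)

lemma wave_periodic: "wave k (x + 2 * pi) = wave k x"
proof -
  have "wave k (x + 2 * pi) = wave k x * cis (2 * pi * of_int k)"
    by (simp add: wave_cis cis_mult distrib_left mult_ac)
  also have "cis (2 * pi * of_int k) = 1"
    by (rule cis_multiple_2pi) auto
  finally show ?thesis by simp
qed

lemma continuous_on_wave [continuous_intros]: "continuous_on A (wave k)"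
  unfolding wave_def by (intro continuous_intros)

lemma measurable_wave [measurable]: "wave k \<in> borel_measurable borel"
  by (rule borel_measurable_continuous_onI) (rule continuous_on_wave)

lemma fourier_coeff_wave:
  "fourier_coeff f k = 1 / (2 * pi) * (LINT x:{0..2*pi}|lborel. wave (- k) x * f x)"
  by (simp add: fourier_coeff_def wave_def)

lemma LINT_continuous:
  fixes f :: "real \<Rightarrow> complex"
  assumes "continuous_on {a..b} f"
  shows "(LINT x:{a..b}|lborel. f x) = integral {a..b} f" "set_integrable lborel {a..b} f"
proof -
  show "set_integrable lborel {a..b} f"
    unfolding set_integrable_def by (rule borel_integrable_compact) (use assms in auto)
  then show "(LINT x:{a..b}|lborel. f x) = integral {a..b} f"
    by (rule set_borel_integral_eq_integral)
qed

lemma integral_wave: "integral {0..2*pi} (wave k) = (if k = 0 then 2 * pi else 0)"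
proof (cases "k = 0")
  case True
  then have "wave k = (\<lambda>_. 1)" by auto
  with True show ?thesis by (simp add: scaleR_conv_of_real)
next
  case False
  have "((\<lambda>x. wave k x) has_integral (wave k (2*pi) / (\<i> * of_int k) - wave k 0 / (\<i> * of_int k))) {0..2*pi}"
  proof (rule fundamental_theorem_of_calculus)
    fix x
    have "((\<lambda>x. exp (\<i> * of_int k * x) / (\<i> * of_int k)) has_field_derivative
        exp (\<i> * of_int k * of_real x)) (at (of_real x))"
      using False by (auto intro!: derivative_eq_intros)
    from has_vector_derivative_real_field[OF this]
    show "((\<lambda>x. wave k x / (\<i> * of_int k)) has_vector_derivative wave k x) (at x within {0..2*pi})"
      by (simp add: wave_def)
  qed simp
  moreover have "wave k (2*pi) = wave k 0"
    using wave_periodic[of k 0] by simp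
  ultimately show ?thesis
    using False by (simp add: integral_unique)
qed

lemma FS_summable:
  assumes "l1 c"
  shows "l1 (\<lambda>k. c k * wave k x)" "(\<lambda>k. c k * wave k x) summable_on UNIV"
  using assms by (auto simp: norm_mult intro: abs_summable_summable)

lemma FS_uniform_limit:
  assumes "l1 c"
  shows "uniform_limit A (\<lambda>X x. \<Sum>k\<in>X. c k * wave k x) (FS c) (finite_subsets_at_top UNIV)"
  unfolding FS_def
  by (rule Weierstrass_m_test_general[where M = "\<lambda>k. norm (c k)"]) (use assms in \<open>auto simp: norm_mult\<close>)

lemma continuous_on_FS:
  assumes "l1 c"
  shows "continuous_on A (FS c)"
  by (rule uniform_limit_theorem[OF _ FS_uniform_limit[OF assms]])
    (auto intro!: always_eventually continuous_intros)

lemma FS_periodic: "FS c (x + 2 * pi) = FS c x"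
  by (simp add: FS_def wave_periodic)

lemma norm_FS_le:
  assumes "l1 c"
  shows "norm (FS c x) \<le> l1_norm c"
  using norm_infsum_bound[OF FS_summable(1)[OF assms], of x] by (simp add: FS_def norm_mult)

lemma measurable_FS:
  assumes "l1 c"
  shows "FS c \<in> borel_measurable borel"
  by (rule borel_measurable_continuous_onI[OF continuous_on_FS[OF assms]])

lemma fourier_coeff_continuous:
  assumes "continuous_on {0..2*pi} f"
  shows "fourier_coeff f k = 1 / (2 * pi) * integral {0..2*pi} (\<lambda>x. wave (- k) x * f x)"
  unfolding fourier_coeff_wave
  by (subst LINT_continuous) (auto intro!: continuous_intros assms)

text \<open>Uniform convergence carries the integral through the net of finite partial sums. By
  orthogonality of the waves the integral equals \<open>2 * pi * c k\<close> once the finite set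
  contains \<open>k\<close>, so the net of integrals is eventually constant.\<close>

lemma fourier_coeff_FS:
  assumes "l1 c"
  shows "fourier_coeff (FS c) k = c k"
proof -
  let ?F = "finite_subsets_at_top (UNIV :: int set)"
  have "uniform_limit {0..2*pi} (\<lambda>X x. \<Sum>j\<in>X. wave (- k) x * (c j * wave j x))
      (\<lambda>x. \<Sum>\<^sub>\<infinity>j. wave (- k) x * (c j * wave j x)) ?F"
    by (rule Weierstrass_m_test_general[where M = "\<lambda>k. norm (c k)"]) (use assms in \<open>auto simp: norm_mult\<close>)
  then have u: "uniform_limit {0..2*pi} (\<lambda>X x. \<Sum>j\<in>X. wave (- k) x * (c j * wave j x))
      (\<lambda>x. wave (- k) x * FS c x) ?F"
    by (simp add: FS_def infsum_cmult_right FS_summable(2)[OF assms])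
  have c: "continuous_on {0..2*pi} (\<lambda>x. \<Sum>j\<in>X. wave (- k) x * (c j * wave j x))" for X
    by (intro continuous_intros)
  from uniform_limit_integral[OF u c finite_subsets_at_top_neq_bot] obtain I J where
    I: "\<And>X. ((\<lambda>x. \<Sum>j\<in>X. wave (- k) x * (c j * wave j x)) has_integral I X) {0..2*pi}" and
    J: "((\<lambda>x. wave (- k) x * FS c x) has_integral J) {0..2*pi}" and lim: "(I \<longlongrightarrow> J) ?F"
    by blast
  have "I X = 2 * pi * c k" if "finite X" "k \<in> X" for X
  proof -
    have "I X = integral {0..2*pi} (\<lambda>x. \<Sum>j\<in>X. wave (- k) x * (c j * wave j x))"
      using I[of X] by (simp add: integral_unique)
    also have "\<dots> = (\<Sum>j\<in>X. integral {0..2*pi} (\<lambda>x. wave (- k) x * (c j * wave j x)))"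
      by (rule integral_sum[OF that(1)])
        (auto intro!: integrable_continuous_interval continuous_intros)
    also have "\<dots> = (\<Sum>j\<in>X. c j * integral {0..2*pi} (wave (j - k)))"
    proof (rule sum.cong[OF refl])
      fix j
      have "(\<lambda>x. wave (- k) x * (c j * wave j x)) = (\<lambda>x. c j * wave (j - k) x)"
        using wave_mult[of "- k" _ j] by (auto simp: mult_ac)
      then show "integral {0..2*pi} (\<lambda>x. wave (- k) x * (c j * wave j x)) =
          c j * integral {0..2*pi} (wave (j - k))"
        by simp
    qed
    also have "\<dots> = 2 * pi * c k"
      using that by (simp add: integral_wave if_distrib cong: if_cong)
    finally show ?thesis .
  qed
  then have "eventually (\<lambda>X. I X = 2 * pi * c k) ?F"
    by (auto simp: eventually_finite_subsets_at_top intro!: exI[of _ "{k}"])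
  then have "(I \<longlongrightarrow> 2 * pi * c k) ?F"
    by (rule tendsto_eventually)
  then have "J = 2 * pi * c k"
    using lim tendsto_unique[OF finite_subsets_at_top_neq_bot] by blast
  then have "integral {0..2*pi} (\<lambda>x. wave (- k) x * FS c x) = 2 * pi * c k"
    using J by (simp add: integral_unique)
  then show ?thesis
    by (subst fourier_coeff_continuous[OF continuous_on_FS[OF assms]]) simp
qed

lemma FS_mult_l: "FS c x * a = FS (\<lambda>k. c k * a) x" 
  using infsum_cmult_left'[of "\<lambda>k. c k * wave k x" a UNIV] by (simp add: FS_def mult_ac)

lemma FS_add:
  assumes "l1 c" "l1 d"
  shows "FS c x + FS d x = FS (\<lambda>k. c k + d k) x"
  unfolding FS_def distrib_right
  by (rule infsum_add[symmetric]) (use assms FS_summable in auto)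

lemma FS_diff:
  assumes "l1 c" "l1 d"
  shows "FS c x - FS d x = FS (\<lambda>k. c k - d k) x"
proof -
  have "FS c x - FS d x = FS c x + FS (\<lambda>k. - d k) x"
    using FS_mult_l[of d x "-1"] by simp
  also have "\<dots> = FS (\<lambda>k. c k - d k) x"
    using FS_add[of c "\<lambda>k. - d k" x] assms by simp
  finally show ?thesis .
qed

lemma cnj_FS: "cnj (FS c x) = FS (\<lambda>k. cnj (c (- k))) x"
proof -
  have "cnj (FS c x) = (\<Sum>\<^sub>\<infinity>k. cnj (c k) * wave (- k) x)"
    by (simp add: FS_def infsum_cnj[symmetric] cnj_wave del: infsum_cnj)
  also have "\<dots> = (\<Sum>\<^sub>\<infinity>k. cnj (c (- k)) * wave k x)"
    by (rule infsum_reindex_bij_witness[of _ uminus uminus]) auto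
  finally show ?thesis by (simp add: FS_def)
qed

lemma abs_summable_reflect:
  fixes c :: "int \<Rightarrow> complex"
  assumes "l1 c"
  shows "l1 (\<lambda>k. cnj (c (- k)))"
proof -
  have "(\<lambda>k. norm (c k)) summable_on UNIV \<longleftrightarrow> (\<lambda>k. norm (cnj (c (- k)))) summable_on UNIV"
    by (rule summable_on_reindex_bij_witness[of _ uminus uminus]) auto
  with assms show ?thesis by simp
qed

section \<open>Uniqueness of Fourier coefficients\<close>

definition null_coeffs :: "(real \<Rightarrow> complex) \<Rightarrow> bool" where
  "null_coeffs h \<longleftrightarrow> set_integrable lborel {0..2*pi} h \<and> (\<forall>k. fourier_coeff h k = 0)"

text \<open>
  These multipliers are closed under products, so they contain the trigonometric polynomials; by
  Stone--Weierstrass, a function with vanishing coefficients is then orthogonal to all continuous functions.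
\<close>

definition preserves_null :: "(real \<Rightarrow> complex) \<Rightarrow> bool" where
  "preserves_null g \<longleftrightarrow> (\<forall>h. null_coeffs h \<longrightarrow> null_coeffs (\<lambda>x. h x * g x))"

lemma set_integrable_mult_bounded:
  fixes h g :: "real \<Rightarrow> complex"
  assumes "set_integrable lborel A h" and g: "g \<in> borel_measurable borel" "\<And>x. norm (g x) \<le> B"
  shows "set_integrable lborel A (\<lambda>x. h x * g x)"
proof -
  have h: "integrable lborel (\<lambda>x. indicator A x *\<^sub>R h x)"
    using assms(1) by (simp add: set_integrable_def)
  have [measurable]: "g \<in> borel_measurable lborel" using g(1) by simp
  have [measurable]: "(\<lambda>x. indicator A x *\<^sub>R h x) \<in> borel_measurable lborel"
    using h by (rule borel_measurable_integrable)
  have "integrable lborel (\<lambda>x. (indicator A x *\<^sub>R h x) * g x)"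
  proof (rule Bochner_Integration.integrable_bound[OF integrable_scaleR_right[OF integrable_norm[OF h], of B]])
    show "(\<lambda>x. (indicator A x *\<^sub>R h x) * g x) \<in> borel_measurable lborel" by measurable
    show "AE x in lborel. norm ((indicator A x *\<^sub>R h x) * g x) \<le> norm (B *\<^sub>R norm (indicator A x *\<^sub>R h x))"
    proof (rule AE_I2)
      fix x
      have "norm (indicator A x *\<^sub>R h x) * norm (g x) \<le> norm (indicator A x *\<^sub>R h x) * \<bar>B\<bar>"
        by (intro mult_left_mono order_trans[OF g(2)]) auto
      then show "norm ((indicator A x *\<^sub>R h x) * g x) \<le> norm (B *\<^sub>R norm (indicator A x *\<^sub>R h x))"
        by (simp add: norm_mult abs_mult mult_ac)
    qed
  qed
  then show ?thesis by (simp add: set_integrable_def)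
qed

lemma set_integrable_wave_mult:
  assumes "set_integrable lborel A h"
  shows "set_integrable lborel A (\<lambda>x. wave k x * h x)"
  using set_integrable_mult_bounded[OF assms, of "wave k" 1] by (simp add: mult.commute)

lemma fourier_coeff_add:
  assumes "set_integrable lborel {0..2*pi} f" "set_integrable lborel {0..2*pi} g"
  shows "fourier_coeff (\<lambda>x. f x + g x) k = fourier_coeff f k + fourier_coeff g k"
  unfolding fourier_coeff_wave distrib_left
  by (subst set_integral_add) (auto intro: set_integrable_wave_mult assms simp: distrib_left)

lemma fourier_coeff_diff:
  assumes "set_integrable lborel {0..2*pi} f" "set_integrable lborel {0..2*pi} g"
  shows "fourier_coeff (\<lambda>x. f x - g x) k = fourier_coeff f k - fourier_coeff g k"
  unfolding fourier_coeff_wave right_diff_distrib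
  by (subst set_integral_diff) (auto intro: set_integrable_wave_mult assms simp: right_diff_distrib)

lemma fourier_coeff_mult_right: "fourier_coeff (\<lambda>x. f x * a) k = fourier_coeff f k * a"
  unfolding fourier_coeff_wave
  by (simp add: mult.assoc [symmetric] set_integral_mult_left)

lemma fourier_coeff_cong_AE:
  assumes "f \<in> borel_measurable borel" "g \<in> borel_measurable borel"
  assumes "AE x in lborel. x \<in> {0..2*pi} \<longrightarrow> f x = g x"
  shows "fourier_coeff f k = fourier_coeff g k"
proof -
  have [measurable]: "f \<in> borel_measurable borel" "g \<in> borel_measurable borel" by fact+
  have "(LINT x:{0..2*pi}|lborel. wave (- k) x * f x) = (LINT x:{0..2*pi}|lborel. wave (- k) x * g x)"
    unfolding set_lebesgue_integral_def
    by (rule integral_cong_AE) (use assms(3) in \<open>auto elim!: eventually_mono simp: indicator_def\<close>)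
  then show ?thesis by (simp add: fourier_coeff_wave)
qed

lemma null_coeffs_add:
  "null_coeffs f \<Longrightarrow> null_coeffs g \<Longrightarrow> null_coeffs (\<lambda>x. f x + g x)"
  by (auto simp: null_coeffs_def fourier_coeff_add)

lemma null_coeffs_mult_right:
  "null_coeffs f \<Longrightarrow> null_coeffs (\<lambda>x. f x * a)"
  by (auto simp: null_coeffs_def fourier_coeff_mult_right intro: set_integrable_mult_left)

text \<open>Multiplication by a wave only shifts the sequence of Fourier coefficients.\<close>

lemma preserves_null_wave: "preserves_null (wave j)"
  unfolding preserves_null_def
proof (intro allI impI)
  fix h assume h: "null_coeffs h"
  have "wave (- k) x * (h x * wave j x) = wave (- (k - j)) x * h x" for k x
    using wave_mult[of "- k" x j] by (simp add: mult_ac)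
  then have "fourier_coeff (\<lambda>x. h x * wave j x) k = fourier_coeff h (k - j)" for k
    by (simp only: fourier_coeff_wave)
  moreover have "set_integrable lborel {0..2*pi} (\<lambda>x. h x * wave j x)"
    using h set_integrable_wave_mult[of _ h j] by (simp add: null_coeffs_def mult.commute)
  ultimately show "null_coeffs (\<lambda>x. h x * wave j x)"
    using h by (auto simp: null_coeffs_def)
qed

lemma preserves_null_add:
  assumes "preserves_null f" "preserves_null g"
  shows "preserves_null (\<lambda>x. f x + g x)"
  unfolding preserves_null_def
proof (intro allI impI)
  fix h assume "null_coeffs h"
  then have "null_coeffs (\<lambda>x. h x * f x)" "null_coeffs (\<lambda>x. h x * g x)"
    using assms by (auto simp: preserves_null_def)
  then show "null_coeffs (\<lambda>x. h x * (f x + g x))"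
    using null_coeffs_add by (simp add: distrib_left)
qed

lemma preserves_null_mult:
  assumes "preserves_null f" "preserves_null g"
  shows "preserves_null (\<lambda>x. f x * g x)"
  unfolding preserves_null_def
proof (intro allI impI)
  fix h assume "null_coeffs h"
  then have "null_coeffs (\<lambda>x. (h x * f x) * g x)"
    using assms by (auto simp: preserves_null_def)
  then show "null_coeffs (\<lambda>x. h x * (f x * g x))" by (simp add: mult.assoc)
qed

lemma preserves_null_const: "preserves_null (\<lambda>x. a)"
  by (simp add: preserves_null_def null_coeffs_mult_right)

lemma preserves_null_trig:
  "preserves_null (\<lambda>x. of_real (cos x))" "preserves_null (\<lambda>x. of_real (sin x))"
proof -
  have "(\<lambda>x. of_real (cos x)) = (\<lambda>x. (wave 1 x + wave (- 1) x) * (1/2))"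
    by (auto simp: wave_cis complex_eq_iff)
  then show "preserves_null (\<lambda>x. of_real (cos x))"
    using preserves_null_mult[OF preserves_null_add[OF preserves_null_wave preserves_null_wave] preserves_null_const,
      of 1 "-1" "1/2"] by simp
  have "(\<lambda>x. of_real (sin x)) = (\<lambda>x. (wave 1 x + wave (- 1) x * (- 1)) * (- \<i> / 2))"
    by (auto simp: wave_cis complex_eq_iff)
  then show "preserves_null (\<lambda>x. of_real (sin x))"
    using preserves_null_mult[OF preserves_null_add[OF preserves_null_wave preserves_null_mult[OF preserves_null_wave preserves_null_const]]
        preserves_null_const, of 1 "-1" "-1" "- \<i> / 2"] by simp
qed

text \<open>Induction over the polynomial: a real linear functional of \<open>cis x\<close> is a
  combination of \<open>cos x\<close> and \<open>sin x\<close>, and the property is closed under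
  sums and products.\<close>

lemma preserves_null_polynomial:
  assumes "real_polynomial_function p"
  shows "preserves_null (\<lambda>x. of_real (p (cis x)))"
  using assms
proof (induction p rule: real_polynomial_function.induct)
  case (linear f)
  then interpret bounded_linear f .
  have "f (cis x) = cos x * f 1 + sin x * f \<i>" for x
  proof -
    have "cis x = cos x *\<^sub>R 1 + sin x *\<^sub>R \<i>" by (simp add: complex_eq_iff)
    then have "f (cis x) = f (cos x *\<^sub>R 1 + sin x *\<^sub>R \<i>)" by simp
    then show ?thesis by (simp only: add scaleR) simp
  qed
  then show ?case
    using preserves_null_add[OF preserves_null_mult[OF preserves_null_trig(1) preserves_null_const]
        preserves_null_mult[OF preserves_null_trig(2) preserves_null_const], of "of_real (f 1)" "of_real (f \<i>)"]
    by simp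
qed (auto intro: preserves_null_const preserves_null_add preserves_null_mult)

text \<open>The test functions are pulled back from the unit circle by \<open>cis\<close>, which
  makes them periodic. A uniform approximation on the circle with error \<open>e\<close> changes the
  integral by at most \<open>e\<close> times the L^1 norm of \<open>h\<close>.\<close>

lemma null_coeffs_continuous:
  fixes \<phi> :: "complex \<Rightarrow> real"
  assumes h: "null_coeffs h" and \<phi>: "continuous_on UNIV \<phi>"
  shows "(LINT x:{0..2*pi}|lborel. h x * of_real (\<phi> (cis x))) = 0"
proof -
  define B where "B = (LINT x:{0..2*pi}|lborel. norm (h x))"
  have hi: "set_integrable lborel {0..2*pi} h"
    using h by (simp add: null_coeffs_def)
  have hn: "set_integrable lborel {0..2*pi} (\<lambda>x. norm (h x))"
    using set_integrable_norm[OF hi] .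
  have cc: "continuous_on UNIV (\<lambda>x. complex_of_real (\<psi> (cis x)))" if "continuous_on UNIV \<psi>" for \<psi> :: "complex \<Rightarrow> real"
    by (intro continuous_intros continuous_on_compose2[OF that]) auto
  have m: "(\<lambda>x. complex_of_real (\<psi> (cis x))) \<in> borel_measurable borel" if "continuous_on UNIV \<psi>" for \<psi> :: "complex \<Rightarrow> real"
    using cc[OF that] by (rule borel_measurable_continuous_onI)
  have bd: "\<exists>C. \<forall>x. norm (complex_of_real (\<psi> (cis x))) \<le> C" if "continuous_on UNIV \<psi>" for \<psi> :: "complex \<Rightarrow> real"
  proof -
    have "compact (\<psi> ` sphere 0 1)"
      by (intro compact_continuous_image continuous_on_subset[OF that]) auto
    then obtain C where "\<And>y. y \<in> \<psi> ` sphere 0 1 \<Longrightarrow> norm y \<le> C"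
      by (metis compact_imp_bounded bounded_iff)
    then show ?thesis by (intro exI[of _ C]) auto
  qed
  have "norm (LINT x:{0..2*pi}|lborel. h x * of_real (\<phi> (cis x))) \<le> e * B" if e: "e > 0" for e
  proof -
    obtain p where p: "real_polynomial_function p" "\<And>z. z \<in> sphere 0 1 \<Longrightarrow> \<bar>\<phi> z - p z\<bar> < e"
    proof (rule Stone_Weierstrass_real_polynomial_function[of "sphere 0 1" \<phi> e])
      show "continuous_on (sphere 0 1) \<phi>" by (rule continuous_on_subset[OF \<phi> subset_UNIV])
    qed (use e in auto)
    have pc: "continuous_on UNIV p"
      by (rule continuous_on_polymonial_function) (use p(1) real_polynomial_function_eq in auto)
    have d: "continuous_on UNIV (\<lambda>z. \<phi> z - p z)"
      by (intro continuous_intros pc \<phi>)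
    have ip: "set_integrable lborel {0..2*pi} (\<lambda>x. h x * of_real (p (cis x)))"
      using bd[OF pc] set_integrable_mult_bounded[OF hi m[OF pc]] by blast
    have i\<phi>: "set_integrable lborel {0..2*pi} (\<lambda>x. h x * of_real (\<phi> (cis x)))"
      using bd[OF \<phi>] set_integrable_mult_bounded[OF hi m[OF \<phi>]] by blast
    have "null_coeffs (\<lambda>x. h x * of_real (p (cis x)))"
      using preserves_null_polynomial[OF p(1)] h by (simp add: preserves_null_def)
    then have "fourier_coeff (\<lambda>x. h x * of_real (p (cis x))) 0 = 0"
      by (simp add: null_coeffs_def)
    then have "(LINT x:{0..2*pi}|lborel. h x * of_real (p (cis x))) = 0"
      by (simp add: fourier_coeff_wave)
    then have "(LINT x:{0..2*pi}|lborel. h x * of_real (\<phi> (cis x))) =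
        (LINT x:{0..2*pi}|lborel. h x * of_real (\<phi> (cis x)) - h x * of_real (p (cis x)))"
      by (simp add: set_integral_diff(2)[OF i\<phi> ip])
    also have "norm \<dots> \<le> (LINT x:{0..2*pi}|lborel. norm (h x * of_real (\<phi> (cis x)) - h x * of_real (p (cis x))))"
      by (rule set_integral_norm_bound) (rule set_integral_diff(1)[OF i\<phi> ip])
    also have "\<dots> \<le> (LINT x:{0..2*pi}|lborel. e * norm (h x))"
    proof (rule set_integral_mono)
      show "set_integrable lborel {0..2*pi} (\<lambda>x. norm (h x * of_real (\<phi> (cis x)) - h x * of_real (p (cis x))))"
        by (rule set_integrable_norm) (rule set_integral_diff(1)[OF i\<phi> ip])
      show "set_integrable lborel {0..2*pi} (\<lambda>x. e * norm (h x))"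
        using hn by (rule set_integrable_mult_right)
      fix x
      have "norm (h x * of_real (\<phi> (cis x)) - h x * of_real (p (cis x))) = norm (h x) * \<bar>\<phi> (cis x) - p (cis x)\<bar>"
        by (simp add: right_diff_distrib[symmetric] norm_mult flip: of_real_diff)
      also have "\<dots> \<le> norm (h x) * e"
        using p(2)[of "cis x"] by (intro mult_left_mono) auto
      finally show "norm (h x * of_real (\<phi> (cis x)) - h x * of_real (p (cis x))) \<le> e * norm (h x)"
        by (simp add: mult.commute)
    qed
    also have "\<dots> = e * B" by (simp add: B_def)
    finally show ?thesis .
  qed
  then have le: "norm (LINT x:{0..2*pi}|lborel. h x * of_real (\<phi> (cis x))) \<le> e * B" if "e > 0" for e
    using that by blast
  have "B \<ge> 0" unfolding B_def set_lebesgue_integral_def by (rule Bochner_Integration.integral_nonneg) auto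
  have "norm (LINT x:{0..2*pi}|lborel. h x * of_real (\<phi> (cis x))) \<le> 0"
  proof (rule field_le_epsilon)
    fix e :: real assume "e > 0"
    \<comment> \<open>The denominator \<open>B + 1\<close> avoids a case distinction for
      \<open>B = 0\<close>.\<close>
    have "e / (B + 1) * B \<le> e" using \<open>B \<ge> 0\<close> \<open>e > 0\<close> by (simp add: field_simps)
    then show "norm (LINT x:{0..2*pi}|lborel. h x * of_real (\<phi> (cis x))) \<le> 0 + e"
      using le[of "e / (B + 1)"] \<open>B \<ge> 0\<close> \<open>e > 0\<close> by simp
  qed
  then show ?thesis by simp
qed

text \<open>The indicator of a closed set is the pointwise limit of the continuous cutoffs
  \<open>\<phi> n\<close>, and the norm of \<open>h\<close> dominates. The set has to be nonempty
  because \<open>infdist\<close> to the empty set is 0, which would not be positive off the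
  set.\<close>

lemma null_coeffs_closed:
  assumes h: "null_coeffs h" and S: "closed S" "S \<noteq> {}"
  shows "(LINT x:{0..2*pi}|lborel. h x * indicator S (cis x)) = 0"
proof -
  have hi: "integrable lborel (\<lambda>x. indicator {0..2*pi} x *\<^sub>R h x)"
    using h by (simp add: null_coeffs_def set_integrable_def)
  define \<phi> where "\<phi> n z = max 0 (1 - real n * infdist z S)" for n :: nat and z
  have c: "continuous_on UNIV (\<phi> n)" for n
    unfolding \<phi>_def by (intro continuous_intros)
  have mc: "(\<lambda>x. complex_of_real (\<phi> n (cis x))) \<in> borel_measurable borel" for n
    by (rule borel_measurable_continuous_onI) (intro continuous_intros continuous_on_compose2[OF c], auto)
  have lim: "(\<lambda>n. \<phi> n z) \<longlonglongrightarrow> indicator S z" for z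
  proof (cases "z \<in> S")
    case True
    then show ?thesis by (simp add: \<phi>_def)
  next
    case False
    then have "infdist z S > 0" using S by (simp add: infdist_pos_not_in_closed)
    then obtain n0 :: nat where n0: "real n0 * infdist z S > 1"
      using reals_Archimedean3 by blast
    have "\<phi> n z = 0" if "n \<ge> n0" for n
    proof -
      have "real n0 * infdist z S \<le> real n * infdist z S"
        using that by (intro mult_right_mono) (auto simp: infdist_nonneg)
      with n0 show ?thesis by (simp add: \<phi>_def)
    qed
    then have "eventually (\<lambda>n. \<phi> n z = 0) sequentially" by (auto simp: eventually_at_top_linorder)
    then show ?thesis using False by (simp add: tendsto_eventually)
  qed
  have ind: "indicator S z = (of_real (indicator S z) :: complex)" for z by (simp add: indicator_def)
  have "(\<lambda>n. LINT x|lborel. indicator {0..2*pi} x *\<^sub>R (h x * of_real (\<phi> n (cis x))))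
      \<longlonglongrightarrow> (LINT x|lborel. indicator {0..2*pi} x *\<^sub>R (h x * indicator S (cis x)))"
  proof (rule integral_dominated_convergence)
    have [measurable]: "(\<lambda>x. indicator {0..2*pi} x *\<^sub>R h x) \<in> borel_measurable lborel"
      using hi by (rule borel_measurable_integrable)
    have [measurable]: "cis \<in> borel_measurable borel"
      by (rule borel_measurable_continuous_onI) (intro continuous_intros)
    have [measurable]: "S \<in> sets borel" using S(1) by simp
    have "(\<lambda>x. (indicator {0..2*pi} x *\<^sub>R h x) * indicator S (cis x)) \<in> borel_measurable lborel"
      by measurable
    then show "(\<lambda>x. indicator {0..2*pi} x *\<^sub>R (h x * indicator S (cis x))) \<in> borel_measurable lborel"
      by simp
    have [measurable]: "(\<lambda>x. complex_of_real (\<phi> n (cis x))) \<in> borel_measurable borel" for n by (rule mc)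
    have "(\<lambda>x. (indicator {0..2*pi} x *\<^sub>R h x) * of_real (\<phi> n (cis x))) \<in> borel_measurable lborel" for n
      by measurable
    then show "(\<lambda>x. indicator {0..2*pi} x *\<^sub>R (h x * of_real (\<phi> n (cis x)))) \<in> borel_measurable lborel" for n
      by simp
    show "integrable lborel (\<lambda>x. norm (indicator {0..2*pi} x *\<^sub>R h x))"
      using hi by (rule integrable_norm)
    show "AE x in lborel. (\<lambda>n. indicator {0..2*pi} x *\<^sub>R (h x * of_real (\<phi> n (cis x)))) \<longlonglongrightarrow>
        indicator {0..2*pi} x *\<^sub>R (h x * indicator S (cis x))"
      unfolding ind by (intro AE_I2 tendsto_intros lim)
    fix n
    show "AE x in lborel. norm (indicator {0..2*pi} x *\<^sub>R (h x * of_real (\<phi> n (cis x)))) \<le> norm (indicator {0..2*pi} x *\<^sub>R h x)"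
    proof (rule AE_I2)
      fix x
      have "\<bar>\<phi> n (cis x)\<bar> \<le> 1" by (auto simp: \<phi>_def infdist_nonneg)
      then show "norm (indicator {0..2*pi} x *\<^sub>R (h x * of_real (\<phi> n (cis x)))) \<le> norm (indicator {0..2*pi} x *\<^sub>R h x)"
        by (auto simp: norm_mult indicator_def intro: mult_left_le)
    qed
  qed
  moreover have "(LINT x|lborel. indicator {0..2*pi} x *\<^sub>R (h x * of_real (\<phi> n (cis x)))) = 0" for n
    using null_coeffs_continuous[OF h c, of n] by (simp add: set_lebesgue_integral_def)
  ultimately show ?thesis
    by (simp add: set_lebesgue_integral_def LIMSEQ_const_iff)
qed

lemma cis_inj_on: "inj_on cis {0..<2*pi}"
proof (rule inj_onI)
  fix x y assume xy: "x \<in> {0..<2*pi}" "y \<in> {0..<2*pi}" "cis x = cis y"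
  then have "sin y = sin x \<and> cos y = cos x" by (auto simp: complex_eq_iff)
  then obtain n :: int where n: "y = x + 2 * pi * n" using sin_cos_eq_iff by blast
  then have "\<bar>2 * pi * of_int n\<bar> < 2 * pi" using xy by auto
  then have "\<bar>n\<bar> < 1" by (simp add: abs_mult)
  then show "x = y" using n by simp
qed

text \<open>Within one period a half-line is the preimage under \<open>cis\<close> of a closed arc,
  so the restriction \<open>g\<close> of \<open>h\<close> to the period has vanishing integral over
  every half-line. Half-lines are stable under intersection and generate the Borel sets; hence all
  Borel integrals of \<open>g\<close> vanish, and \<open>g\<close> is zero almost
  everywhere.\<close>

theorem null_coeffs_AE:
  assumes h: "null_coeffs h"
  shows "AE x in lborel. x \<in> {0..2*pi} \<longrightarrow> h x = 0"
proof -
  define g where "g x = indicator {0..2*pi} x *\<^sub>R h x" for x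
  have gi: "integrable lborel g"
    using h by (simp add: null_coeffs_def set_integrable_def g_def[abs_def])
  have [measurable]: "g \<in> borel_measurable lborel" using gi by (rule borel_measurable_integrable)
  have all: "(LINT x|lborel. g x) = 0"
    using null_coeffs_closed[OF h, of UNIV] by (simp add: set_lebesgue_integral_def g_def)
  have sub: "set_integrable lborel A g" if "A \<in> sets borel" for A
    unfolding set_integrable_def using gi that by (intro integrable_mult_indicator) auto
  have init: "(LINT x:{..a}|lborel. g x) = 0" for a
  proof -
    consider "a < 0" | "0 \<le> a" "a < 2*pi" | "a \<ge> 2*pi" by linarith
    then show ?thesis
    proof cases
      case 1
      then have "(LINT x:{..a}|lborel. g x) = (LINT x:{..a}|lborel. 0)"
        unfolding set_lebesgue_integral_def
        by (intro Bochner_Integration.integral_cong) (auto simp: g_def indicator_def)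
      then show ?thesis by simp
    next
      case 3
      then have "(LINT x:{..a}|lborel. g x) = (LINT x|lborel. g x)"
        unfolding set_lebesgue_integral_def
        by (intro Bochner_Integration.integral_cong) (auto simp: g_def indicator_def)
      then show ?thesis using all by simp
    next
      case 2
      define S where "S = cis ` {0..a}"
      have S: "closed S" "S \<noteq> {}"
        unfolding S_def using 2 by (auto intro!: compact_imp_closed compact_continuous_image continuous_intros)
      have cisS: "cis x \<in> S \<longleftrightarrow> x \<le> a" if "x \<in> {0..2*pi}" "x \<noteq> 2*pi" for x
      proof
        assume "cis x \<in> S"
        then obtain y where y: "y \<in> {0..a}" "cis x = cis y" by (auto simp: S_def)
        with that 2 have "x = y" by (intro inj_onD[OF cis_inj_on]) auto
        with y show "x \<le> a" by simp
      qed (use that in \<open>auto simp: S_def\<close>)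
      have [measurable]: "cis \<in> borel_measurable borel"
        by (rule borel_measurable_continuous_onI) (intro continuous_intros)
      have [measurable]: "S \<in> sets borel" using S(1) by simp
      have m: "(\<lambda>x. g x * indicator S (cis x)) \<in> borel_measurable lborel"
        by measurable
      have "(LINT x:{..a}|lborel. g x) = (LINT x|lborel. g x * indicator S (cis x))"
        unfolding set_lebesgue_integral_def
      proof (rule integral_cong_AE)
        show "AE x in lborel. indicator {..a} x *\<^sub>R g x = g x * indicator S (cis x)"
          \<comment> \<open>At \<open>x = 2*pi\<close> the point \<open>cis x\<close> is back at the
            start of the arc although \<open>x > a\<close>. This single point is a null set.\<close>
          using AE_lborel_singleton[of "2*pi"]
        proof eventually_elim
          case (elim x)
          then show ?case using cisS[of x] by (auto simp: g_def indicator_def)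
        qed
      qed (use m in measurable)
      also have "\<dots> = 0"
        using null_coeffs_closed[OF h S] by (simp add: set_lebesgue_integral_def g_def)
      finally show ?thesis .
    qed
  qed
  have z: "(LINT x:A|lborel. g x) = 0" if A: "A \<in> sets borel" for A
  proof -
    have ms: "A \<in> sigma_sets UNIV (range (\<lambda>a::real. {..a}))"
      using A by (subst (asm) borel_eq_atMost) simp
    have st: "Int_stable (range (\<lambda>a::real. {..a}))"
      by (auto simp: Int_stable_def)
    have su: "range (\<lambda>a::real. {..a}) \<subseteq> Pow UNIV" by simp
    from st su ms show ?thesis
    proof (induction rule: sigma_sets_induct_disjoint)
      case (compl A)
      then have A: "A \<in> sets borel" by (subst borel_eq_atMost) simp
      have "(LINT x:A \<union> (UNIV - A)|lborel. g x) = (LINT x:A|lborel. g x) + (LINT x:UNIV - A|lborel. g x)"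
        by (rule set_integral_Un) (use A sub in auto)
      then show ?case using all compl by (simp add: set_lebesgue_integral_def)
    next
      case (union A)
      then have A: "A i \<in> sets borel" for i by (subst borel_eq_atMost) auto
      have "(LINT x:(\<Union>i. A i)|lborel. g x) = (\<Sum>i. (LINT x:(A i)|lborel. g x))"
        by (rule lebesgue_integral_countable_add)
          (use union A sub in \<open>auto simp: disjoint_family_on_def\<close>)
      then show ?case using union by simp
    qed (auto simp: init[unfolded set_lebesgue_integral_def] set_lebesgue_integral_def)
  qed
  have "AE x in lborel. g x = 0"
    by (rule sigma_finite_measure.density_zero[OF lborel.sigma_finite_measure_axioms gi]) (use z in auto)
  then show ?thesis by eventually_elim (auto simp: g_def indicator_def split: if_splits)
qed

text \<open>A point where \<open>f\<close> and \<open>g\<close> differ is moved into the base period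
  by an integer multiple of \<open>2*pi\<close>, and countably many translates of a null set still
  form a null set.\<close>

lemma AE_periodic:
  fixes f g :: "real \<Rightarrow> complex"
  assumes "AE x in lborel. x \<in> {0..2*pi} \<longrightarrow> f x = g x"
    and f: "\<And>x. f (x + 2*pi) = f x" and g: "\<And>x. g (x + 2*pi) = g x"
  shows "AE x in lborel. f x = g x"
proof -
  obtain N where N: "{x \<in> space lborel. \<not> (x \<in> {0..2*pi} \<longrightarrow> f x = g x)} \<subseteq> N" "N \<in> null_sets lborel"
    using assms(1) unfolding eventually_ae_filter by blast
  have per: "f (x + 2*pi * of_int n) = f x" if f: "\<And>x. f (x + 2*pi) = f x" for f :: "real \<Rightarrow> complex" and n x
  proof (induction n rule: int_induct[where k = 0])
    case (step1 i)
    then show ?case using f[of "x + 2*pi * of_int i"] by (simp add: algebra_simps)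
  next
    case (step2 i)
    then show ?case using f[of "x + 2*pi * of_int (i-1)"] by (simp add: algebra_simps)
  qed simp
  have "(\<Union>n::int. {x. x - 2*pi * of_int n \<in> N}) \<in> null_sets lborel"
    by (intro null_sets_UN' null_sets_translation N(2)) auto
  moreover have "{x \<in> space lborel. f x \<noteq> g x} \<subseteq> (\<Union>n::int. {x. x - 2*pi * of_int n \<in> N})"
  proof
    fix x assume x: "x \<in> {x \<in> space lborel. f x \<noteq> g x}"
    define n where "n = \<lfloor>x / (2*pi)\<rfloor>"
    define y where "y = x - 2*pi * of_int n"
    have "of_int n \<le> x / (2*pi)" "x / (2*pi) < of_int n + 1" by (auto simp: n_def)
    then have "y \<in> {0..2*pi}" by (auto simp: y_def field_simps)
    moreover have "f y = f x" "g y = g x"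
      using per[of f y n, OF f] per[of g y n, OF g] by (auto simp: y_def)
    ultimately have "y \<in> N" using N(1) x by auto
    then show "x \<in> (\<Union>n::int. {x. x - 2*pi * of_int n \<in> N})" by (auto simp: y_def)
  qed
  ultimately show ?thesis by (rule AE_I')
qed

section \<open>Products of Fourier series and Sobolev functions\<close>

text \<open>An absolutely convergent family may be summed first over each level set of \<sigma>.
  With \<sigma> the sum of the frequencies, the level set of \<open>k\<close> collects all products
  of waves that contribute to the output frequency \<open>k\<close>.\<close>

lemma summable_on_fibres:
  fixes F :: "'a \<Rightarrow> 'b::banach" and \<sigma> :: "'a \<Rightarrow> 'k"
  assumes "l1 F"
  shows "F summable_on {q. \<sigma> q = k}"
    and "(\<lambda>q. norm (F q)) summable_on {q. \<sigma> q = k}"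
    and "((\<lambda>k. infsum F {q. \<sigma> q = k}) has_sum infsum F UNIV) UNIV"
    and "l1 (\<lambda>k. infsum F {q. \<sigma> q = k})"
    and "l1_norm (\<lambda>k. infsum F {q. \<sigma> q = k}) \<le> (\<Sum>\<^sub>\<infinity>q. norm (F q))"
proof -
  \<comment> \<open>Stated for an arbitrary Banach space because it is applied both to
    \<open>F\<close> and to the real family of its norms.\<close>
  have G: "((\<lambda>k. infsum G {q. \<sigma> q = k}) has_sum infsum G UNIV) UNIV"
    if "l1 G" for G :: "'a \<Rightarrow> 'c::banach"
  proof (rule has_sum_SigmaD[where B = "\<lambda>k. {q. \<sigma> q = k}" and f = "\<lambda>(k, q). G q"])
    have "(G has_sum infsum G UNIV) UNIV"
      using that by (intro has_sum_infsum) (rule abs_summable_summable)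
    also have "?this \<longleftrightarrow> ((\<lambda>(k, q). G q) has_sum infsum G UNIV) (Sigma UNIV (\<lambda>k. {q. \<sigma> q = k}))"
      by (rule has_sum_reindex_bij_witness[of _ snd "\<lambda>q. (\<sigma> q, q)"]) auto
    finally show "((\<lambda>(k, q). G q) has_sum infsum G UNIV) (Sigma UNIV (\<lambda>k. {q. \<sigma> q = k}))" .
    fix k
    have "G summable_on {q. \<sigma> q = k}"
      using abs_summable_summable[OF that] summable_on_subset_banach by blast
    then show "((\<lambda>q. case (k, q) of (k, q) \<Rightarrow> G q) has_sum infsum G {q. \<sigma> q = k}) {q. \<sigma> q = k}"
      by simp
  qed
  show "F summable_on {q. \<sigma> q = k}" for k
    using abs_summable_summable[OF assms] summable_on_subset_banach by blast
  show n: "(\<lambda>q. norm (F q)) summable_on {q. \<sigma> q = k}" for k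
    using assms summable_on_subset_banach by blast
  show "((\<lambda>k. infsum F {q. \<sigma> q = k}) has_sum infsum F UNIV) UNIV"
    by (rule G[OF assms])
  have N: "((\<lambda>k. infsum (\<lambda>q. norm (F q)) {q. \<sigma> q = k}) has_sum (\<Sum>\<^sub>\<infinity>q. norm (F q))) UNIV"
    by (rule G) (use assms in simp)
  show L: "l1 (\<lambda>k. infsum F {q. \<sigma> q = k})"
    by (rule Infinite_Sum.abs_summable_on_comparison_test'[OF has_sum_imp_summable[OF N]])
      (rule norm_infsum_bound[OF n])
  show "l1_norm (\<lambda>k. infsum F {q. \<sigma> q = k}) \<le> (\<Sum>\<^sub>\<infinity>q. norm (F q))"
    using has_sum_mono[OF has_sum_infsum[OF L] N] norm_infsum_bound[OF n] by blast
qed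

lemma has_sum_product:
  fixes f :: "'a \<Rightarrow> 'c::{real_normed_field,banach}" and g :: "'b \<Rightarrow> 'c"
  assumes "l1 f" "l1 g"
  shows "l1 (\<lambda>(i,j). f i * g j)"
    and "((\<lambda>(i,j). f i * g j) has_sum (infsum f UNIV * infsum g UNIV)) UNIV"
proof -
  have "(\<lambda>p. norm (case p of (i,j) \<Rightarrow> f i * g j)) summable_on (SIGMA i:UNIV. UNIV)"
  proof (subst Infinite_Sum.abs_summable_on_Sigma_iff, intro conjI ballI)
    fix i
    show "(\<lambda>j. norm (case (i, j) of (i,j) \<Rightarrow> f i * g j)) summable_on UNIV"
      using assms(2) by (auto simp: norm_mult intro: summable_on_cmult_right)
    have "(\<lambda>i. norm (f i) * (\<Sum>\<^sub>\<infinity>j. norm (g j))) summable_on UNIV"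
      using assms(1) by (rule summable_on_cmult_left)
    then show "(\<lambda>i. norm (\<Sum>\<^sub>\<infinity>j. norm (case (i, j) of (i,j) \<Rightarrow> f i * g j))) summable_on UNIV"
      by (simp add: norm_mult infsum_cmult_right' abs_mult infsum_nonneg)
  qed
  then show s: "l1 (\<lambda>(i,j). f i * g j)" by simp
  have "infsum (\<lambda>(i,j). f i * g j) UNIV = infsum f UNIV * infsum g UNIV"
    using infsum_Sigma_banach[of "\<lambda>(i,j). f i * g j" UNIV "\<lambda>_. UNIV"] abs_summable_summable[OF s]
    by (simp add: infsum_cmult_right' infsum_cmult_left')
  then show "((\<lambda>(i,j). f i * g j) has_sum (infsum f UNIV * infsum g UNIV)) UNIV"
    using abs_summable_summable[OF s] by (metis has_sum_infsum)
qed

lemma has_sum_product3: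
  fixes f :: "'a \<Rightarrow> 'c::{real_normed_field,banach}" and g :: "'b \<Rightarrow> 'c" and h :: "'d \<Rightarrow> 'c"
  assumes "l1 f" "l1 g" "l1 h"
  shows "l1 (\<lambda>(i,j,l). f i * g j * h l)"
    and "((\<lambda>(i,j,l). f i * g j * h l) has_sum (infsum f UNIV * infsum g UNIV * infsum h UNIV)) UNIV"
proof -
  note gh = has_sum_product[OF assms(2,3)]
  have eq: "(\<lambda>(i,j,l). f i * g j * h l) = (\<lambda>(i,p). f i * (case p of (j,l) \<Rightarrow> g j * h l))"
    by (auto simp: mult.assoc)
  show "l1 (\<lambda>(i,j,l). f i * g j * h l)"
    unfolding eq by (rule has_sum_product(1)[OF assms(1) gh(1)])
  show "((\<lambda>(i,j,l). f i * g j * h l) has_sum (infsum f UNIV * infsum g UNIV * infsum h UNIV)) UNIV"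
    using has_sum_product(2)[OF assms(1) gh(1)]
    by (simp only: eq infsumI[OF gh(2)] mult.assoc[of "infsum f UNIV"])
qed

text \<open>A sum over a fibre of pairs rather than over one index, so that
  \<open>summable_on_fibres\<close> applies directly. \<open>tri\<close> has the same form.\<close>

definition conv :: "(int \<Rightarrow> complex) \<Rightarrow> (int \<Rightarrow> complex) \<Rightarrow> int \<Rightarrow> complex" where
  "conv a b k = (\<Sum>\<^sub>\<infinity>(i,j)\<in>{p. fst p + snd p = k}. a i * b j)"

definition triples :: "int \<Rightarrow> (int \<times> int \<times> int) set" where
  "triples k = {(i,j,l). i + j + l = k}"

definition tri :: "(int \<Rightarrow> complex) \<Rightarrow> (int \<Rightarrow> complex) \<Rightarrow> (int \<Rightarrow> complex) \<Rightarrow> int \<Rightarrow> complex" where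
  "tri a b c k = (\<Sum>\<^sub>\<infinity>(i,j,l)\<in>triples k. a i * b j * c l)"

lemma triples_fibre: "triples k = {q. (case q of (i,j,l) \<Rightarrow> i + j + l) = k}"
  by (auto simp: triples_def)

lemma l1_mult_wave: "l1 a \<Longrightarrow> l1 (\<lambda>k. a k * wave k x)"
  by (simp add: norm_mult)

lemma l1_conv: "l1 a \<Longrightarrow> l1 b \<Longrightarrow> l1 (conv a b)"
  using summable_on_fibres(4)[OF has_sum_product(1), of a b "\<lambda>p. fst p + snd p"]
  by (simp add: conv_def[abs_def])

lemma FS_conv:
  assumes "l1 a" "l1 b"
  shows "FS a x * FS b x = FS (conv a b) x"
proof -
  let ?F = "\<lambda>(i,j). (a i * wave i x) * (b j * wave j x)"
  note p = has_sum_product[OF l1_mult_wave[OF assms(1), of x] l1_mult_wave[OF assms(2), of x]]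
  have "FS a x * FS b x = infsum ?F UNIV"
    using infsumI[OF p(2)] by (simp add: FS_def)
  also have "\<dots> = (\<Sum>\<^sub>\<infinity>k. infsum ?F {p. fst p + snd p = k})"
    using infsumI[OF summable_on_fibres(3)[OF p(1), of "\<lambda>p. fst p + snd p"]] by simp
  also have "(\<lambda>k. infsum ?F {p. fst p + snd p = k}) = (\<lambda>k. conv a b k * wave k x)"
  proof
    fix k
    have "infsum ?F {p. fst p + snd p = k} = infsum (\<lambda>p. (case p of (i,j) \<Rightarrow> a i * b j) * wave k x) {p. fst p + snd p = k}"
      by (rule infsum_cong) (auto simp: wave_mult[symmetric] mult_ac)
    then show "infsum ?F {p. fst p + snd p = k} = conv a b k * wave k x"
      by (simp add: conv_def infsum_cmult_left')
  qed
  finally show ?thesis by (simp add: FS_def)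
qed

lemma l1_tri: "l1 a \<Longrightarrow> l1 b \<Longrightarrow> l1 c \<Longrightarrow> l1 (tri a b c)"
  using summable_on_fibres(4)[OF has_sum_product3(1), of a b c "\<lambda>(i,j,l). i + j + l"]
  by (simp add: tri_def[abs_def] triples_fibre)

lemma FS_tri:
  assumes "l1 a" "l1 b" "l1 c"
  shows "FS a x * FS b x * FS c x = FS (tri a b c) x"
proof -
  let ?F = "\<lambda>(i,j,l). (a i * wave i x) * (b j * wave j x) * (c l * wave l x)"
  note p = has_sum_product3[OF l1_mult_wave[OF assms(1), of x] l1_mult_wave[OF assms(2), of x] l1_mult_wave[OF assms(3), of x]]
  have "FS a x * FS b x * FS c x = infsum ?F UNIV"
    using infsumI[OF p(2)] by (simp add: FS_def)
  also have "\<dots> = (\<Sum>\<^sub>\<infinity>k. infsum ?F (triples k))"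
    using infsumI[OF summable_on_fibres(3)[OF p(1), of "\<lambda>(i,j,l). i + j + l"]] by (simp add: triples_fibre)
  also have "(\<lambda>k. infsum ?F (triples k)) = (\<lambda>k. tri a b c k * wave k x)"
  proof
    fix k
    have "infsum ?F (triples k) = infsum (\<lambda>q. (case q of (i,j,l) \<Rightarrow> a i * b j * c l) * wave k x) (triples k)"
      by (rule infsum_cong) (auto simp: triples_def wave_mult[symmetric] mult_ac)
    then show "infsum ?F (triples k) = tri a b c k * wave k x"
      by (simp add: tri_def infsum_cmult_left')
  qed
  finally show ?thesis by (simp add: FS_def)
qed

lemma l1_square_summable:
  fixes c :: "'a \<Rightarrow> complex"
  assumes "l1 c"
  shows "(\<lambda>k. (norm (c k))\<^sup>2) summable_on UNIV"
proof (rule summable_on_comparison_test)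
  define B where "B = l1_norm c"
  show "(\<lambda>k. B * norm (c k)) summable_on UNIV" using assms by (rule summable_on_cmult_right)
  fix k
  have "norm (c k) \<le> B"
    using finite_sum_le_infsum[OF assms, of "{k}"] by (simp add: B_def)
  then show "(norm (c k))\<^sup>2 \<le> B * norm (c k)"
    by (simp add: power2_eq_square mult_right_mono)
qed auto

text \<open>The function \<open>(cmod (FS c x))\<^sup>2\<close> is again an absolutely convergent
  series, whose coefficients are the convolution of \<open>c\<close> with its conjugate reflection.
  Its integral is read off from the zero mode, which is the sum of the squares.\<close>

lemma parseval:
  assumes "l1 c"
  shows "(LINT x:{0..2*pi}|lborel. (cmod (FS c x))\<^sup>2) = 2 * pi * (\<Sum>\<^sub>\<infinity>k. (cmod (c k))\<^sup>2)"
proof -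
  let ?d = "\<lambda>k. cnj (c (- k))"
  have d: "l1 ?d" by (rule abs_summable_reflect[OF assms])
  have sq: "of_real ((cmod (FS c x))\<^sup>2) = FS (conv c ?d) x" for x
    using FS_conv[OF assms d, of x] cnj_FS[of c x] by (simp only: complex_norm_square)
  have "complex_of_real (LINT x:{0..2*pi}|lborel. (cmod (FS c x))\<^sup>2) = (LINT x:{0..2*pi}|lborel. FS (conv c ?d) x)"
    by (simp add: sq[symmetric] set_integral_complex_of_real[symmetric] del: of_real_power)
  also have "\<dots> = 2 * pi * fourier_coeff (FS (conv c ?d)) 0"
    by (simp add: fourier_coeff_wave)
  also have "fourier_coeff (FS (conv c ?d)) 0 = conv c ?d 0"
    by (rule fourier_coeff_FS[OF l1_conv[OF assms d]])
  also have "conv c ?d 0 = (\<Sum>\<^sub>\<infinity>k. complex_of_real ((cmod (c k))\<^sup>2))"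
    unfolding conv_def
    by (rule infsum_reindex_bij_witness[of _ "\<lambda>k. (k, - k)" fst])
      (auto simp: complex_norm_square add_eq_0_iff simp del: of_real_power)
  also have "\<dots> = of_real (\<Sum>\<^sub>\<infinity>k. (cmod (c k))\<^sup>2)"
    by (rule infsumI[OF has_sum_of_real[OF has_sum_infsum[OF l1_square_summable[OF assms]]]])
  finally have "complex_of_real (LINT x:{0..2*pi}|lborel. (cmod (FS c x))\<^sup>2) =
      complex_of_real (2 * pi * (\<Sum>\<^sub>\<infinity>k. (cmod (c k))\<^sup>2))" by simp
  then show ?thesis by (simp only: of_real_eq_iff)
qed

lemma torus_L2_norm_FS:
  assumes "l1 c"
  shows "torus_L2_norm (FS c) = sqrt (2 * pi * (\<Sum>\<^sub>\<infinity>k. (cmod (c k))\<^sup>2))"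
  by (simp add: torus_L2_norm_def parseval[OF assms])

section \<open>Sobolev weights and the embedding into the Wiener algebra\<close>

abbreviation W :: "int \<Rightarrow> real" where "W k \<equiv> 1 + (of_int k)\<^sup>2"

abbreviation W_sum :: "real \<Rightarrow> real" where
  "W_sum s \<equiv> \<Sum>\<^sub>\<infinity>k. W k powr (- s)"

abbreviation sobolev_sum :: "real \<Rightarrow> (int \<Rightarrow> complex) \<Rightarrow> real" where
  "sobolev_sum s f \<equiv> \<Sum>\<^sub>\<infinity>k. W k powr s * (norm (f k))\<^sup>2"

abbreviation sobolev_summable :: "real \<Rightarrow> (int \<Rightarrow> complex) \<Rightarrow> bool" where
  "sobolev_summable s f \<equiv> (\<lambda>k. W k powr s * (norm (f k))\<^sup>2) summable_on UNIV"

abbreviation band_l1 :: "nat \<Rightarrow> (int \<Rightarrow> 'a::real_normed_vector) \<Rightarrow> real" where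
  "band_l1 N f \<equiv> \<Sum>k\<in>{- int N..int N}. norm (f k)"

abbreviation band_l2 :: "nat \<Rightarrow> (int \<Rightarrow> 'a::real_normed_vector) \<Rightarrow> real" where
  "band_l2 N f \<equiv> L2_set (\<lambda>k. norm (f k)) {- int N..int N}"

lemma W_pos [simp]: "W k > 0" by (rule add_pos_nonneg) auto

lemma summable_W:
  assumes "s > 1/2"
  shows "(\<lambda>k::int. W k powr (- s)) summable_on UNIV"
proof -
  have sm: "summable (\<lambda>n::nat. (real n) powr (- 2 * s))"
    using assms by (subst summable_real_powr_iff) auto
  have "(\<lambda>n::nat. W (int n) powr (- s)) summable_on UNIV"
  proof (subst summable_on_UNIV_nonneg_real_iff)
    show "summable (\<lambda>n::nat. W (int n) powr (- s))"
    proof (rule summable_comparison_test_ev[OF _ sm])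
      show "\<forall>\<^sub>F n in sequentially. norm (W (int n) powr (- s)) \<le> (real n) powr (- 2 * s)"
        using eventually_gt_at_top[of 0]
      proof eventually_elim
        case (elim n)
        have "W (int n) powr (- s) \<le> ((real n)\<^sup>2) powr (- s)"
          using elim assms by (intro powr_mono2') auto
        also have "\<dots> = (real n) powr (- 2 * s)"
          using elim by (simp add: powr_powr flip: powr_numeral)
        finally show ?case by simp
      qed
    qed
  qed auto
  moreover have "(\<lambda>k::int. W k powr (- s)) summable_on range int \<longleftrightarrow> (\<lambda>n::nat. W (int n) powr (- s)) summable_on UNIV"
    by (subst summable_on_reindex) (auto simp: o_def)
  moreover have "(\<lambda>k::int. W k powr (- s)) summable_on range (\<lambda>n. - int n) \<longleftrightarrow> (\<lambda>n::nat. W (int n) powr (- s)) summable_on UNIV"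
    by (subst summable_on_reindex) (auto simp: o_def inj_on_def)
  moreover have "UNIV = range int \<union> range (\<lambda>n. - int n)"
  proof -
    have "k \<in> range int \<union> range (\<lambda>n. - int n)" for k :: int
      by (cases k rule: int_cases2) auto
    then show ?thesis by auto
  qed
  ultimately show ?thesis
    using summable_on_union[of "\<lambda>k::int. W k powr (- s)" "range int" "range (\<lambda>n. - int n)"] by simp
qed

lemma infsum_Cauchy_Schwarz:
  fixes u v :: "'a \<Rightarrow> real"
  assumes "(\<lambda>x. (u x)\<^sup>2) summable_on A" "(\<lambda>x. (v x)\<^sup>2) summable_on A"
  shows "(\<lambda>x. u x * v x) summable_on A"
    and "(\<Sum>\<^sub>\<infinity>x\<in>A. u x * v x)\<^sup>2 \<le> (\<Sum>\<^sub>\<infinity>x\<in>A. (u x)\<^sup>2) * (\<Sum>\<^sub>\<infinity>x\<in>A. (v x)\<^sup>2)"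
proof -
  show s: "(\<lambda>x. u x * v x) summable_on A"
    by (rule abs_summable_summable, rule abs_summable_product)
      (use assms in \<open>simp_all add: power2_eq_square\<close>)
  let ?F = "finite_subsets_at_top A"
  show "(\<Sum>\<^sub>\<infinity>x\<in>A. u x * v x)\<^sup>2 \<le> (\<Sum>\<^sub>\<infinity>x\<in>A. (u x)\<^sup>2) * (\<Sum>\<^sub>\<infinity>x\<in>A. (v x)\<^sup>2)"
  proof (rule tendsto_le)
    show "((\<lambda>X. (\<Sum>x\<in>X. u x * v x)\<^sup>2) \<longlongrightarrow> (\<Sum>\<^sub>\<infinity>x\<in>A. u x * v x)\<^sup>2) ?F"
      by (intro tendsto_intros infsum_tendsto s)
    show "((\<lambda>X. (\<Sum>x\<in>X. (u x)\<^sup>2) * (\<Sum>x\<in>X. (v x)\<^sup>2)) \<longlongrightarrow> (\<Sum>\<^sub>\<infinity>x\<in>A. (u x)\<^sup>2) * (\<Sum>\<^sub>\<infinity>x\<in>A. (v x)\<^sup>2)) ?F"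
      by (intro tendsto_intros infsum_tendsto assms)
    show "\<forall>\<^sub>F X in ?F. (\<Sum>x\<in>X. u x * v x)\<^sup>2 \<le> (\<Sum>x\<in>X. (u x)\<^sup>2) * (\<Sum>x\<in>X. (v x)\<^sup>2)"
      by (intro always_eventually allI Cauchy_Schwarz_ineq_sum)
  qed simp
qed

text \<open>Cauchy-Schwarz for \<open>W k powr (- s/2)\<close> against
  \<open>W k powr (s/2) * y k\<close>; the first factor is square summable because
  \<open>s > 1/2\<close>. This is the embedding of H^s into the Wiener algebra.\<close>

lemma weighted_l1_bound:
  fixes y :: "int \<Rightarrow> real"
  assumes s: "s > 1/2" and y: "\<And>k. y k \<ge> 0" "(\<lambda>k. W k powr s * (y k)\<^sup>2) summable_on UNIV"
  shows "y summable_on UNIV"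
    and "(\<Sum>\<^sub>\<infinity>k. y k) \<le> sqrt (W_sum s) * sqrt (\<Sum>\<^sub>\<infinity>k. W k powr s * (y k)\<^sup>2)"
proof -
  have sq: "(W k powr t)\<^sup>2 = W k powr (2 * t)" for k :: int and t :: real
    by (simp add: power2_eq_square flip: powr_add)
  have 1: "(\<lambda>k::int. (W k powr (- s/2))\<^sup>2) summable_on UNIV"
    using summable_W[OF s] by (simp add: sq)
  have 2: "(\<lambda>k::int. (W k powr (s/2) * y k)\<^sup>2) summable_on UNIV"
    using y(2) by (simp add: sq power_mult_distrib)
  have e: "W k powr (- s/2) * (W k powr (s/2) * y k) = y k" for k :: int
    using less_imp_neq[OF W_pos[of k]] by (simp add: mult.assoc[symmetric] flip: powr_add)
  note CS = infsum_Cauchy_Schwarz[OF 1 2, unfolded e]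
  show "y summable_on UNIV" by (rule CS(1))
  have "(\<Sum>\<^sub>\<infinity>k. y k) = sqrt ((\<Sum>\<^sub>\<infinity>k. y k)\<^sup>2)"
    using y(1) by (simp add: infsum_nonneg)
  also have "\<dots> \<le> sqrt ((\<Sum>\<^sub>\<infinity>k::int. (W k powr (- s/2))\<^sup>2) * (\<Sum>\<^sub>\<infinity>k::int. (W k powr (s/2) * y k)\<^sup>2))"
    using CS(2) by (rule real_sqrt_le_mono)
  finally show "(\<Sum>\<^sub>\<infinity>k. y k) \<le> sqrt (W_sum s) * sqrt (\<Sum>\<^sub>\<infinity>k. W k powr s * (y k)\<^sup>2)"
    by (simp add: sq power_mult_distrib real_sqrt_mult)
qed

lemma torus_Hs_integrable:
  assumes "f \<in> torus_Hs s"
  shows "set_integrable lborel {0..2*pi} f"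
proof -
  have sq: "set_integrable lborel {0..2*pi} (\<lambda>x. (cmod (f x))\<^sup>2)" and [measurable]: "f \<in> borel_measurable borel"
    using assms by (auto simp: torus_Hs_def)
  have one: "set_integrable lborel {0..2*pi} (\<lambda>x. 1::real)"
    by (rule borel_integrable_atLeastAtMost') auto
  show ?thesis
    unfolding set_integrable_def
  proof (rule Bochner_Integration.integrable_bound)
    show "integrable lborel (\<lambda>x. indicator {0..2*pi} x *\<^sub>R (1 + (cmod (f x))\<^sup>2))"
      using set_integral_add(1)[OF one sq] by (simp add: set_integrable_def)
    show "(\<lambda>x. indicator {0..2*pi} x *\<^sub>R f x) \<in> borel_measurable lborel"
      by measurable
    have "y \<le> 1 + y\<^sup>2" for y :: real
      using zero_le_power2[of "y - 1"] zero_le_power2[of y] by (simp add: power2_diff) (smt (verit) zero_le_power2)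
    then show "AE x in lborel. norm (indicator {0..2*pi} x *\<^sub>R f x) \<le> norm (indicator {0..2*pi} x *\<^sub>R (1 + (cmod (f x))\<^sup>2))"
      by (intro AE_I2) (auto simp: indicator_def)
  qed
qed

lemma torus_Hs_l1:
  assumes "f \<in> torus_Hs s" "s > 1/2"
  shows "l1 (fourier_coeff f)"
  by (rule weighted_l1_bound(1)[OF assms(2)]) (use assms(1) in \<open>auto simp: torus_Hs_def\<close>)

text \<open>The difference of \<open>f\<close> and its Fourier series is integrable with vanishing
  coefficients, so \<open>null_coeffs_AE\<close> applies on one period, and periodicity does the
  rest.\<close>

lemma torus_Hs_AE_FS:
  assumes "f \<in> torus_Hs s" "s > 1/2"
  shows "AE x in lborel. f x = FS (fourier_coeff f) x"
proof (rule AE_periodic)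
  have c: "l1 (fourier_coeff f)" by (rule torus_Hs_l1[OF assms])
  have i: "set_integrable lborel {0..2*pi} f" by (rule torus_Hs_integrable[OF assms(1)])
  have j: "set_integrable lborel {0..2*pi} (FS (fourier_coeff f))"
    by (rule LINT_continuous(2)[OF continuous_on_FS[OF c]])
  have "null_coeffs (\<lambda>x. f x - FS (fourier_coeff f) x)"
    using i j by (auto simp: null_coeffs_def fourier_coeff_diff fourier_coeff_FS[OF c] intro: set_integral_diff)
  from null_coeffs_AE[OF this]
  show "AE x in lborel. x \<in> {0..2*pi} \<longrightarrow> f x = FS (fourier_coeff f) x"
    by simp
  show "f (x + 2*pi) = f x" for x using assms(1) by (simp add: torus_Hs_def)
  show "FS (fourier_coeff f) (x + 2*pi) = FS (fourier_coeff f) x" for x by (rule FS_periodic)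
qed

lemma continuous_AE_eq:
  fixes f g :: "real \<Rightarrow> complex"
  assumes "continuous_on UNIV f" "continuous_on UNIV g" "AE x in lborel. f x = g x"
  shows "f = g"
proof (rule ccontr)
  assume "f \<noteq> g"
  let ?U = "{x. f x \<noteq> g x}"
  have o: "open ?U"
    using assms(1,2) by (rule open_Collect_neq)
  have "?U \<noteq> {}" using \<open>f \<noteq> g\<close> by auto
  then obtain x e where e: "e > 0" "ball x e \<subseteq> ?U"
    using o by (auto simp: open_contains_ball)
  have "AE x in lborel. x \<notin> ?U" using assms(3) by simp
  then have "?U \<in> null_sets lborel"
    using o by (subst (asm) AE_iff_null_sets[symmetric]) auto
  then have "ball x e \<in> null_sets lborel"
    using null_sets_subset[OF _ _ e(2)] by auto
  moreover have "emeasure lborel (ball x e) = ennreal (2 * e)"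
    using e(1) by (simp add: ball_eq_greaterThanLessThan)
  ultimately show False using e(1) by (auto simp: null_sets_def)
qed

text \<open>Both halves of the definite description have to be checked: the Fourier series is a
  continuous periodic representative, and two continuous functions that agree almost everywhere are
  equal. This identifies the point values that the interpolation samples.\<close>

lemma continuous_rep_torus_Hs:
  assumes "f \<in> torus_Hs s" "s > 1/2"
  shows "continuous_rep f = FS (fourier_coeff f)"
  unfolding continuous_rep_def
proof (rule the_equality)
  have c: "l1 (fourier_coeff f)" by (rule torus_Hs_l1[OF assms])
  note ae = torus_Hs_AE_FS[OF assms]
  show "continuous_on UNIV (FS (fourier_coeff f)) \<and> (\<forall>x. FS (fourier_coeff f) (x + 2 * pi) = FS (fourier_coeff f) x) \<and>
      (AE x in lborel. FS (fourier_coeff f) x = f x)"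
    using ae by (auto simp: continuous_on_FS[OF c] FS_periodic elim: eventually_mono)
  fix g assume g: "continuous_on UNIV g \<and> (\<forall>x. g (x + 2 * pi) = g x) \<and> (AE x in lborel. g x = f x)"
  show "g = FS (fourier_coeff f)"
  proof (rule continuous_AE_eq)
    show "AE x in lborel. g x = FS (fourier_coeff f) x"
      using g ae by (auto elim: eventually_elim2)
  qed (use g continuous_on_FS[OF c] in auto)
qed

section \<open>Trilinear estimates\<close>

lemma dominated_infsum:
  fixes f :: "'a \<Rightarrow> 'b::banach"
  assumes "g summable_on A" "\<And>q. q \<in> A \<Longrightarrow> norm (f q) \<le> g q"
  shows "(\<lambda>q. norm (f q)) summable_on A" "f summable_on A" "norm (infsum f A) \<le> infsum g A"
proof -
  show n: "(\<lambda>q. norm (f q)) summable_on A"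
    by (rule Infinite_Sum.abs_summable_on_comparison_test'[OF assms])
  then show s: "f summable_on A" by (rule abs_summable_summable)
  show "norm (infsum f A) \<le> infsum g A"
    by (rule norm_infsum_le[OF has_sum_infsum[OF s] has_sum_infsum[OF assms(1)] assms(2)])
qed

text \<open>On \<open>triples k\<close> two entries determine the third, so a summand that depends
  on two entries runs over all pairs and the value is the same for every \<open>k\<close>. This
  uniformity is what Schur's test requires.\<close>

lemma pair_sums:
  fixes g h :: "int \<Rightarrow> real"
  assumes "g summable_on UNIV" "h summable_on UNIV" "\<And>k. g k \<ge> 0" "\<And>k. h k \<ge> 0"
  shows "((\<lambda>(i,j,l). g i * h j) has_sum (infsum g UNIV * infsum h UNIV)) (triples k)"
    and "((\<lambda>(i,j,l). g i * h l) has_sum (infsum g UNIV * infsum h UNIV)) (triples k)"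
    and "((\<lambda>(i,j,l). g j * h l) has_sum (infsum g UNIV * infsum h UNIV)) (triples k)"
proof -
  have p: "((\<lambda>(i,j). g i * h j) has_sum (infsum g UNIV * infsum h UNIV)) UNIV"
    by (rule has_sum_product(2)) (use assms in simp_all)
  show "((\<lambda>(i,j,l). g i * h j) has_sum (infsum g UNIV * infsum h UNIV)) (triples k)"
    by (rule has_sum_reindex_bij_witness[THEN iffD2, OF _ _ _ _ _ refl p, of _ "\<lambda>(i,j). (i,j,k-i-j)" "\<lambda>(i,j,l). (i,j)"])
      (auto simp: triples_def)
  show "((\<lambda>(i,j,l). g i * h l) has_sum (infsum g UNIV * infsum h UNIV)) (triples k)"
    by (rule has_sum_reindex_bij_witness[THEN iffD2, OF _ _ _ _ _ refl p, of _ "\<lambda>(i,l). (i,k-i-l,l)" "\<lambda>(i,j,l). (i,l)"])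
      (auto simp: triples_def)
  show "((\<lambda>(i,j,l). g j * h l) has_sum (infsum g UNIV * infsum h UNIV)) (triples k)"
    by (rule has_sum_reindex_bij_witness[THEN iffD2, OF _ _ _ _ _ refl p, of _ "\<lambda>(j,l). (k-j-l,j,l)" "\<lambda>(i,j,l). (j,l)"])
      (auto simp: triples_def)
qed

lemma triple_sums:
  fixes x y z :: "int \<Rightarrow> real"
  assumes "x summable_on UNIV" "y summable_on UNIV" "z summable_on UNIV"
    and "\<And>k. x k \<ge> 0" "\<And>k. y k \<ge> 0" "\<And>k. z k \<ge> 0"
  shows "(\<lambda>(i,j,l). x i * y j * z l) summable_on UNIV"
    and "(\<lambda>(i,j,l). x i * y j * z l) summable_on triples k"
    and "infsum (\<lambda>(i,j,l). x i * y j * z l) UNIV = infsum x UNIV * infsum y UNIV * infsum z UNIV"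
    and "finite K \<Longrightarrow> (\<Sum>k\<in>K. \<Sum>\<^sub>\<infinity>(i,j,l)\<in>triples k. x i * y j * z l) \<le> infsum x UNIV * infsum y UNIV * infsum z UNIV"
proof -
  have l: "l1 (\<lambda>(i,j,l). x i * y j * z l)"
    and h: "((\<lambda>(i,j,l). x i * y j * z l) has_sum (infsum x UNIV * infsum y UNIV * infsum z UNIV)) UNIV"
    using has_sum_product3[of x y z] assms by simp_all
  show "(\<lambda>(i,j,l). x i * y j * z l) summable_on UNIV" using h by (rule has_sum_imp_summable)
  show "infsum (\<lambda>(i,j,l). x i * y j * z l) UNIV = infsum x UNIV * infsum y UNIV * infsum z UNIV"
    using h by (rule infsumI)
  note f = summable_on_fibres[OF l, of "\<lambda>(i,j,l). i + j + l", folded triples_fibre]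
  show "(\<lambda>(i,j,l). x i * y j * z l) summable_on triples k" by (rule f(1))
  show "(\<Sum>k\<in>K. \<Sum>\<^sub>\<infinity>(i,j,l)\<in>triples k. x i * y j * z l) \<le> infsum x UNIV * infsum y UNIV * infsum z UNIV" if "finite K"
    unfolding infsumI[OF h, symmetric]
    by (rule finite_sum_le_has_sum[OF f(3) that]) (auto intro!: infsum_nonneg mult_nonneg_nonneg assms)
qed

text \<open>Cauchy-Schwarz on each fibre: the factors with \<open>u\<close> are bounded uniformly by
  \<open>C\<close>, and the factors with \<open>v\<close> add up over the disjoint fibres to the sum
  over all triples.\<close>

lemma schur_test:
  fixes u v :: "int \<times> int \<times> int \<Rightarrow> real"
  assumes u: "\<And>k. (\<lambda>q. (u q)\<^sup>2) summable_on triples k" "\<And>k. (\<Sum>\<^sub>\<infinity>q\<in>triples k. (u q)\<^sup>2) \<le> C"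
    and v: "(\<lambda>q. (v q)\<^sup>2) summable_on UNIV"
  shows "(\<lambda>q. u q * v q) summable_on triples k"
    and "finite K \<Longrightarrow> (\<Sum>k\<in>K. (\<Sum>\<^sub>\<infinity>q\<in>triples k. u q * v q)\<^sup>2) \<le> C * (\<Sum>\<^sub>\<infinity>q. (v q)\<^sup>2)"
proof -
  have l: "l1 (\<lambda>q. (v q)\<^sup>2)" using v by simp
  note f = summable_on_fibres[OF l, of "\<lambda>(i,j,l). i + j + l", folded triples_fibre]
  note CS = infsum_Cauchy_Schwarz[OF u(1) f(1)]
  show "(\<lambda>q. u q * v q) summable_on triples k" by (rule CS)
  have C: "C \<ge> 0" using order_trans[OF infsum_nonneg u(2)] by simp
  assume K: "finite K"
  have "(\<Sum>k\<in>K. (\<Sum>\<^sub>\<infinity>q\<in>triples k. u q * v q)\<^sup>2) \<le> (\<Sum>k\<in>K. C * (\<Sum>\<^sub>\<infinity>q\<in>triples k. (v q)\<^sup>2))"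
    by (intro sum_mono order_trans[OF CS(2)] mult_right_mono u(2) infsum_nonneg) auto
  also have "\<dots> = C * (\<Sum>k\<in>K. \<Sum>\<^sub>\<infinity>q\<in>triples k. (v q)\<^sup>2)"
    by (rule sum_distrib_left[symmetric])
  also have "\<dots> \<le> C * (\<Sum>\<^sub>\<infinity>q. (v q)\<^sup>2)"
    by (intro mult_left_mono finite_sum_le_has_sum[OF f(3) K] C) (auto intro: infsum_nonneg)
  finally show "(\<Sum>k\<in>K. (\<Sum>\<^sub>\<infinity>q\<in>triples k. u q * v q)\<^sup>2) \<le> C * (\<Sum>\<^sub>\<infinity>q. (v q)\<^sup>2)" .
qed

text \<open>Schur's test with \<open>u = sqrt p\<close> and \<open>v = sqrt p * z\<close>; each of
  the two contributes one factor \<open>sqrt P\<close>. In the application \<open>p\<close> is a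
  product of two l^1 sequences and \<open>z\<close> an l^2 sequence in the remaining entry.\<close>

lemma young_l2_core:
  fixes p :: "int \<times> int \<times> int \<Rightarrow> real" and z :: "int \<times> int \<times> int \<Rightarrow> real"
  assumes p: "\<And>k. (p has_sum P) (triples k)" "\<And>q. p q \<ge> 0"
    and z: "((\<lambda>q. p q * (z q)\<^sup>2) has_sum (P * Z)) UNIV" and K: "finite K"
  shows "(\<lambda>q. p q * z q) summable_on triples k"
    and "L2_set (\<lambda>k. \<Sum>\<^sub>\<infinity>q\<in>triples k. p q * z q) K \<le> P * sqrt Z"
proof -
  have P: "P \<ge> 0" using has_sum_nonneg[OF p(1)] p(2) by blast
  have 1: "(sqrt (p q))\<^sup>2 = p q" "(sqrt (p q) * z q)\<^sup>2 = p q * (z q)\<^sup>2" "sqrt (p q) * (sqrt (p q) * z q) = p q * z q" for q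
    using p(2) by (auto simp: power_mult_distrib mult.assoc[symmetric])
  note S = schur_test[of "\<lambda>q. sqrt (p q)" P "\<lambda>q. sqrt (p q) * z q", unfolded 1, OF _ _ has_sum_imp_summable[OF z]]
  show "(\<lambda>q. p q * z q) summable_on triples k"
    using has_sum_imp_summable[OF p(1)] infsumI[OF p(1)] by (intro S(1)) auto
  have "(\<Sum>k\<in>K. (\<Sum>\<^sub>\<infinity>q\<in>triples k. p q * z q)\<^sup>2) \<le> P * (\<Sum>\<^sub>\<infinity>q. p q * (z q)\<^sup>2)"
    using has_sum_imp_summable[OF p(1)] infsumI[OF p(1)] K by (intro S(2)) auto
  also have "\<dots> = P\<^sup>2 * Z" using infsumI[OF z] by (simp add: power2_eq_square)
  finally have "L2_set (\<lambda>k. \<Sum>\<^sub>\<infinity>q\<in>triples k. p q * z q) K \<le> sqrt (P\<^sup>2 * Z)"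
    unfolding L2_set_def by (rule real_sqrt_le_mono)
  then show "L2_set (\<lambda>k. \<Sum>\<^sub>\<infinity>q\<in>triples k. p q * z q) K \<le> P * sqrt Z"
    using P by (simp add: real_sqrt_mult)
qed

text \<open>Young's inequality for two l^1 factors and one l^2 factor. All three positions of the
  l^2 factor are recorded, because in a telescoped difference and in the truncation error the
  distinguished factor visits each place.\<close>

lemma young_l2:
  fixes x y z :: "int \<Rightarrow> real"
  assumes x: "x summable_on UNIV" "\<And>k. x k \<ge> 0" and y: "y summable_on UNIV" "\<And>k. y k \<ge> 0"
    and z: "(\<lambda>k. (z k)\<^sup>2) summable_on UNIV" and K: "finite K"
  shows "(\<lambda>(i,j,l). z i * x j * y l) summable_on triples k"
    and "(\<lambda>(i,j,l). x i * z j * y l) summable_on triples k"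
    and "(\<lambda>(i,j,l). x i * y j * z l) summable_on triples k"
    and "L2_set (\<lambda>k. \<Sum>\<^sub>\<infinity>(i,j,l)\<in>triples k. z i * x j * y l) K \<le> infsum x UNIV * infsum y UNIV * sqrt (\<Sum>\<^sub>\<infinity>k. (z k)\<^sup>2)"
    and "L2_set (\<lambda>k. \<Sum>\<^sub>\<infinity>(i,j,l)\<in>triples k. x i * z j * y l) K \<le> infsum x UNIV * infsum y UNIV * sqrt (\<Sum>\<^sub>\<infinity>k. (z k)\<^sup>2)"
    and "L2_set (\<lambda>k. \<Sum>\<^sub>\<infinity>(i,j,l)\<in>triples k. x i * y j * z l) K \<le> infsum x UNIV * infsum y UNIV * sqrt (\<Sum>\<^sub>\<infinity>k. (z k)\<^sup>2)"
proof -
  let ?P = "infsum x UNIV * infsum y UNIV" and ?Z = "\<Sum>\<^sub>\<infinity>k. (z k)\<^sup>2"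
  note ps = pair_sums[OF x(1) y(1) x(2) y(2)]
  have "((\<lambda>(i,j,l). x i * y j * (z l)\<^sup>2) has_sum (?P * ?Z)) UNIV"
    using has_sum_product3(2)[of x y "\<lambda>k. (z k)\<^sup>2"] x y z by simp
  then have h: "((\<lambda>q. (case q of (i,j,l) \<Rightarrow> x i * y j) * (case q of (i,j,l) \<Rightarrow> z l)\<^sup>2) has_sum (?P * ?Z)) UNIV"
    by (simp add: case_prod_unfold)
  have h1: "((\<lambda>q. (case q of (i,j,l) \<Rightarrow> x j * y l) * (case q of (i,j,l) \<Rightarrow> z i)\<^sup>2) has_sum (?P * ?Z)) UNIV"
    by (rule has_sum_reindex_bij_witness[THEN iffD2, OF _ _ _ _ _ refl h, of _ "\<lambda>(j,l,i). (i,j,l)" "\<lambda>(i,j,l). (j,l,i)"]) auto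
  have h2: "((\<lambda>q. (case q of (i,j,l) \<Rightarrow> x i * y l) * (case q of (i,j,l) \<Rightarrow> z j)\<^sup>2) has_sum (?P * ?Z)) UNIV"
    by (rule has_sum_reindex_bij_witness[THEN iffD2, OF _ _ _ _ _ refl h, of _ "\<lambda>(i,l,j). (i,j,l)" "\<lambda>(i,j,l). (i,l,j)"]) auto
  have nn: "(case q of (i,j,l) \<Rightarrow> x j * y l) \<ge> 0" "(case q of (i,j,l) \<Rightarrow> x i * y l) \<ge> 0" "(case q of (i,j,l) \<Rightarrow> x i * y j) \<ge> 0"
    for q :: "int \<times> int \<times> int" using x(2) y(2) by (auto split: prod.split)
  note c1 = young_l2_core[OF ps(3) nn(1) h1 K] and c2 = young_l2_core[OF ps(2) nn(2) h2 K] and c3 = young_l2_core[OF ps(1) nn(3) h K]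
  have e: "(\<lambda>(i,j,l). z i * x j * y l) = (\<lambda>q. (case q of (i,j,l) \<Rightarrow> x j * y l) * (case q of (i,j,l) \<Rightarrow> z i))"
     "(\<lambda>(i,j,l). x i * z j * y l) = (\<lambda>q. (case q of (i,j,l) \<Rightarrow> x i * y l) * (case q of (i,j,l) \<Rightarrow> z j))"
     "(\<lambda>(i,j,l). x i * y j * z l) = (\<lambda>q. (case q of (i,j,l) \<Rightarrow> x i * y j) * (case q of (i,j,l) \<Rightarrow> z l))"
    by (auto simp: mult_ac)
  show "(\<lambda>(i,j,l). z i * x j * y l) summable_on triples k" unfolding e by (rule c1(1))
  show "(\<lambda>(i,j,l). x i * z j * y l) summable_on triples k" unfolding e by (rule c2(1))
  show "(\<lambda>(i,j,l). x i * y j * z l) summable_on triples k" unfolding e by (rule c3(1))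
  show "L2_set (\<lambda>k. \<Sum>\<^sub>\<infinity>(i,j,l)\<in>triples k. z i * x j * y l) K \<le> ?P * sqrt ?Z" unfolding e by (rule c1(2))
  show "L2_set (\<lambda>k. \<Sum>\<^sub>\<infinity>(i,j,l)\<in>triples k. x i * z j * y l) K \<le> ?P * sqrt ?Z" unfolding e by (rule c2(2))
  show "L2_set (\<lambda>k. \<Sum>\<^sub>\<infinity>(i,j,l)\<in>triples k. x i * y j * z l) K \<le> ?P * sqrt ?Z" unfolding e by (rule c3(2))
qed

section \<open>The kernel of the resonance error\<close>

lemma weighted_geometric_mean_le:
  fixes X Y Z :: real
  assumes "X > 0" "Y > 0" "Z > 0" "a \<ge> 0" "b \<ge> 0" "c \<ge> 0" "a + b + c = 1"
  shows "X powr a * Y powr b * Z powr c \<le> X + Y + Z"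
proof -
  define m where "m = max X (max Y Z)"
  have m: "m > 0" "X \<le> m" "Y \<le> m" "Z \<le> m" "m \<le> X + Y + Z" using assms by (auto simp: m_def)
  have "X powr a * Y powr b * Z powr c \<le> m powr a * m powr b * m powr c"
    using assms m by (intro mult_mono powr_mono2) auto
  also have "\<dots> = m" using m(1) assms(7) by (simp flip: powr_add)
  finally show ?thesis using m(5) by simp
qed

text \<open>The weights of the geometric mean are forced. Equal total degree on both sides means -2
  S = 4 \<alpha> - 3 \<gamma>, and comparing the powers of \<open>A\<close>, \<open>B\<close> and
  \<open>C\<close> gives \<open>S * a = \<gamma>/2 - \<alpha>\<close> for the two products that
  contain \<open>A\<close> and \<open>S * b = \<gamma>/2\<close> for \<open>B * C\<close>. The
  condition \<open>2 * \<alpha> \<le> \<gamma>\<close> makes \<open>a\<close> nonnegative.\<close>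

lemma kernel_exponents:
  fixes A B C \<alpha> \<gamma> :: real
  assumes "A > 0" "B > 0" "C > 0" "0 \<le> \<gamma>" "2 * \<alpha> \<le> \<gamma>" "3 * \<gamma> - 4 * \<alpha> > 0"
  defines "S \<equiv> (3 * \<gamma> - 4 * \<alpha>) / 2"
  shows "A powr (2 * \<alpha> - \<gamma>) * B powr (\<alpha> - \<gamma>) * C powr (\<alpha> - \<gamma>)
    \<le> (A * B) powr (- S) + (B * C) powr (- S) + (A * C) powr (- S)"
proof -
  have S: "S > 0" using assms by simp
  define a where "a = (\<gamma>/2 - \<alpha>) / S"
  define b where "b = (\<gamma>/2) / S"
  have ab: "a \<ge> 0" "b \<ge> 0" using assms S by (auto simp: a_def b_def)
  have Sa: "S * a = \<gamma>/2 - \<alpha>" "S * b = \<gamma>/2" using S by (auto simp: a_def b_def)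
  define p where "p = - (S * a)"
  define r where "r = - (S * b)"
  have pr: "S * a = - p" "S * b = - r" by (simp_all add: p_def r_def)
  have "S * (a + b + a) = S * 1"
    unfolding distrib_left Sa by (simp add: S_def)
  then have sum: "a + b + a = 1" using S by simp
  have "((A * B) powr (- S)) powr a * ((B * C) powr (- S)) powr b * ((A * C) powr (- S)) powr a
      \<le> (A * B) powr (- S) + (B * C) powr (- S) + (A * C) powr (- S)"
    using assms(1-3) ab sum by (intro weighted_geometric_mean_le) auto
  also have "((A * B) powr (- S)) powr a * ((B * C) powr (- S)) powr b * ((A * C) powr (- S)) powr a
     = (A powr p * A powr p) * (B powr p * B powr r) * (C powr r * C powr p)"
    using assms(1-3) by (simp add: powr_powr powr_mult pr mult_ac)
  also have "\<dots> = A powr (2 * \<alpha> - \<gamma>) * B powr (\<alpha> - \<gamma>) * C powr (\<alpha> - \<gamma>)"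
    by (simp add: p_def r_def Sa algebra_simps flip: powr_add)
  finally show ?thesis .
qed

lemma abs_le_W: "\<bar>real_of_int k\<bar> \<le> W k powr (1/2)"
proof -
  have "\<bar>real_of_int k\<bar> = sqrt ((real_of_int k)\<^sup>2)" by simp
  also have "\<dots> \<le> sqrt (W k)" by (intro real_sqrt_le_mono) simp
  finally show ?thesis by (simp add: powr_half_sqrt)
qed

lemma abs_powr_le_W: "a \<ge> 0 \<Longrightarrow> \<bar>real_of_int k\<bar> powr a \<le> W k powr (a/2)"
  using powr_mono2[OF _ _ abs_le_W, of a k] by (simp add: powr_powr)

text \<open>
  \<open>(W i * W j * W l) powr (- \<gamma>/2)\<close> is what is left of the kernel after a factor of \<open>H\<^sup>\<gamma>\<close> has been taken
  out for each of the three functions; a weighted geometric mean leaves two summable weights.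
\<close>

lemma resonance_kernel:
  fixes \<alpha> \<gamma> :: real
  assumes "0 < \<alpha>" "2 * \<alpha> \<le> \<gamma>" "\<gamma> \<le> 1"
  defines "S \<equiv> (3 * \<gamma> - 4 * \<alpha>) / 2"
  shows "(((\<bar>of_int (i + j + l)\<bar> * \<bar>of_int i\<bar> * \<bar>of_int j\<bar> * \<bar>of_int l\<bar>) powr \<alpha>) * (W i * W j * W l) powr (- \<gamma>/2))\<^sup>2
    \<le> 9 * (W i powr (- S) * W j powr (- S) + W j powr (- S) * W l powr (- S) + W i powr (- S) * W l powr (- S))"
proof -
  let ?i = "\<bar>real_of_int i\<bar>" and ?j = "\<bar>real_of_int j\<bar>" and ?l = "\<bar>real_of_int l\<bar>"
  let ?k = "\<bar>real_of_int (i + j + l)\<bar>"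
  have W: "W i > 0" "W j > 0" "W l > 0" by (rule W_pos)+
  \<comment> \<open>The output frequency is at most three times the largest input, and its power is
    charged to one input at a time. This is why below one exponent is
    \<open>2 * \<alpha> - \<gamma>\<close> and the other two are
    \<open>\<alpha> - \<gamma>\<close>.\<close>
  have "?k \<le> 3 * max ?i (max ?j ?l)" by auto
  then have "?k powr (2*\<alpha>) \<le> (3 * max ?i (max ?j ?l)) powr (2*\<alpha>)"
    using assms by (intro powr_mono2) auto
  also have "\<dots> = 3 powr (2*\<alpha>) * (max ?i (max ?j ?l)) powr (2*\<alpha>)"
    by (simp add: powr_mult)
  also have "\<dots> \<le> 3 * (?i powr (2*\<alpha>) + ?j powr (2*\<alpha>) + ?l powr (2*\<alpha>))"
  proof (rule mult_mono)
    have "3 powr (2*\<alpha>) \<le> (3::real) powr 1"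
      using assms by (intro powr_mono) auto
    then show "3 powr (2*\<alpha>) \<le> (3::real)" by simp
  qed (auto simp: max_def)
  finally have k: "?k powr (2*\<alpha>) \<le> 3 * (?i powr (2*\<alpha>) + ?j powr (2*\<alpha>) + ?l powr (2*\<alpha>))" .
  have w: "?i powr (2*\<alpha>) \<le> W i powr \<alpha>" "?j powr (2*\<alpha>) \<le> W j powr \<alpha>" "?l powr (2*\<alpha>) \<le> W l powr \<alpha>"
    using abs_powr_le_W[of "2*\<alpha>"] assms(1) by auto
  have sq: "(x powr a)\<^sup>2 = x powr (2*a)" for x a :: real
    by (simp add: power2_eq_square flip: powr_add)
  have g: "\<gamma> \<ge> 0" "3 * \<gamma> - 4 * \<alpha> > 0" using assms by linarith+
  have ke: "x powr (2 * \<alpha> - \<gamma>) * y powr (\<alpha> - \<gamma>) * z powr (\<alpha> - \<gamma>)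
      \<le> x powr (- S) * y powr (- S) + y powr (- S) * z powr (- S) + x powr (- S) * z powr (- S)"
    if "x > 0" "y > 0" "z > 0" for x y z
    using kernel_exponents[OF that g(1) assms(2) g(2)] that by (simp add: S_def powr_mult)
  have "(((?k * ?i * ?j * ?l) powr \<alpha>) * (W i * W j * W l) powr (- \<gamma>/2))\<^sup>2
     = ?k powr (2*\<alpha>) * (?i powr (2*\<alpha>) * ?j powr (2*\<alpha>) * ?l powr (2*\<alpha>)) * (W i powr (-\<gamma>) * W j powr (-\<gamma>) * W l powr (-\<gamma>))"
    using W by (simp add: power_mult_distrib powr_mult sq)
  also have "\<dots> \<le> (3 * (W i powr \<alpha> + W j powr \<alpha> + W l powr \<alpha>)) * (W i powr \<alpha> * W j powr \<alpha> * W l powr \<alpha>) *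
      (W i powr (-\<gamma>) * W j powr (-\<gamma>) * W l powr (-\<gamma>))"
    using k w by (intro mult_right_mono mult_mono) auto
  also have "\<dots> = 3 * (W i powr (2 * \<alpha> - \<gamma>) * W j powr (\<alpha> - \<gamma>) * W l powr (\<alpha> - \<gamma>)
      + W j powr (2 * \<alpha> - \<gamma>) * W i powr (\<alpha> - \<gamma>) * W l powr (\<alpha> - \<gamma>)
      + W l powr (2 * \<alpha> - \<gamma>) * W i powr (\<alpha> - \<gamma>) * W j powr (\<alpha> - \<gamma>))"
  proof -
    have "x powr (2 * \<alpha> - \<gamma>) = x powr \<alpha> * x powr \<alpha> * x powr (-\<gamma>)" "x powr (\<alpha> - \<gamma>) = x powr \<alpha> * x powr (-\<gamma>)" for x :: real
      by (simp_all flip: powr_add)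
    then show ?thesis by (simp add: algebra_simps)
  qed
  \<comment> \<open>The bound of \<open>kernel_exponents\<close> is symmetric in the three weights,
    hence the same for all three summands: 9 = 3 * 3.\<close>
  also have "\<dots> \<le> 9 * (W i powr (- S) * W j powr (- S) + W j powr (- S) * W l powr (- S) + W i powr (- S) * W l powr (- S))"
    using ke[OF W(1,2,3)] ke[OF W(2,1,3)] ke[OF W(3,1,2)] by (simp add: mult_ac)
  finally show ?thesis .
qed

text \<open>Schur's test with \<open>u\<close> the kernel of \<open>resonance_kernel\<close> and
  \<open>v\<close> the product of the three weighted functions. The squared kernel is summable along
  every fibre once \<open>S > 1/2\<close>, that is
  \<open>3 * \<gamma> - 4 * \<alpha> > 1\<close>.\<close>

lemma resonance_l2:
  fixes \<alpha> \<gamma> :: real and x y z :: "int \<Rightarrow> real"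
  assumes \<alpha>: "0 < \<alpha>" "2 * \<alpha> \<le> \<gamma>" "\<gamma> \<le> 1" "3 * \<gamma> - 4 * \<alpha> > 1"
    and x: "(\<lambda>k. W k powr \<gamma> * (x k)\<^sup>2) summable_on UNIV"
    and y: "(\<lambda>k. W k powr \<gamma> * (y k)\<^sup>2) summable_on UNIV"
    and z: "(\<lambda>k. W k powr \<gamma> * (z k)\<^sup>2) summable_on UNIV" and K: "finite K"
  defines "h \<equiv> \<lambda>(i,j,l). (\<bar>of_int (i + j + l)\<bar> * \<bar>of_int i\<bar> * \<bar>of_int j\<bar> * \<bar>of_int l\<bar>) powr \<alpha> * (x i * y j * z l)"
  shows "h summable_on triples k"
    and "L2_set (\<lambda>k. infsum h (triples k)) K \<le> sqrt 27 * W_sum ((3 * \<gamma> - 4 * \<alpha>) / 2) *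
      (sqrt (\<Sum>\<^sub>\<infinity>k. W k powr \<gamma> * (x k)\<^sup>2) * sqrt (\<Sum>\<^sub>\<infinity>k. W k powr \<gamma> * (y k)\<^sup>2) * sqrt (\<Sum>\<^sub>\<infinity>k. W k powr \<gamma> * (z k)\<^sup>2))"
proof -
  define S where "S = (3 * \<gamma> - 4 * \<alpha>) / 2"
  define Z where "Z = W_sum S"
  define u where "u = (\<lambda>(i,j,l). (\<bar>of_int (i + j + l)\<bar> * \<bar>of_int i\<bar> * \<bar>of_int j\<bar> * \<bar>of_int l\<bar>) powr \<alpha> * (W i * W j * W l) powr (- \<gamma>/2))"
  define v where "v = (\<lambda>(i,j,l). W i powr (\<gamma>/2) * x i * (W j powr (\<gamma>/2) * y j) * (W l powr (\<gamma>/2) * z l))"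
  have S: "S > 1/2" using \<alpha> by (simp add: S_def)
  have sW: "(\<lambda>k::int. W k powr (- S)) summable_on UNIV" by (rule summable_W[OF S])
  have Z: "Z \<ge> 0" unfolding Z_def by (intro infsum_nonneg) auto
  have sq: "(W k powr (\<gamma>/2) * a)\<^sup>2 = W k powr \<gamma> * a\<^sup>2" for k :: int and a
    by (simp add: power_mult_distrib power2_eq_square[of "_ powr _"] flip: powr_add)
  have h: "h = (\<lambda>q. u q * v q)"
  proof
    fix q :: "int \<times> int \<times> int"
    obtain i j l where q: "q = (i,j,l)" by (cases q)
    have e: "W k powr (- \<gamma>/2) * W k powr (\<gamma>/2) = 1" for k :: int
      using less_imp_neq[OF W_pos[of k]] by (simp flip: powr_add)
    have "u q * v q = (\<bar>of_int (i + j + l)\<bar> * \<bar>of_int i\<bar> * \<bar>of_int j\<bar> * \<bar>of_int l\<bar>) powr \<alpha> * (x i * y j * z l) *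
       (W i powr (- \<gamma>/2) * W i powr (\<gamma>/2)) * (W j powr (- \<gamma>/2) * W j powr (\<gamma>/2)) * (W l powr (- \<gamma>/2) * W l powr (\<gamma>/2))"
      by (simp add: u_def v_def q powr_mult less_imp_le[OF W_pos])
    then show "h q = u q * v q" by (simp only: e mult_1_right h_def q prod.case)
  qed
  have "((\<lambda>(i,j,l). W i powr \<gamma> * (x i)\<^sup>2 * (W j powr \<gamma> * (y j)\<^sup>2) * (W l powr \<gamma> * (z l)\<^sup>2)) has_sum
     ((\<Sum>\<^sub>\<infinity>k. W k powr \<gamma> * (x k)\<^sup>2) * (\<Sum>\<^sub>\<infinity>k. W k powr \<gamma> * (y k)\<^sup>2) * (\<Sum>\<^sub>\<infinity>k. W k powr \<gamma> * (z k)\<^sup>2))) UNIV"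
    by (rule has_sum_product3(2)) (use x y z in \<open>simp_all add: abs_mult\<close>)
  also have "(\<lambda>(i,j,l). W i powr \<gamma> * (x i)\<^sup>2 * (W j powr \<gamma> * (y j)\<^sup>2) * (W l powr \<gamma> * (z l)\<^sup>2)) = (\<lambda>q. (v q)\<^sup>2)"
    by (auto simp: v_def sq power_mult_distrib[of "_ * _ * (_ * _)"] power_mult_distrib[of "_ * _" "_ * _"])
  finally have v: "((\<lambda>q. (v q)\<^sup>2) has_sum ((\<Sum>\<^sub>\<infinity>k. W k powr \<gamma> * (x k)\<^sup>2) * (\<Sum>\<^sub>\<infinity>k. W k powr \<gamma> * (y k)\<^sup>2) * (\<Sum>\<^sub>\<infinity>k. W k powr \<gamma> * (z k)\<^sup>2))) UNIV" .
  define g where "g = (\<lambda>(i,j,l). 9 * (W i powr (- S) * W j powr (- S) + W j powr (- S) * W l powr (- S) + W i powr (- S) * W l powr (- S)))"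
  note ps = pair_sums[OF sW sW, folded Z_def]
  \<comment> \<open>27 = 9 * 3: each of the three pair sums equals \<open>Z * Z\<close>, whatever
    \<open>k\<close> is.\<close>
  have g: "(g has_sum (27 * Z\<^sup>2)) (triples k)" for k
  proof -
    have "((\<lambda>q. 9 * ((case q of (i,j,l) \<Rightarrow> W i powr (- S) * W j powr (- S)) + (case q of (i,j,l) \<Rightarrow> W j powr (- S) * W l powr (- S)) + (case q of (i,j,l) \<Rightarrow> W i powr (- S) * W l powr (- S)))) has_sum (9 * (Z * Z + Z * Z + Z * Z))) (triples k)"
      by (intro has_sum_cmult_right has_sum_add ps) auto
    then show ?thesis by (simp add: g_def case_prod_unfold power2_eq_square)
  qed
  have ug: "norm ((u q)\<^sup>2) \<le> g q" for q
    using resonance_kernel[OF \<alpha>(1-3)] by (auto simp: u_def g_def S_def split: prod.split)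
  have u1: "(\<lambda>q. (u q)\<^sup>2) summable_on triples k" for k
    by (rule dominated_infsum(2)[OF has_sum_imp_summable[OF g] ug])
  have u2: "(\<Sum>\<^sub>\<infinity>q\<in>triples k. (u q)\<^sup>2) \<le> 27 * Z\<^sup>2" for k
    using dominated_infsum(3)[OF has_sum_imp_summable[OF g] ug, of k] infsumI[OF g, of k] by simp
  note s = schur_test[OF u1 u2 has_sum_imp_summable[OF v], folded h]
  show "h summable_on triples k" by (rule s(1))
  have "L2_set (\<lambda>k. infsum h (triples k)) K \<le> sqrt (27 * Z\<^sup>2 * (\<Sum>\<^sub>\<infinity>q. (v q)\<^sup>2))"
    unfolding L2_set_def h by (rule real_sqrt_le_mono) (rule s(2)[OF K, unfolded h])
  then show "L2_set (\<lambda>k. infsum h (triples k)) K \<le> sqrt 27 * W_sum ((3 * \<gamma> - 4 * \<alpha>) / 2) *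
      (sqrt (\<Sum>\<^sub>\<infinity>k. W k powr \<gamma> * (x k)\<^sup>2) * sqrt (\<Sum>\<^sub>\<infinity>k. W k powr \<gamma> * (y k)\<^sup>2) * sqrt (\<Sum>\<^sub>\<infinity>k. W k powr \<gamma> * (z k)\<^sup>2))"
    using Z unfolding infsumI[OF v] S_def[symmetric] Z_def[symmetric] by (simp add: real_sqrt_mult)
qed

section \<open>The cubic nonlinearity\<close>

lemma infsum_minus:
  fixes f g :: "'a \<Rightarrow> 'b::real_normed_vector"
  assumes "f summable_on A" "g summable_on A"
  shows "(\<Sum>\<^sub>\<infinity>x\<in>A. f x - g x) = infsum f A - infsum g A" "(\<lambda>x. f x - g x) summable_on A"
proof -
  have u: "(\<lambda>x. - g x) summable_on A" using assms(2) by (simp add: summable_on_uminus)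
  show "(\<Sum>\<^sub>\<infinity>x\<in>A. f x - g x) = infsum f A - infsum g A"
    using infsum_add[OF assms(1) u] by (simp add: infsum_uminus)
  show "(\<lambda>x. f x - g x) summable_on A"
    using summable_on_add[OF assms(1) u] by simp
qed

text \<open>The first entry is the frequency of the conjugated factor. The conjugate function has
  the coefficient \<open>cnj (f (- i))\<close> at \<open>i\<close>, so that all three frequencies
  enter the output with a plus sign.\<close>

definition cubic_term :: "(int \<Rightarrow> complex) \<Rightarrow> int \<times> int \<times> int \<Rightarrow> complex" where
  "cubic_term f = (\<lambda>(i,j,l). cnj (f (- i)) * f j * f l)"

text \<open>The multiplier \<open>\<kappa>\<close> treats three trilinear forms at once: the
  nonlinearity itself (constant 1), the nonlinearity in the twisted unknown (\<open>phase\<close>)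
  and the one of the scheme (\<open>band_kernel\<close>).\<close>

definition cubic :: "(int \<times> int \<times> int \<Rightarrow> complex) \<Rightarrow> (int \<Rightarrow> complex) \<Rightarrow> int \<Rightarrow> complex" where
  "cubic \<kappa> f k = (\<Sum>\<^sub>\<infinity>q\<in>triples k. \<kappa> q * cubic_term f q)"

lemma reflect_sum:
  fixes f :: "int \<Rightarrow> 'a::{comm_monoid_add,t2_space}"
  shows "infsum (\<lambda>k. f (- k)) UNIV = infsum f UNIV" "(\<lambda>k. f (- k)) summable_on UNIV \<longleftrightarrow> f summable_on UNIV"
  by (rule infsum_reindex_bij_witness[of _ uminus uminus] summable_on_reindex_bij_witness[of _ uminus uminus]; simp)+

lemma cubic_term_bound: "norm (cubic_term f (i,j,l)) = norm (f (- i)) * norm (f j) * norm (f l)"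
  by (simp add: cubic_term_def norm_mult)

lemma cubic_term_diff_bound:
  "norm (cubic_term f (i,j,l) - cubic_term g (i,j,l)) \<le>
     norm (f (- i) - g (- i)) * norm (f j) * norm (f l)
   + norm (g (- i)) * norm (f j - g j) * norm (f l)
   + norm (g (- i)) * norm (g j) * norm (f l - g l)"
proof -
  have "cubic_term f (i,j,l) - cubic_term g (i,j,l) = cnj (f (- i) - g (- i)) * f j * f l
     + cnj (g (- i)) * (f j - g j) * f l + cnj (g (- i)) * g j * (f l - g l)"
    by (simp add: cubic_term_def algebra_simps)
  also have "norm \<dots> \<le> norm (cnj (f (- i) - g (- i)) * f j * f l)
     + norm (cnj (g (- i)) * (f j - g j) * f l) + norm (cnj (g (- i)) * g j * (f l - g l))"
    by (intro norm_triangle_le add_mono) auto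
  finally show ?thesis by (simp add: norm_mult del: complex_cnj_diff)
qed

lemma cubic_summable:
  assumes f: "l1 f" and \<kappa>: "\<And>q. norm (\<kappa> q) \<le> B"
  shows "(\<lambda>q. norm (\<kappa> q * cubic_term f q)) summable_on triples k" "(\<lambda>q. \<kappa> q * cubic_term f q) summable_on triples k"
    and "norm (cubic \<kappa> f k) \<le> B * (\<Sum>\<^sub>\<infinity>(i,j,l)\<in>triples k. norm (f (- i)) * norm (f j) * norm (f l))"
    and "finite K \<Longrightarrow> (\<Sum>k\<in>K. norm (cubic \<kappa> f k)) \<le> B * l1_norm f ^ 3"
proof -
  have rf: "(\<lambda>k. norm (f (- k))) summable_on UNIV"
    using f by (simp add: reflect_sum(2)[of "\<lambda>k. norm (f k)"])
  note ts = triple_sums[OF rf f f]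
  have B: "B \<ge> 0" using order_trans[OF norm_ge_zero \<kappa>] .
  have s: "(\<lambda>q. B * (case q of (i,j,l) \<Rightarrow> norm (f (- i)) * norm (f j) * norm (f l))) summable_on triples k" for k
    by (intro summable_on_cmult_right ts) auto
  have b: "norm (\<kappa> q * cubic_term f q) \<le> B * (case q of (i,j,l) \<Rightarrow> norm (f (- i)) * norm (f j) * norm (f l))" for q
  proof (cases q)
    case (fields i j l)
    then show ?thesis
      using mult_right_mono[OF \<kappa>, of "norm (cubic_term f q)"] by (simp add: norm_mult cubic_term_bound)
  qed
  note d = dominated_infsum[OF s b]
  show "(\<lambda>q. norm (\<kappa> q * cubic_term f q)) summable_on triples k" "(\<lambda>q. \<kappa> q * cubic_term f q) summable_on triples k"
    by (rule d)+
  show le: "norm (cubic \<kappa> f k) \<le> B * (\<Sum>\<^sub>\<infinity>(i,j,l)\<in>triples k. norm (f (- i)) * norm (f j) * norm (f l))" for k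
    using d(3)[of k] by (simp add: cubic_def infsum_cmult_right')
  assume K: "finite K"
  have "(\<Sum>k\<in>K. norm (cubic \<kappa> f k)) \<le> B * (\<Sum>k\<in>K. \<Sum>\<^sub>\<infinity>(i,j,l)\<in>triples k. norm (f (- i)) * norm (f j) * norm (f l))"
    unfolding sum_distrib_left by (intro sum_mono le)
  also have "\<dots> \<le> B * l1_norm f ^ 3"
    using ts(4)[OF _ _ _ K] B reflect_sum(1)[of "\<lambda>k. norm (f k)"]
    by (intro mult_left_mono) (auto simp: power3_eq_cube)
  finally show "(\<Sum>k\<in>K. norm (cubic \<kappa> f k)) \<le> B * l1_norm f ^ 3" .
qed

lemma summable_bounded_sums:
  fixes f :: "'a \<Rightarrow> real"
  assumes "\<And>k. f k \<ge> 0" "\<And>K. finite K \<Longrightarrow> sum f K \<le> C"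
  shows "f summable_on UNIV" "infsum f UNIV \<le> C"
proof -
  show s: "f summable_on UNIV"
    by (rule nonneg_bdd_above_summable_on) (use assms in \<open>auto intro!: bdd_aboveI2[of _ _ C]\<close>)
  show "infsum f UNIV \<le> C"
    by (rule infsum_le_finite_sums[OF s]) (use assms in auto)
qed

lemma l1_cubic:
  assumes f: "l1 f" and \<kappa>: "\<And>q. norm (\<kappa> q) \<le> B"
  shows "l1 (cubic \<kappa> f)" "l1_norm (cubic \<kappa> f) \<le> B * l1_norm f ^ 3"
  using cubic_summable(4)[OF assms] by (auto intro!: summable_bounded_sums)

text \<open>The difference telescopes into three terms, each with one factor \<open>f - g\<close>
  and two factors of l^1 norm at most \<open>R\<close>. The l^2 bound thus uses only l^1 control of
  \<open>f\<close> and \<open>g\<close> separately, which is exactly what the stability argument can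
  provide.\<close>

lemma cubic_diff:
  assumes f: "l1 f" "l1_norm f \<le> R" and g: "l1 g" "l1_norm g \<le> R"
    and \<kappa>: "\<And>q. norm (\<kappa> q) \<le> B" and K: "finite K"
  shows "(\<Sum>k\<in>K. norm (cubic \<kappa> f k - cubic \<kappa> g k)) \<le> 3 * B * R\<^sup>2 * l1_norm (\<lambda>k. f k - g k)"
    and "L2_set (\<lambda>k. norm (cubic \<kappa> f k - cubic \<kappa> g k)) K \<le> 3 * B * R\<^sup>2 * sqrt (\<Sum>\<^sub>\<infinity>k. (norm (f k - g k))\<^sup>2)"
proof -
  define F G D where "F = (\<lambda>k. norm (f k))" and "G = (\<lambda>k. norm (g k))" and "D = (\<lambda>k. norm (f k - g k))"
  have B: "B \<ge> 0" using order_trans[OF norm_ge_zero \<kappa>] .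
  have nn: "F k \<ge> 0" "G k \<ge> 0" "D k \<ge> 0" for k by (auto simp: F_def G_def D_def)
  have lD: "D summable_on UNIV"
    unfolding D_def
    by (rule summable_on_comparison_test[OF summable_on_add[OF f(1) g(1)]]) (auto simp: norm_triangle_ineq4)
  have D2: "(\<lambda>k. (D k)\<^sup>2) summable_on UNIV"
    unfolding D_def using lD by (intro l1_square_summable) (simp add: D_def)
  have FG: "F summable_on UNIV" "G summable_on UNIV" using f g by (simp_all add: F_def G_def)
  have r: "(\<lambda>k. F (- k)) summable_on UNIV" "(\<lambda>k. G (- k)) summable_on UNIV" "(\<lambda>k. D (- k)) summable_on UNIV"
    "(\<lambda>k. (D (- k))\<^sup>2) summable_on UNIV"
    using FG lD D2 reflect_sum(2)[of F] reflect_sum(2)[of G] reflect_sum(2)[of D] reflect_sum(2)[of "\<lambda>k. (D k)\<^sup>2"] by auto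
  have ri: "(\<Sum>\<^sub>\<infinity>k. F (- k)) = infsum F UNIV" "(\<Sum>\<^sub>\<infinity>k. G (- k)) = infsum G UNIV" "(\<Sum>\<^sub>\<infinity>k. D (- k)) = infsum D UNIV"
    "(\<Sum>\<^sub>\<infinity>k. (D (- k))\<^sup>2) = (\<Sum>\<^sub>\<infinity>k. (D k)\<^sup>2)"
    by (rule reflect_sum(1)[of F] reflect_sum(1)[of G] reflect_sum(1)[of D] reflect_sum(1)[of "\<lambda>k. (D k)\<^sup>2"])+
  have FR: "infsum F UNIV \<le> R" "infsum G UNIV \<le> R" using f g by (simp_all add: F_def G_def)
  have F0: "infsum F UNIV \<ge> 0" "infsum G UNIV \<ge> 0" "infsum D UNIV \<ge> 0" "(\<Sum>\<^sub>\<infinity>k. (D k)\<^sup>2) \<ge> 0"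
    using nn by (auto intro: infsum_nonneg)
  have R: "R \<ge> 0" using F0 FR by linarith
  let ?h1 = "\<lambda>(i,j,l). D (- i) * F j * F l" and ?h2 = "\<lambda>(i,j,l). G (- i) * D j * F l" and ?h3 = "\<lambda>(i,j,l). G (- i) * G j * D l"
  define S where "S h k = infsum h (triples k)" for h :: "int \<times> int \<times> int \<Rightarrow> real" and k
  note t1 = triple_sums[OF r(3) FG(1,1) nn(3,1,1)] and t2 = triple_sums[OF r(2) lD FG(1) nn(2,3,1)]
    and t3 = triple_sums[OF r(2) FG(2) lD nn(2,2,3)]
  have point: "norm (cubic \<kappa> f k - cubic \<kappa> g k) \<le> B * (S ?h1 k + S ?h2 k + S ?h3 k)" for k
  proof -
    have s: "(\<lambda>q. B * (?h1 q + ?h2 q + ?h3 q)) summable_on triples k"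
      by (intro summable_on_cmult_right summable_on_add t1 t2 t3)
    have b: "norm (\<kappa> q * (cubic_term f q - cubic_term g q)) \<le> B * (?h1 q + ?h2 q + ?h3 q)" for q
    proof (cases q)
      case (fields i j l)
      show ?thesis
        using mult_mono[OF \<kappa>[of q] cubic_term_diff_bound[of f i j l g] B] fields
        by (simp add: norm_mult F_def G_def D_def)
    qed
    have "cubic \<kappa> f k - cubic \<kappa> g k = (\<Sum>\<^sub>\<infinity>q\<in>triples k. \<kappa> q * (cubic_term f q - cubic_term g q))"
      unfolding cubic_def right_diff_distrib
      by (rule infsum_minus(1)[symmetric]) (rule cubic_summable(2)[OF _ \<kappa>], use f g in simp)+
    also have "norm \<dots> \<le> (\<Sum>\<^sub>\<infinity>q\<in>triples k. B * (?h1 q + ?h2 q + ?h3 q))"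
      by (rule dominated_infsum(3)[OF s b])
    also have "\<dots> = B * (S ?h1 k + S ?h2 k + S ?h3 k)"
      unfolding S_def infsum_cmult_right'
      by (subst infsum_add infsum_add, (intro summable_on_add t1 t2 t3)+)+ simp
    finally show ?thesis .
  qed
  have Snn: "S ?h1 k \<ge> 0" "S ?h2 k \<ge> 0" "S ?h3 k \<ge> 0" for k
    unfolding S_def by (auto intro!: infsum_nonneg mult_nonneg_nonneg nn)
  have RR: "X * X' * Y \<le> R\<^sup>2 * Y" if "X \<le> R" "X' \<le> R" "0 \<le> X" "0 \<le> X'" "0 \<le> Y" for X X' Y
    unfolding power2_eq_square using that R by (intro mult_right_mono mult_mono) auto
  have "(\<Sum>k\<in>K. norm (cubic \<kappa> f k - cubic \<kappa> g k)) \<le> (\<Sum>k\<in>K. B * (S ?h1 k + S ?h2 k + S ?h3 k))"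
    by (intro sum_mono point)
  also have "\<dots> = B * (sum (S ?h1) K + sum (S ?h2) K + sum (S ?h3) K)"
    by (simp add: sum_distrib_left[symmetric] sum.distrib)
  also have "\<dots> \<le> B * (R\<^sup>2 * infsum D UNIV + R\<^sup>2 * infsum D UNIV + R\<^sup>2 * infsum D UNIV)"
  proof (intro mult_left_mono add_mono B)
    show "sum (S ?h1) K \<le> R\<^sup>2 * infsum D UNIV"
      using t1(4)[OF K] RR[OF FR(1,1) F0(1,1,3)] by (simp add: S_def ri mult_ac)
    show "sum (S ?h2) K \<le> R\<^sup>2 * infsum D UNIV"
      using t2(4)[OF K] RR[OF FR(2,1) F0(2,1,3)] by (simp add: S_def ri mult_ac)
    show "sum (S ?h3) K \<le> R\<^sup>2 * infsum D UNIV"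
      using t3(4)[OF K] RR[OF FR(2,2) F0(2,2,3)] by (simp add: S_def ri mult_ac)
  qed
  finally show "(\<Sum>k\<in>K. norm (cubic \<kappa> f k - cubic \<kappa> g k)) \<le> 3 * B * R\<^sup>2 * l1_norm (\<lambda>k. f k - g k)"
    by (simp add: D_def)
  let ?E = "sqrt (\<Sum>\<^sub>\<infinity>k. (D k)\<^sup>2)"
  have E: "?E \<ge> 0" using F0 by simp
  have "L2_set (\<lambda>k. norm (cubic \<kappa> f k - cubic \<kappa> g k)) K \<le> L2_set (\<lambda>k. B * (S ?h1 k + S ?h2 k + S ?h3 k)) K"
    by (intro L2_set_mono point) auto
  also have "\<dots> = B * L2_set (\<lambda>k. S ?h1 k + S ?h2 k + S ?h3 k) K"
    using B by (rule L2_set_right_distrib[symmetric])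
  also have "\<dots> \<le> B * (L2_set (S ?h1) K + L2_set (S ?h2) K + L2_set (S ?h3) K)"
    by (intro mult_left_mono order_trans[OF L2_set_triangle_ineq] add_mono B) auto
  also have "\<dots> \<le> B * (R\<^sup>2 * ?E + R\<^sup>2 * ?E + R\<^sup>2 * ?E)"
  proof (intro mult_left_mono add_mono B)
    show "L2_set (S ?h1) K \<le> R\<^sup>2 * ?E"
      using young_l2(4)[OF FG(1) nn(1) FG(1) nn(1) r(4) K] RR[OF FR(1,1) F0(1,1) E]
      unfolding S_def[abs_def] ri by linarith
    show "L2_set (S ?h2) K \<le> R\<^sup>2 * ?E"
      using young_l2(5)[OF r(2) nn(2) FG(1) nn(1) D2 K] RR[OF FR(2,1) F0(2,1) E]
      unfolding S_def[abs_def] ri by linarith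
    show "L2_set (S ?h3) K \<le> R\<^sup>2 * ?E"
      using young_l2(6)[OF r(2) nn(2) FG(2) nn(2) D2 K] RR[OF FR(2,2) F0(2,2) E]
      unfolding S_def[abs_def] ri by linarith
  qed
  finally show "L2_set (\<lambda>k. norm (cubic \<kappa> f k - cubic \<kappa> g k)) K \<le> 3 * B * R\<^sup>2 * sqrt (\<Sum>\<^sub>\<infinity>k. (norm (f k - g k))\<^sup>2)"
    by (simp add: D_def)
qed

lemma fourier_coeff_cubic:
  assumes f: "f \<in> torus_Hs s" "s > 1/2"
  shows "fourier_coeff (\<lambda>y. of_real ((cmod (f y))\<^sup>2) * f y) k = cubic (\<lambda>_. 1) (fourier_coeff f) k"
proof -
  let ?c = "fourier_coeff f" and ?b = "\<lambda>k. cnj (fourier_coeff f (- k))"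
  have c: "l1 ?c" by (rule torus_Hs_l1[OF f])
  have b: "l1 ?b" by (rule abs_summable_reflect[OF c])
  have [measurable]: "f \<in> borel_measurable borel" using f(1) by (simp add: torus_Hs_def)
  note t = l1_tri[OF b c c]
  have "fourier_coeff (\<lambda>y. of_real ((cmod (f y))\<^sup>2) * f y) k = fourier_coeff (FS (tri ?b ?c ?c)) k"
  proof (rule fourier_coeff_cong_AE)
    show "(\<lambda>y. of_real ((cmod (f y))\<^sup>2) * f y) \<in> borel_measurable borel" by measurable
    show "FS (tri ?b ?c ?c) \<in> borel_measurable borel" by (rule measurable_FS[OF t])
    show "AE x in lborel. x \<in> {0..2 * pi} \<longrightarrow> complex_of_real ((cmod (f x))\<^sup>2) * f x = FS (tri ?b ?c ?c) x"
      using torus_Hs_AE_FS[OF f]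
    proof eventually_elim
      case (elim x)
      have "complex_of_real ((cmod (f x))\<^sup>2) * f x = cnj (FS ?c x) * FS ?c x * FS ?c x"
        unfolding complex_norm_square by (simp add: elim mult_ac)
      then show ?case by (simp add: cnj_FS FS_tri[OF b c c])
    qed
  qed
  also have "\<dots> = tri ?b ?c ?c k" by (rule fourier_coeff_FS[OF t])
  also have "\<dots> = cubic (\<lambda>_. 1) ?c k" by (simp add: tri_def cubic_def cubic_term_def)
  finally show ?thesis .
qed

section \<open>The linear group and the equation for the modes\<close>

definition disp :: "real \<Rightarrow> int \<Rightarrow> complex" where
  "disp t k = exp (- (\<i> * of_real t * (of_int k)\<^sup>2))"

lemma disp_cis: "disp t k = cis (- (t * (of_int k)\<^sup>2))"
  by (simp add: disp_def cis_conv_exp mult.assoc)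

lemma norm_disp [simp]: "norm (disp t k) = 1"
  by (simp add: disp_cis)

lemma disp_0 [simp]: "disp 0 k = 1" by (simp add: disp_def)

lemma disp_add: "disp s k * disp t k = disp (s + t) k"
  by (simp add: disp_cis cis_mult algebra_simps)

lemma continuous_on_disp [continuous_intros]:
  "continuous_on A f \<Longrightarrow> continuous_on A (\<lambda>x. disp (f x) k)"
  unfolding disp_def by (intro continuous_intros)

lemma schroedinger_group_FS: "schroedinger_group t f = FS (\<lambda>k. disp t k * fourier_coeff f k)"
  by (simp add: schroedinger_group_def fourier_mult_def FS_def wave_def disp_def fun_eq_iff)

text \<open>What is kept of the solution: a weighted bound at every time, continuity in l^1, and
  Duhamel's formula mode by mode. Constants defined from \<gamma>, \<open>T\<close> and
  \<open>m\<close> alone do not see \<open>c\<close>.\<close>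

locale nls_modes =
  fixes \<gamma> T m :: real and c :: "real \<Rightarrow> int \<Rightarrow> complex"
  assumes \<gamma>: "1/2 < \<gamma>" "\<gamma> \<le> 1" and T: "T > 0" and m: "m \<ge> 0"
    and weighted_summable: "t \<in> {0..T} \<Longrightarrow> sobolev_summable \<gamma> (c t)"
    and weighted_bound: "t \<in> {0..T} \<Longrightarrow> sobolev_sum \<gamma> (c t) \<le> m\<^sup>2"
    and c_continuous: "t \<in> {0..T} \<Longrightarrow> ((\<lambda>s. \<Sum>\<^sub>\<infinity>k. norm (c s k - c t k)) \<longlongrightarrow> 0) (at t within {0..T})"
    and duhamel: "t \<in> {0..T} \<Longrightarrow>
      c t k = disp t k * c 0 k - \<i> * integral {0..t} (\<lambda>s. disp (t - s) k * cubic (\<lambda>_. 1) (c s) k)"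

text \<open>The essential supremum controls only almost every interior time. A continuous function
  that exceeded \<open>C\<close> at some \<open>t\<close>, possibly an endpoint, would exceed it on
  an open interval inside \<open>{0<..<T}\<close>, which has positive measure.\<close>

lemma le_of_AE_continuous:
  fixes \<phi> :: "real \<Rightarrow> real"
  assumes T: "T > 0" and cont: "continuous_on {0..T} \<phi>"
    and ae: "AE t in lborel. t \<in> {0<..<T} \<longrightarrow> \<phi> t \<le> C" and t: "t \<in> {0..T}"
  shows "\<phi> t \<le> C"
proof (rule ccontr)
  assume "\<not> \<phi> t \<le> C"
  then have "\<phi> t - C > 0" by simp
  with cont t obtain d where d: "d > 0" "\<And>s. s \<in> {0..T} \<Longrightarrow> dist s t < d \<Longrightarrow> dist (\<phi> s) (\<phi> t) < \<phi> t - C"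
    unfolding continuous_on_iff by metis
  let ?J = "{max 0 (t - d)<..<min T (t + d)}"
  have J: "max 0 (t - d) < min T (t + d)" using T t d(1) by auto
  have "\<phi> s > C" "s \<in> {0<..<T}" if "s \<in> ?J" for s
  proof -
    have "dist (\<phi> s) (\<phi> t) < \<phi> t - C" using that by (intro d(2)) (auto simp: dist_real_def)
    then show "\<phi> s > C" by (auto simp: dist_real_def)
  qed (use that in auto)
  then have "AE s in lborel. s \<notin> ?J"
    using ae by (auto elim!: eventually_mono) (smt (verit))
  then have "?J \<in> null_sets lborel"
    by (subst (asm) AE_iff_null_sets[symmetric]) auto
  then show False using J by (auto simp: null_sets_def)
qed

section \<open>The solution in Fourier modes\<close>

lemma torus_Hs_norm_sq:
  "(torus_Hs_norm s f)\<^sup>2 = 2 * pi * sobolev_sum s (fourier_coeff f)"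
  unfolding torus_Hs_norm_def by (rule real_sqrt_pow2) (auto intro!: mult_nonneg_nonneg infsum_nonneg)

text \<open>Turns continuity of the solution in H^\<gamma> into continuity of its coefficients in
  l^1.\<close>

lemma torus_Hs_diff:
  assumes f: "f \<in> torus_Hs s" and g: "g \<in> torus_Hs s" and s: "s > 1/2"
  shows "l1_norm (\<lambda>k. fourier_coeff f k - fourier_coeff g k)
    \<le> sqrt (W_sum s) / sqrt (2 * pi) * torus_Hs_norm s (\<lambda>x. f x - g x)"
proof -
  let ?d = "\<lambda>k. norm (fourier_coeff f k - fourier_coeff g k)"
  have sf: "sobolev_summable s (fourier_coeff f)"
    and sg: "sobolev_summable s (fourier_coeff g)"
    using f g by (auto simp: torus_Hs_def)
  have sum: "(\<lambda>k. W k powr s * (?d k)\<^sup>2) summable_on UNIV"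
  proof (rule summable_on_comparison_test)
    show "(\<lambda>k. 2 * (W k powr s * (norm (fourier_coeff f k))\<^sup>2) + 2 * (W k powr s * (norm (fourier_coeff g k))\<^sup>2)) summable_on UNIV"
      by (intro summable_on_add summable_on_cmult_right sf sg)
    fix k
    have "?d k \<le> norm (fourier_coeff f k) + norm (fourier_coeff g k)" by (rule norm_triangle_ineq4)
    then have "(?d k)\<^sup>2 \<le> (norm (fourier_coeff f k) + norm (fourier_coeff g k))\<^sup>2" by (rule power_mono) simp
    also have "\<dots> \<le> 2 * (norm (fourier_coeff f k))\<^sup>2 + 2 * (norm (fourier_coeff g k))\<^sup>2"
      using zero_le_power2[of "norm (fourier_coeff f k) - norm (fourier_coeff g k)"] by (simp add: power2_sum power2_diff)
    finally have "W k powr s * (?d k)\<^sup>2 \<le> W k powr s * (2 * (norm (fourier_coeff f k))\<^sup>2 + 2 * (norm (fourier_coeff g k))\<^sup>2)"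
      by (rule mult_left_mono) simp
    then show "W k powr s * (?d k)\<^sup>2 \<le> 2 * (W k powr s * (norm (fourier_coeff f k))\<^sup>2) + 2 * (W k powr s * (norm (fourier_coeff g k))\<^sup>2)"
      by (simp add: algebra_simps)
  qed auto
  have "fourier_coeff (\<lambda>x. f x - g x) k = fourier_coeff f k - fourier_coeff g k" for k
    by (intro fourier_coeff_diff torus_Hs_integrable[OF f] torus_Hs_integrable[OF g])
  then have "torus_Hs_norm s (\<lambda>x. f x - g x) = sqrt (2 * pi) * sqrt (\<Sum>\<^sub>\<infinity>k. W k powr s * (?d k)\<^sup>2)"
    by (simp add: torus_Hs_norm_def real_sqrt_mult)
  then show ?thesis
    using weighted_l1_bound(2)[OF s _ sum] by (simp add: mult_ac)
qed

lemma fourier_modes_cubic_continuous: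
  fixes c :: "real \<Rightarrow> int \<Rightarrow> complex"
  assumes l: "\<And>t. t \<in> I \<Longrightarrow> l1 (c t)" and R: "\<And>t. t \<in> I \<Longrightarrow> l1_norm (c t) \<le> R"
    and lim: "((\<lambda>s. \<Sum>\<^sub>\<infinity>k. norm (c s k - c t k)) \<longlongrightarrow> 0) (at t within I)" and t: "t \<in> I"
  shows "((\<lambda>s. \<Sum>\<^sub>\<infinity>k. norm (cubic (\<lambda>_. 1) (c s) k - cubic (\<lambda>_. 1) (c t) k)) \<longlongrightarrow> 0) (at t within I)"
proof (rule tendsto_sandwich)
  show "\<forall>\<^sub>F s in at t within I. 0 \<le> l1_norm (\<lambda>k. cubic (\<lambda>_. 1) (c s) k - cubic (\<lambda>_. 1) (c t) k)"
    by (intro always_eventually allI infsum_nonneg) auto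
  show "\<forall>\<^sub>F s in at t within I. l1_norm (\<lambda>k. cubic (\<lambda>_. 1) (c s) k - cubic (\<lambda>_. 1) (c t) k) \<le> 3 * 1 * R\<^sup>2 * l1_norm (\<lambda>k. c s k - c t k)"
  proof -
    have "l1_norm (\<lambda>k. cubic (\<lambda>_. 1) (c s) k - cubic (\<lambda>_. 1) (c t) k) \<le> 3 * 1 * R\<^sup>2 * l1_norm (\<lambda>k. c s k - c t k)"
      if s: "s \<in> I" for s
      by (rule summable_bounded_sums(2)) (simp, rule cubic_diff(1)[OF l[OF s] R[OF s] l[OF t] R[OF t]], simp_all)
    then show ?thesis by (auto simp: eventually_at_filter)
  qed
  show "((\<lambda>s. 3 * 1 * R\<^sup>2 * l1_norm (\<lambda>k. c s k - c t k)) \<longlongrightarrow> 0) (at t within I)"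
    using tendsto_mult_right_zero[OF lim, of "3 * 1 * R\<^sup>2"] by simp
qed auto

lemma tendsto_of_l1:
  fixes c :: "real \<Rightarrow> int \<Rightarrow> complex"
  assumes l: "\<And>t. t \<in> I \<Longrightarrow> l1 (c t)" and t: "t \<in> I"
    and lim: "((\<lambda>s. \<Sum>\<^sub>\<infinity>k. norm (c s k - c t k)) \<longlongrightarrow> 0) (at t within I)"
  shows "((\<lambda>s. c s k) \<longlongrightarrow> c t k) (at t within I)"
proof (rule LIM_zero_cancel, rule Lim_null_comparison[OF _ lim])
  have "norm (c s k - c t k) \<le> l1_norm (\<lambda>k. c s k - c t k)" if "s \<in> I" for s
  proof -
    have "(\<lambda>k. norm (c s k - c t k)) summable_on UNIV"
      by (rule summable_on_comparison_test[OF summable_on_add[OF l[OF that] l[OF t]]]) (auto simp: norm_triangle_ineq4)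
    from finite_sum_le_infsum[OF this, of "{k}"] show ?thesis by simp
  qed
  then show "\<forall>\<^sub>F s in at t within I. norm (c s k - c t k) \<le> l1_norm (\<lambda>k. c s k - c t k)"
    by (auto simp: eventually_at_filter)
qed

lemma norm_FS_diff_le:
  assumes "l1 a" "l1 b"
  shows "norm (FS a x - FS b x) \<le> l1_norm (\<lambda>k. a k - b k)"
proof -
  have "l1 (\<lambda>k. a k - b k)"
    by (rule summable_on_comparison_test[OF summable_on_add[OF assms]]) (auto simp: norm_triangle_ineq4)
  from norm_FS_le[OF this] show ?thesis by (simp add: FS_diff[OF assms])
qed

lemma continuous_on_wave_compose [continuous_intros]:
  "continuous_on A f \<Longrightarrow> continuous_on A (\<lambda>x. wave k (f x))"
  unfolding wave_def by (intro continuous_intros)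

text \<open>With the coefficients frozen at \<open>s0\<close> the series is a uniform limit of
  continuous functions of both variables, and replacing \<open>G s\<close> by \<open>G s0\<close>
  changes it by at most their l^1 distance, uniformly in \<open>x\<close>. Joint continuity
  justifies the exchange of the two integrals in \<open>fourier_coeff_duhamel\<close>.\<close>

lemma continuous_on_FS_joint:
  fixes G :: "real \<Rightarrow> int \<Rightarrow> complex"
  assumes l: "\<And>s. s \<in> I \<Longrightarrow> l1 (G s)"
    and lim: "\<And>t. t \<in> I \<Longrightarrow> ((\<lambda>s. \<Sum>\<^sub>\<infinity>k. norm (G s k - G t k)) \<longlongrightarrow> 0) (at t within I)"
  shows "continuous_on (I \<times> UNIV) (\<lambda>(s,x). FS (\<lambda>k. disp (t - s) k * G s k) x)"
  unfolding continuous_on_iff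
proof (intro ballI allI impI)
  fix p and e :: real assume p: "p \<in> I \<times> (UNIV :: real set)" and e: "e > 0"
  obtain s0 x0 where p0: "p = (s0, x0)" "s0 \<in> I" using p by auto
  define h where "h = (\<lambda>p. FS (\<lambda>k. disp (t - fst p) k * G s0 k) (snd p))"
  have "uniform_limit UNIV (\<lambda>X p. \<Sum>k\<in>X. disp (t - fst p) k * G s0 k * wave k (snd p)) h (finite_subsets_at_top UNIV)"
    unfolding h_def FS_def
    by (rule Weierstrass_m_test_general[where M = "\<lambda>k. norm (G s0 k)"]) (use l[OF p0(2)] in \<open>auto simp: norm_mult\<close>)
  then have "continuous_on UNIV h"
    by (rule uniform_limit_theorem[rotated]) (auto intro!: always_eventually continuous_intros)
  then obtain d1 where d1: "d1 > 0" "\<And>q. dist q p < d1 \<Longrightarrow> dist (h q) (h p) < e/2"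
    using e unfolding continuous_on_iff by (meson UNIV_I half_gt_zero)
  obtain d2 where d2: "d2 > 0" "\<And>s. s \<in> I \<Longrightarrow> s \<noteq> s0 \<Longrightarrow> dist s s0 < d2 \<Longrightarrow> dist (l1_norm (\<lambda>k. G s k - G s0 k)) 0 < e/2"
    using lim[OF p0(2)] e unfolding Lim_within by (metis half_gt_zero zero_less_dist_iff)
  show "\<exists>d>0. \<forall>q\<in>I \<times> UNIV. dist q p < d \<longrightarrow>
      dist (case q of (s,x) \<Rightarrow> FS (\<lambda>k. disp (t - s) k * G s k) x) (case p of (s,x) \<Rightarrow> FS (\<lambda>k. disp (t - s) k * G s k) x) < e"
  proof (intro exI[of _ "min d1 d2"] conjI ballI impI)
    fix q assume q: "q \<in> I \<times> (UNIV :: real set)" "dist q p < min d1 d2"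
    obtain s x where qs: "q = (s,x)" "s \<in> I" using q by auto
    have ds: "dist s s0 < d2"
      using q(2) dist_fst_le[of q p] by (simp add: qs p0)
    have "norm (FS (\<lambda>k. disp (t - s) k * G s k) x - h q) \<le> l1_norm (\<lambda>k. disp (t - s) k * G s k - disp (t - s) k * G s0 k)"
      unfolding h_def qs fst_conv snd_conv
      by (rule norm_FS_diff_le) (use l qs p0 in \<open>simp_all add: norm_mult\<close>)
    also have "\<dots> = l1_norm (\<lambda>k. G s k - G s0 k)"
      by (simp add: right_diff_distrib[symmetric] norm_mult)
    also have "\<dots> < e/2"
      using d2(2)[OF qs(2) _ ds] e by (cases "s = s0") auto
    finally have 1: "dist (FS (\<lambda>k. disp (t - s) k * G s k) x) (h q) < e/2" by (simp add: dist_norm)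
    have "dist (h q) (h p) < e/2" using q(2) by (intro d1(2)) simp
    with 1 have "dist (FS (\<lambda>k. disp (t - s) k * G s k) x) (h p) < e"
      using dist_triangle[of "FS (\<lambda>k. disp (t - s) k * G s k) x" "h p" "h q"] by linarith
    then show "dist (case q of (s,x) \<Rightarrow> FS (\<lambda>k. disp (t - s) k * G s k) x) (case p of (s,x) \<Rightarrow> FS (\<lambda>k. disp (t - s) k * G s k) x) < e"
      by (simp add: qs p0 h_def)
  qed (use d1 d2 in auto)
qed

lemma fourier_coeff_duhamel:
  fixes G :: "real \<Rightarrow> int \<Rightarrow> complex"
  assumes t: "t \<ge> 0" and l: "\<And>s. s \<in> {0..t} \<Longrightarrow> l1 (G s)"
    and lim: "\<And>r. r \<in> {0..t} \<Longrightarrow> ((\<lambda>s. \<Sum>\<^sub>\<infinity>k. norm (G s k - G r k)) \<longlongrightarrow> 0) (at r within {0..t})"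
  defines "D \<equiv> \<lambda>x. integral {0..t} (\<lambda>s. FS (\<lambda>k. disp (t - s) k * G s k) x)"
  shows "continuous_on UNIV D" "fourier_coeff D k = integral {0..t} (\<lambda>s. disp (t - s) k * G s k)"
proof -
  let ?g = "\<lambda>s. FS (\<lambda>k. disp (t - s) k * G s k)"
  have lg: "l1 (\<lambda>k. disp (t - s) k * G s k)" if "s \<in> {0..t}" for s
    using l[OF that] by (simp add: norm_mult)
  have joint: "continuous_on ({0..t} \<times> UNIV) (\<lambda>(s,x). ?g s x)"
    by (rule continuous_on_FS_joint[OF l lim])
  have sw: "continuous_on (UNIV \<times> {0..t}) (\<lambda>(x,s). ?g s x)"
  proof -
    have "continuous_on (UNIV \<times> {0..t}) (\<lambda>p. case (snd p, fst p) of (s,x) \<Rightarrow> ?g s x)"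
      by (rule continuous_on_compose2[OF joint]) (auto intro!: continuous_intros)
    then show ?thesis by (simp add: case_prod_unfold)
  qed
  show cD: "continuous_on UNIV D"
    unfolding D_def using integral_continuous_on_param[of UNIV 0 t "\<lambda>x s. ?g s x"] sw by simp
  have "fourier_coeff D k = 1 / (2 * pi) * integral {0..2*pi} (\<lambda>x. wave (- k) x * D x)"
    by (rule fourier_coeff_continuous) (rule continuous_on_subset[OF cD], simp)
  also have "(\<lambda>x. wave (- k) x * D x) = (\<lambda>x. integral {0..t} (\<lambda>s. wave (- k) x * ?g s x))"
    by (simp add: D_def)
  also have "integral {0..2*pi} (\<lambda>x. integral {0..t} (\<lambda>s. wave (- k) x * ?g s x)) =
      integral {0..t} (\<lambda>s. integral {0..2*pi} (\<lambda>x. wave (- k) x * ?g s x))"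
  proof -
    have "continuous_on ({0..2*pi} \<times> {0..t}) (\<lambda>p. wave (- k) (fst p) * (case p of (x,s) \<Rightarrow> ?g s x))"
      by (intro continuous_intros continuous_on_subset[OF sw]) auto
    then have "continuous_on (cbox (0,0) (2*pi,t)) (\<lambda>(x,s). wave (- k) x * ?g s x)"
      by (simp add: cbox_Pair_eq case_prod_unfold)
    from integral_swap_continuous[OF this] show ?thesis by simp
  qed
  also have "1 / (2 * pi) * \<dots> = integral {0..t} (\<lambda>s. 1 / (2 * pi) * integral {0..2*pi} (\<lambda>x. wave (- k) x * ?g s x))"
    by simp
  also have "\<dots> = integral {0..t} (\<lambda>s. disp (t - s) k * G s k)"
  proof (rule integral_cong)
    fix s assume s: "s \<in> {0..t}"
    show "1 / (2 * pi) * integral {0..2*pi} (\<lambda>x. wave (- k) x * ?g s x) = disp (t - s) k * G s k"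
      using fourier_coeff_continuous[OF continuous_on_FS[OF lg[OF s]], of k] fourier_coeff_FS[OF lg[OF s], of k] by simp
  qed
  finally show "fourier_coeff D k = integral {0..t} (\<lambda>s. disp (t - s) k * G s k)" .
qed

lemma tendsto_within_Icc_mono:
  "(f \<longlongrightarrow> l) (at r within {0..T}) \<Longrightarrow> t \<le> T \<Longrightarrow> (f \<longlongrightarrow> l) (at r within {0..t::real})"
  by (rule tendsto_within_subset) auto

text \<open>Coefficients do not see null sets, so the almost everywhere identities become identities
  of modes. Using \<open>\<bar>M\<bar>\<close> makes the bound nonnegative at once, and
  \<open>sqrt (2 * pi)\<close> comes from the normalisation of the Sobolev norm.\<close>

theorem nls_solution_modes:
  assumes sol: "nls_solution \<gamma> T u0 u" and M: "Linf_Hs_norm \<gamma> T u = ereal M"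
    and T: "T > 0" and \<gamma>: "1/2 < \<gamma>" "\<gamma> \<le> 1"
  shows "nls_modes \<gamma> T (\<bar>M\<bar> / sqrt (2 * pi)) (\<lambda>t. fourier_coeff (u t))"
    and "fourier_coeff (u 0) = fourier_coeff u0"
proof -
  define c where "c = (\<lambda>t. fourier_coeff (u t))"
  have u0: "u0 \<in> torus_Hs \<gamma>" and u: "\<And>t. t \<in> {0..T} \<Longrightarrow> u t \<in> torus_Hs \<gamma>"
    and ucont: "\<And>t. t \<in> {0..T} \<Longrightarrow> ((\<lambda>s. torus_Hs_norm \<gamma> (\<lambda>x. u s x - u t x)) \<longlongrightarrow> 0) (at t within {0..T})"
    and init: "AE x in lborel. u 0 x = u0 x"
    and duh: "\<And>t. t \<in> {0..T} \<Longrightarrow> AE x in lborel. u t x = schroedinger_group t u0 x -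
          \<i> * integral {0..t} (\<lambda>s. schroedinger_group (t - s) (\<lambda>y. of_real ((cmod (u s y))\<^sup>2) * u s y) x)"
    using sol by (auto simp: nls_solution_def)
  have bu: "u t \<in> borel_measurable borel" if "t \<in> {0..T}" for t using u[OF that] by (simp add: torus_Hs_def)
  have bu0: "u0 \<in> borel_measurable borel" using u0 by (simp add: torus_Hs_def)
  show c0: "fourier_coeff (u 0) = fourier_coeff u0"
    by (intro ext fourier_coeff_cong_AE bu bu0) (use init T in auto)
  have ws: "sobolev_summable \<gamma> (c t)" if "t \<in> {0..T}" for t
    using u[OF that] by (simp add: torus_Hs_def c_def)
  have lc: "l1 (c t)" if "t \<in> {0..T}" for t
    unfolding c_def by (rule torus_Hs_l1[OF u[OF that] \<gamma>(1)])
  have cc: "((\<lambda>s. \<Sum>\<^sub>\<infinity>k. norm (c s k - c t k)) \<longlongrightarrow> 0) (at t within {0..T})" if t: "t \<in> {0..T}" for t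
  proof (rule Lim_null_comparison)
    let ?C = "sqrt (W_sum \<gamma>) / sqrt (2 * pi)"
    show "((\<lambda>s. ?C * torus_Hs_norm \<gamma> (\<lambda>x. u s x - u t x)) \<longlongrightarrow> 0) (at t within {0..T})"
      by (rule tendsto_mult_right_zero[OF ucont[OF t]])
    have "norm (l1_norm (\<lambda>k. c s k - c t k)) \<le> ?C * torus_Hs_norm \<gamma> (\<lambda>x. u s x - u t x)" if "s \<in> {0..T}" for s
      using torus_Hs_diff[OF u[OF that] u[OF t] \<gamma>(1)] by (simp add: c_def infsum_nonneg)
    then show "\<forall>\<^sub>F s in at t within {0..T}. norm (l1_norm (\<lambda>k. c s k - c t k)) \<le> ?C * torus_Hs_norm \<gamma> (\<lambda>x. u s x - u t x)"
      by (auto simp: eventually_at_filter)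
  qed
  have ck: "continuous_on {0..T} (\<lambda>s. c s k)" for k
    unfolding continuous_on_def using tendsto_of_l1[OF lc _ cc] by blast
  have aeM: "AE t in lborel. t \<in> {0<..<T} \<longrightarrow> torus_Hs_norm \<gamma> (u t) \<le> M"
  proof -
    have "AE t in restrict_space lborel {0<..<T}. ereal (torus_Hs_norm \<gamma> (u t)) \<le> ereal M"
      using esssup_AE[of "\<lambda>t. ereal (torus_Hs_norm \<gamma> (u t))" "restrict_space lborel {0<..<T}"] M
      by (simp add: Linf_Hs_norm_def)
    then show ?thesis by (subst (asm) AE_restrict_space_iff) auto
  qed
  \<comment> \<open>A finite partial sum is continuous in time because single modes are. The bound
    passes from almost every to every time for each partial sum, and then to the infinite
    sum.\<close>
  have wb: "sobolev_sum \<gamma> (c t) \<le> (\<bar>M\<bar> / sqrt (2 * pi))\<^sup>2" if t: "t \<in> {0..T}" for t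
  proof (rule infsum_le_finite_sums[OF ws[OF t]])
    fix F :: "int set" assume F: "finite F"
    show "(\<Sum>k\<in>F. W k powr \<gamma> * (norm (c t k))\<^sup>2) \<le> (\<bar>M\<bar> / sqrt (2 * pi))\<^sup>2"
    proof (rule le_of_AE_continuous[OF T _ _ t])
      show "continuous_on {0..T} (\<lambda>t. \<Sum>k\<in>F. W k powr \<gamma> * (norm (c t k))\<^sup>2)"
        by (intro continuous_intros ck)
      show "AE t in lborel. t \<in> {0<..<T} \<longrightarrow> (\<Sum>k\<in>F. W k powr \<gamma> * (norm (c t k))\<^sup>2) \<le> (\<bar>M\<bar> / sqrt (2 * pi))\<^sup>2"
        using aeM
      proof eventually_elim
        case (elim t)
        show ?case
        proof
          assume t: "t \<in> {0<..<T}"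
          then have tT: "t \<in> {0..T}" by auto
          have n0: "torus_Hs_norm \<gamma> (u t) \<ge> 0" unfolding torus_Hs_norm_def by (auto intro!: mult_nonneg_nonneg infsum_nonneg)
          have "2 * pi * sobolev_sum \<gamma> (c t) = (torus_Hs_norm \<gamma> (u t))\<^sup>2"
            by (simp add: torus_Hs_norm_sq c_def)
          also have "\<dots> \<le> \<bar>M\<bar>\<^sup>2" using elim t n0 by (intro power_mono) auto
          finally have "sobolev_sum \<gamma> (c t) \<le> (\<bar>M\<bar> / sqrt (2 * pi))\<^sup>2"
            by (simp add: power_divide field_simps)
          moreover have "(\<Sum>k\<in>F. W k powr \<gamma> * (norm (c t k))\<^sup>2) \<le> sobolev_sum \<gamma> (c t)"
            by (rule finite_sum_le_infsum[OF ws[OF tT] F]) auto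
          ultimately show "(\<Sum>k\<in>F. W k powr \<gamma> * (norm (c t k))\<^sup>2) \<le> (\<bar>M\<bar> / sqrt (2 * pi))\<^sup>2" by linarith
        qed
      qed
    qed
  qed
  define R where "R = sqrt (W_sum \<gamma>) * (\<bar>M\<bar> / sqrt (2 * pi))"
  have R: "l1_norm (c t) \<le> R" if t: "t \<in> {0..T}" for t
  proof -
    have "l1_norm (c t) \<le> sqrt (W_sum \<gamma>) * sqrt (sobolev_sum \<gamma> (c t))"
      by (rule weighted_l1_bound(2)[OF \<gamma>(1) _ ws[OF t]]) simp
    also have "sqrt (sobolev_sum \<gamma> (c t)) \<le> \<bar>M\<bar> / sqrt (2 * pi)"
      by (rule real_le_lsqrt) (use wb[OF t] in simp_all)
    finally show ?thesis unfolding R_def by (auto simp: mult_left_mono infsum_nonneg)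
  qed
  define G where "G = (\<lambda>s. cubic (\<lambda>_. 1) (c s))"
  have lG: "l1 (G s)" if "s \<in> {0..T}" for s
    unfolding G_def by (rule l1_cubic(1)[OF lc[OF that], of _ 1]) simp
  have Glim: "((\<lambda>s. \<Sum>\<^sub>\<infinity>k. norm (G s k - G r k)) \<longlongrightarrow> 0) (at r within {0..T})" if "r \<in> {0..T}" for r
    unfolding G_def by (rule fourier_modes_cubic_continuous[OF lc R cc[OF that] that])
  have "c t k = disp t k * c 0 k - \<i> * integral {0..t} (\<lambda>s. disp (t - s) k * G s k)" if t: "t \<in> {0..T}" for t k
  proof -
    have sub: "s \<in> {0..T}" if "s \<in> {0..t}" for s using that t by auto
    let ?D = "\<lambda>x. integral {0..t} (\<lambda>s. FS (\<lambda>k. disp (t - s) k * G s k) x)"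
    have D: "continuous_on UNIV ?D" "fourier_coeff ?D k = integral {0..t} (\<lambda>s. disp (t - s) k * G s k)"
    proof -
      have t0: "0 \<le> t" using t by simp
      have lim: "((\<lambda>s. \<Sum>\<^sub>\<infinity>k. norm (G s k - G r k)) \<longlongrightarrow> 0) (at r within {0..t})" if "r \<in> {0..t}" for r
        by (rule tendsto_within_Icc_mono[OF Glim[OF sub[OF that]]]) (use t in simp)
      show "continuous_on UNIV ?D" "fourier_coeff ?D k = integral {0..t} (\<lambda>s. disp (t - s) k * G s k)"
        using fourier_coeff_duhamel[of t G, OF t0 lG[OF sub] lim] by simp_all
    qed
    let ?f = "FS (\<lambda>k. disp t k * c 0 k)"
    have lf: "l1 (\<lambda>k. disp t k * c 0 k)" using lc[of 0] T by (simp add: norm_mult)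
    have "c t k = fourier_coeff (\<lambda>x. ?f x - ?D x * \<i>) k"
      unfolding c_def
    proof (rule fourier_coeff_cong_AE[OF bu[OF t]])
      show "(\<lambda>x. FS (\<lambda>k. disp t k * fourier_coeff (u 0) k) x - ?D x * \<i>) \<in> borel_measurable borel"
        using continuous_on_FS[OF lf] D(1)
        by (intro borel_measurable_continuous_onI continuous_intros) (simp_all add: c_def)
      show "AE x in lborel. x \<in> {0..2*pi} \<longrightarrow> u t x = FS (\<lambda>k. disp t k * fourier_coeff (u 0) k) x - ?D x * \<i>"
        using duh[OF t]
      proof eventually_elim
        case (elim x)
        have "integral {0..t} (\<lambda>s. schroedinger_group (t - s) (\<lambda>y. of_real ((cmod (u s y))\<^sup>2) * u s y) x) = ?D x"
        proof (rule integral_cong)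
          fix s assume "s \<in> {0..t}"
          then show "schroedinger_group (t - s) (\<lambda>y. of_real ((cmod (u s y))\<^sup>2) * u s y) x = FS (\<lambda>k. disp (t - s) k * G s k) x"
            unfolding schroedinger_group_FS G_def c_def
            by (simp add: fourier_coeff_cubic[OF u[OF sub] \<gamma>(1)] del: of_real_power)
        qed
        with elim show ?case by (simp add: schroedinger_group_FS c0 mult.commute)
      qed
    qed
    also have "\<dots> = fourier_coeff ?f k - fourier_coeff ?D k * \<i>"
      using LINT_continuous(2)[OF continuous_on_FS[OF lf]] LINT_continuous(2)[OF continuous_on_subset[OF D(1)]]
      by (subst fourier_coeff_diff) (auto simp: fourier_coeff_mult_right intro!: set_integrable_mult_left)
    finally show ?thesis by (simp only: D(2) fourier_coeff_FS[OF lf]) (simp add: mult.commute)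
  qed
  then have dh: "c t k = disp t k * c 0 k - \<i> * integral {0..t} (\<lambda>s. disp (t - s) k * cubic (\<lambda>_. 1) (c s) k)"
    if "t \<in> {0..T}" for t k
    using that unfolding G_def by blast
  have "nls_modes \<gamma> T (\<bar>M\<bar> / sqrt (2 * pi)) c"
    by (rule nls_modes.intro[OF \<gamma> T _ ws wb cc dh]) simp
  then show "nls_modes \<gamma> T (\<bar>M\<bar> / sqrt (2 * pi)) (\<lambda>t. fourier_coeff (u t))"
    by (simp only: c_def)
qed

section \<open>The numerical flow in Fourier modes\<close>

definition disp_modes :: "real \<Rightarrow> (int \<Rightarrow> complex) \<Rightarrow> int \<Rightarrow> complex" where
  "disp_modes t a k = disp t k * a k"

definition dx_symbol :: "int \<Rightarrow> complex" where
  "dx_symbol k = (if k = 0 then 0 else inverse (\<i> * of_int k))"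

definition dx_modes :: "(int \<Rightarrow> complex) \<Rightarrow> int \<Rightarrow> complex" where
  "dx_modes a k = dx_symbol k * a k"

definition band_cut :: "nat \<Rightarrow> (int \<Rightarrow> complex) \<Rightarrow> int \<Rightarrow> complex" where
  "band_cut N a k = (if \<bar>k\<bar> \<le> int N then a k else 0)"

definition conj_refl :: "(int \<Rightarrow> complex) \<Rightarrow> int \<Rightarrow> complex" where
  "conj_refl a k = cnj (a (- k))"

text \<open>Encodes a constant function, such as the zero modes in the scheme, as a sequence of
  coefficients.\<close>

definition at_zero :: "complex \<Rightarrow> int \<Rightarrow> complex" where
  "at_zero a k = (if k = 0 then a else 0)"

lemma l1_bounded_mult:
  fixes a :: "int \<Rightarrow> complex"
  assumes "l1 a" "\<And>k. norm (d k) \<le> norm (a k)"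
  shows "l1 (d :: int \<Rightarrow> complex)"
  by (rule Infinite_Sum.abs_summable_on_comparison_test'[OF assms])

lemma norm_dx_symbol_le: "norm (dx_symbol k) \<le> 1"
proof (cases "k = 0")
  case False
  then have "norm (complex_of_int k) \<ge> 1" by (simp add: norm_of_int)
  then show ?thesis using False by (simp add: dx_symbol_def norm_divide norm_mult field_simps)
qed (simp add: dx_symbol_def)

lemma l1_disp_modes [simp]: "l1 a \<Longrightarrow> l1 (disp_modes t a)"
  by (simp add: disp_modes_def norm_mult)

lemma l1_dx_modes [simp]: "l1 a \<Longrightarrow> l1 (dx_modes a)"
  by (erule l1_bounded_mult) (simp add: dx_modes_def norm_mult mult_left_le_one_le norm_dx_symbol_le)

lemma l1_cut [simp]: "l1 (band_cut N a)"
proof -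
  have "(\<lambda>k. norm (band_cut N a k)) summable_on UNIV \<longleftrightarrow> (\<lambda>k. norm (band_cut N a k)) summable_on {- int N..int N}"
    by (rule summable_on_cong_neutral) (auto simp: band_cut_def)
  then show ?thesis by simp
qed

lemma l1_band_limited:
  assumes "\<And>k. \<bar>k\<bar> > int N \<Longrightarrow> w k = 0"
  shows "l1 (w :: int \<Rightarrow> complex)"
proof -
  have "w = band_cut N w" using assms by (auto simp: band_cut_def not_le)
  then show ?thesis by (metis l1_cut)
qed

lemma l1_conj_refl [simp]: "l1 a \<Longrightarrow> l1 (conj_refl a)"
  using abs_summable_reflect[of a] by (simp add: conj_refl_def)

lemma l1_at_zero [simp]: "l1 (at_zero a)"
proof -
  have "(\<lambda>k. norm (at_zero a k)) summable_on UNIV \<longleftrightarrow> (\<lambda>k. norm (at_zero a k)) summable_on {0}"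
    by (rule summable_on_cong_neutral) (auto simp: at_zero_def)
  then show ?thesis by simp
qed

lemma fourier_mult_FS: "l1 a \<Longrightarrow> fourier_mult \<mu> (FS a) = FS (\<lambda>k. \<mu> k * a k)"
  by (simp add: fourier_mult_def FS_def wave_def fourier_coeff_FS fun_eq_iff flip: FS_def wave_def)

lemma operators_FS:
  assumes "l1 a"
  shows "schroedinger_group t (FS a) = FS (disp_modes t a)" "dx_inv (FS a) = FS (dx_modes a)"
    "low_pass N (FS a) = FS (band_cut N a)" "zero_mode (FS a) = a 0" "cnj (FS a x) = FS (conj_refl a) x"
proof -
  show "schroedinger_group t (FS a) = FS (disp_modes t a)"
    by (simp add: schroedinger_group_FS fourier_coeff_FS[OF assms] disp_modes_def[abs_def])
  have "(\<lambda>k. (if k = 0 then 0 else inverse (\<i> * of_int k)) * a k) = dx_modes a"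
    by (auto simp: dx_modes_def dx_symbol_def)
  then show "dx_inv (FS a) = FS (dx_modes a)"
    by (simp only: dx_inv_def fourier_mult_FS[OF assms])
  have "(\<lambda>k. (if \<bar>k\<bar> \<le> int N then 1 else 0) * a k) = band_cut N a"
    by (auto simp: band_cut_def)
  then show "low_pass N (FS a) = FS (band_cut N a)"
    by (simp only: low_pass_def fourier_mult_FS[OF assms])
  show "zero_mode (FS a) = a 0" by (simp add: zero_mode_def fourier_coeff_FS[OF assms])
  show "cnj (FS a x) = FS (conj_refl a) x" by (simp add: cnj_FS conj_refl_def[abs_def])
qed

lemma FS_at_zero: "FS (at_zero a) x = a"
proof -
  have "FS (at_zero a) x = (\<Sum>\<^sub>\<infinity>k\<in>{0}. at_zero a k * wave k x)"
    unfolding FS_def by (rule infsum_cong_neutral) (auto simp: at_zero_def)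
  then show ?thesis by (simp add: at_zero_def)
qed

lemma FS_square: "l1 a \<Longrightarrow> (FS a x)\<^sup>2 = FS (conv a a) x"
  by (simp add: power2_eq_square FS_conv)

lemma FS_lincomb:
  assumes "l1 a" "l1 b"
  shows "FS a x + s * FS b x = FS (\<lambda>k. a k + s * b k) x" "l1 (\<lambda>k. a k + s * b k)"
proof -
  have sb: "l1 (\<lambda>k. s * b k)" using assms(2) by (simp add: norm_mult summable_on_cmult_right)
  have "s * FS b x = FS (\<lambda>k. s * b k) x" using FS_mult_l[of b x s] by (simp add: mult.commute)
  then show "FS a x + s * FS b x = FS (\<lambda>k. a k + s * b k) x" using FS_add[OF assms(1) sb] by simp
  show "l1 (\<lambda>k. a k + s * b k)"
    by (rule summable_on_comparison_test[OF summable_on_add[OF assms(1) sb]]) (auto simp: norm_triangle_ineq)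
qed

text \<open>The integral of exp (2 \<i> s n) over \<open>0 \<le> s \<le> \<tau>\<close>. The
  quotient is what \<open>dx_inv\<close> and the group produce; the resonant value \<tau> at
  \<open>n = 0\<close> has to come from the zero-mode terms of the scheme.\<close>

definition phase_int :: "real \<Rightarrow> int \<Rightarrow> complex" where
  "phase_int \<tau> n = (if n = 0 then of_real \<tau> else (exp (2 * \<i> * of_real \<tau> * of_int n) - 1) / (2 * \<i> * of_int n))"

definition flow_kernel :: "real \<Rightarrow> int \<times> int \<times> int \<Rightarrow> complex" where
  "flow_kernel \<tau> = (\<lambda>(i,j,l). phase_int \<tau> ((i + j + l) * i) + phase_int \<tau> (j * l) - of_real \<tau>)"

text \<open>The condition on \<open>j + l\<close> stems from the inner projection, which acts on the
  square before it is multiplied by the conjugate; those on the single entries stem from the band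
  limit of the numerical solution.\<close>

definition band_triples :: "nat \<Rightarrow> int \<Rightarrow> (int \<times> int \<times> int) set" where
  "band_triples N k = {(i,j,l). i + j + l = k \<and> \<bar>i\<bar> \<le> int N \<and> \<bar>j\<bar> \<le> int N \<and> \<bar>l\<bar> \<le> int N \<and> \<bar>j + l\<bar> \<le> int N}"

definition flow_modes :: "real \<Rightarrow> nat \<Rightarrow> (int \<Rightarrow> complex) \<Rightarrow> int \<Rightarrow> complex" where
  "flow_modes \<tau> N w = band_cut N (\<lambda>k. disp \<tau> k * (w k - \<i> * (\<Sum>q\<in>band_triples N k. flow_kernel \<tau> q * cubic_term w q)))"

lemma finite_band_triples [simp]: "finite (band_triples N k)"
  by (rule finite_subset[of _ "{- int N..int N} \<times> {- int N..int N} \<times> {- int N..int N}"])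
    (auto simp: band_triples_def)

lemma disp_at_0 [simp]: "disp t 0 = 1"
  by (simp add: disp_def)

lemma disp_product: "disp s i * disp t j = exp (- \<i> * (of_real s * (of_int i)\<^sup>2 + of_real t * (of_int j)\<^sup>2))"
  by (simp add: disp_def algebra_simps flip: exp_add)

text \<open>Since i^2 - (k - i)^2 = 2 k i - k^2, the group factors produce exp (2 \<i> \<tau> k i),
  and the two symbols of \<open>dx_inv\<close> produce -1 / (k i). For \<open>k = 0\<close> or
  \<open>i = 0\<close> the symbols vanish and the terms with \<tau> supply the resonant value; the
  second of them excludes \<open>k = 0\<close>, so that \<open>k = i = 0\<close> is not counted
  twice.\<close>

lemma first_phase_identity:
  "1/2 * (dx_symbol k * dx_symbol i * (disp (- \<tau>) i * disp \<tau> (k - i))) - 1/2 * (disp \<tau> k * dx_symbol k * dx_symbol i)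
    - (if k = 0 then \<i> * \<tau> else 0) - (if i = 0 \<and> k \<noteq> 0 then \<i> * \<tau> * disp \<tau> k else 0)
   = - \<i> * disp \<tau> k * phase_int \<tau> (k * i)"
proof (cases "k = 0 \<or> i = 0")
  case True
  then show ?thesis by (auto simp: dx_symbol_def phase_int_def disp_def)
next
  case False
  have e: "disp (- \<tau>) i * disp \<tau> (k - i) = disp \<tau> k * exp (2 * \<i> * of_real \<tau> * of_int (k * i))"
    unfolding disp_product unfolding disp_def
    by (simp add: power2_eq_square algebra_simps flip: exp_add)
  show ?thesis using False unfolding e
    by (simp add: dx_symbol_def phase_int_def field_simps)
qed

text \<open>Here (j + l)^2 - j^2 - l^2 = 2 j l. The resonant set is \<open>j = 0\<close> or
  \<open>l = 0\<close>, counted by inclusion and exclusion: this is the origin of the factor 2 in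
  the scheme and of its last term, with the squared zero mode.\<close>

lemma second_phase_identity:
  "1/2 * (disp \<tau> k * (disp (- \<tau>) (j + l) * (disp \<tau> j * dx_symbol j * (disp \<tau> l * dx_symbol l)))) - 1/2 * (disp \<tau> k * (dx_symbol j * dx_symbol l))
    - \<i> * \<tau> * disp \<tau> k * ((if j = 0 then 1 else 0) + (if l = 0 then 1 else 0) - (if j = 0 \<and> l = 0 then 1 else 0))
   = - \<i> * disp \<tau> k * phase_int \<tau> (j * l)"
proof (cases "j = 0 \<or> l = 0")
  case True
  then show ?thesis by (auto simp: dx_symbol_def phase_int_def)
next
  case False
  have "disp (- \<tau>) (j + l) * (disp \<tau> j * dx_symbol j * (disp \<tau> l * dx_symbol l)) =
      (disp (- \<tau>) (j + l) * disp \<tau> j) * disp \<tau> l * (dx_symbol j * dx_symbol l)" by (simp add: mult_ac)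
  also have "(disp (- \<tau>) (j + l) * disp \<tau> j) * disp \<tau> l = exp (2 * \<i> * of_real \<tau> * of_int (j * l))"
    unfolding disp_product unfolding disp_def
    by (simp add: power2_eq_square algebra_simps flip: exp_add)
  finally have e: "disp (- \<tau>) (j + l) * (disp \<tau> j * dx_symbol j * (disp \<tau> l * dx_symbol l)) =
    exp (2 * \<i> * of_real \<tau> * of_int (j * l)) * (dx_symbol j * dx_symbol l)" .
  show ?thesis using False unfolding e
    by (simp add: dx_symbol_def phase_int_def field_simps)
qed

lemma conv_band:
  assumes "\<And>i. \<bar>i\<bar> > int N \<Longrightarrow> a i = 0"
  shows "conv a b k = (\<Sum>i\<in>{- int N..int N}. a i * b (k - i))"
proof -
  have "conv a b k = (\<Sum>\<^sub>\<infinity>i. a i * b (k - i))"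
    unfolding conv_def
    by (rule infsum_reindex_bij_witness[of _ "\<lambda>i. (i, k - i)" fst]) auto
  also have "\<dots> = (\<Sum>\<^sub>\<infinity>i\<in>{- int N..int N}. a i * b (k - i))"
    by (rule infsum_cong_neutral) (use assms in \<open>auto simp: not_le\<close>)
  finally show ?thesis by simp
qed

text \<open>Every cubic term of the scheme, read at the output frequency \<open>k\<close>, is a
  double sum over \<open>(i, j)\<close> of the same product \<open>A i j\<close>, the third
  frequency being \<open>k - i - j\<close>. The terms differ only in scalar coefficients, and their
  sum \<open>F i j\<close> is evaluated by the two phase identities.\<close>

lemma num_flow_FS:
  assumes w: "\<And>k. \<bar>k\<bar> > int N \<Longrightarrow> w k = 0"
  shows "num_flow \<tau> N (FS w) = FS (flow_modes \<tau> N w)"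
proof -
  have lw: "l1 w" by (rule l1_band_limited) (rule w, assumption)
  define b where "b = conj_refl w"
  define sq where "sq = band_cut N (conv w w)"
  define R where "R = (\<lambda>k. disp_modes \<tau> w k
    + 1/2 * dx_modes (band_cut N (conv (disp_modes (- \<tau>) (dx_modes b)) (disp_modes \<tau> sq))) k
    + (- 1/2) * disp_modes \<tau> (dx_modes (band_cut N (conv (dx_modes b) sq))) k
    + (- \<i> * \<tau> * conv b sq 0) * at_zero 1 k
    + (- \<i> * \<tau> * b 0) * disp_modes \<tau> sq k
    + (\<i> * \<tau> * b 0 * conv w w 0) * at_zero 1 k
    + 1/2 * disp_modes \<tau> (band_cut N (conv b (disp_modes (- \<tau>) (band_cut N (conv (disp_modes \<tau> (dx_modes w)) (disp_modes \<tau> (dx_modes w))))))) k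
    + (- 1/2) * disp_modes \<tau> (band_cut N (conv b (band_cut N (conv (dx_modes w) (dx_modes w))))) k
    + (\<i> * \<tau>) * disp_modes \<tau> (band_cut N (conv b sq)) k
    + (- 2 * \<i> * \<tau> * w 0) * disp_modes \<tau> (band_cut N (conv b (band_cut N w))) k
    + (\<i> * \<tau> * (w 0)\<^sup>2) * disp_modes \<tau> (band_cut N b) k)"
  have lb: "l1 b" unfolding b_def using lw by simp
  have ls: "l1 sq" unfolding sq_def by simp
  note ops = operators_FS FS_square FS_conv l1_conv lw lb ls
  have "num_flow \<tau> N (FS w) x = FS R x" for x
  proof -
    have "num_flow \<tau> N (FS w) x = FS (disp_modes \<tau> w) x
    + 1/2 * FS (dx_modes (band_cut N (conv (disp_modes (- \<tau>) (dx_modes b)) (disp_modes \<tau> sq)))) x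
    + (- 1/2) * FS (disp_modes \<tau> (dx_modes (band_cut N (conv (dx_modes b) sq)))) x
    + (- \<i> * \<tau> * conv b sq 0) * FS (at_zero 1) x
    + (- \<i> * \<tau> * b 0) * FS (disp_modes \<tau> sq) x
    + (\<i> * \<tau> * b 0 * conv w w 0) * FS (at_zero 1) x
    + 1/2 * FS (disp_modes \<tau> (band_cut N (conv b (disp_modes (- \<tau>) (band_cut N (conv (disp_modes \<tau> (dx_modes w)) (disp_modes \<tau> (dx_modes w)))))))) x
    + (- 1/2) * FS (disp_modes \<tau> (band_cut N (conv b (band_cut N (conv (dx_modes w) (dx_modes w)))))) x
    + (\<i> * \<tau>) * FS (disp_modes \<tau> (band_cut N (conv b sq))) x
    + (- 2 * \<i> * \<tau> * w 0) * FS (disp_modes \<tau> (band_cut N (conv b (band_cut N w)))) x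
    + (\<i> * \<tau> * (w 0)\<^sup>2) * FS (disp_modes \<tau> (band_cut N b)) x"
      unfolding num_flow_def Let_def
      by (simp add: ops FS_at_zero flip: b_def sq_def) (simp add: algebra_simps)
    also have "\<dots> = FS R x"
      unfolding R_def by (simp only: FS_lincomb l1_disp_modes l1_dx_modes l1_cut l1_at_zero l1_conv lw lb ls)
    finally show ?thesis .
  qed
  moreover have "R k = flow_modes \<tau> N w k" for k
  proof (cases "\<bar>k\<bar> \<le> int N")
    case False
    then have "k \<noteq> 0" by auto
    then show ?thesis using False w[of k]
      by (simp add: R_def flow_modes_def band_cut_def disp_modes_def dx_modes_def at_zero_def sq_def)
  next
    case k: True
    let ?B = "{- int N..int N}"
    define A where "A i j = (if \<bar>k - i\<bar> \<le> int N then b i * w j * w (k - i - j) else 0)" for i j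
    have bb: "b i = 0" if "\<bar>i\<bar> > int N" for i using w[of "- i"] that by (simp add: b_def conj_refl_def)
    \<comment> \<open>\<open>g\<close> acts on the conjugated factor, \<open>h\<close> on the
      intermediate frequency \<open>k - i\<close> after the inner projection, and \<open>p\<close>
      on both factors of the square. The convolutions in \<open>t2\<close>, \<open>t3\<close>,
      \<open>t4\<close>, \<open>t6\<close> and \<open>t7\<close> are instances.\<close>
    have cb: "conv (\<lambda>i. g i * b i) (\<lambda>m. h m * band_cut N (conv (\<lambda>j. p j * w j) (\<lambda>j. p j * w j)) m) k
        = (\<Sum>i\<in>?B. \<Sum>j\<in>?B. g i * h (k - i) * p j * p (k - i - j) * A i j)" for g h p
    proof -
      have "conv (\<lambda>j. p j * w j) (\<lambda>j. p j * w j) m = (\<Sum>j\<in>?B. (p j * w j) * (p (m - j) * w (m - j)))" for m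
        by (rule conv_band) (use w in auto)
      moreover have "conv (\<lambda>i. g i * b i) (\<lambda>m. h m * band_cut N (conv (\<lambda>j. p j * w j) (\<lambda>j. p j * w j)) m) k
        = (\<Sum>i\<in>?B. (g i * b i) * (h (k - i) * band_cut N (conv (\<lambda>j. p j * w j) (\<lambda>j. p j * w j)) (k - i)))"
        by (rule conv_band) (use bb in auto)
      ultimately show ?thesis
        by (auto simp: A_def band_cut_def sum_distrib_left mult_ac intro!: sum.cong)
    qed
    have t2: "conv (disp_modes (- \<tau>) (dx_modes b)) (disp_modes \<tau> sq) k = (\<Sum>i\<in>?B. \<Sum>j\<in>?B. disp (- \<tau>) i * dx_symbol i * disp \<tau> (k - i) * A i j)"
      using cb[of "\<lambda>i. disp (- \<tau>) i * dx_symbol i" "disp \<tau>" "\<lambda>_. 1"] by (simp add: disp_modes_def[abs_def] dx_modes_def[abs_def] sq_def mult.assoc)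
    have t3: "conv (dx_modes b) sq k = (\<Sum>i\<in>?B. \<Sum>j\<in>?B. dx_symbol i * A i j)"
      using cb[of dx_symbol "\<lambda>_. 1" "\<lambda>_. 1"] by (simp add: dx_modes_def[abs_def] sq_def)
    have t4: "conv b sq k = (\<Sum>i\<in>?B. \<Sum>j\<in>?B. A i j)"
      using cb[of "\<lambda>_. 1" "\<lambda>_. 1" "\<lambda>_. 1"] by (simp add: sq_def)
    have t6: "conv b (disp_modes (- \<tau>) (band_cut N (conv (disp_modes \<tau> (dx_modes w)) (disp_modes \<tau> (dx_modes w))))) k =
        (\<Sum>i\<in>?B. \<Sum>j\<in>?B. disp (- \<tau>) (k - i) * (disp \<tau> j * dx_symbol j) * (disp \<tau> (k - i - j) * dx_symbol (k - i - j)) * A i j)"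
      using cb[of "\<lambda>_. 1" "disp (- \<tau>)" "\<lambda>j. disp \<tau> j * dx_symbol j"] by (simp add: disp_modes_def[abs_def] dx_modes_def[abs_def] mult.assoc)
    have t7: "conv b (band_cut N (conv (dx_modes w) (dx_modes w))) k = (\<Sum>i\<in>?B. \<Sum>j\<in>?B. dx_symbol j * dx_symbol (k - i - j) * A i j)"
      using cb[of "\<lambda>_. 1" "\<lambda>_. 1" dx_symbol] by (simp add: dx_modes_def[abs_def])
    have t5: "b 0 * sq k = (\<Sum>i\<in>?B. \<Sum>j\<in>?B. (if i = 0 then 1 else 0) * A i j)"
    proof -
      have "conv w w k = (\<Sum>j\<in>?B. w j * w (k - j))" by (rule conv_band) (rule w)
      then have "b 0 * sq k = (\<Sum>j\<in>?B. A 0 j)"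
        using k by (simp add: sq_def band_cut_def A_def sum_distrib_left mult_ac)
      also have "\<dots> = (\<Sum>i\<in>?B. if i = 0 then (\<Sum>j\<in>?B. A i j) else 0)"
        by (simp add: sum.delta)
      also have "\<dots> = (\<Sum>i\<in>?B. \<Sum>j\<in>?B. (if i = 0 then 1 else 0) * A i j)"
        by (rule sum.cong) auto
      finally show ?thesis .
    qed
    have bw: "conv b (band_cut N w) k = (\<Sum>i\<in>?B. b i * band_cut N w (k - i))"
      by (rule conv_band) (rule bb)
    \<comment> \<open>The factor 2 in front of this term of the scheme is split: here the vanishing
      frequency is \<open>j\<close>, in \<open>t9'\<close> the same quantity is written with
      vanishing frequency \<open>k - i - j\<close>.\<close>
    have t9: "conv b (band_cut N w) k * w 0 = (\<Sum>i\<in>?B. \<Sum>j\<in>?B. (if j = 0 then 1 else 0) * A i j)"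
    proof -
      have "(\<Sum>j\<in>?B. (if j = 0 then 1 else 0) * A i j) = b i * band_cut N w (k - i) * w 0" for i
      proof -
        have "(\<Sum>j\<in>?B. (if j = 0 then 1 else 0) * A i j) = (\<Sum>j\<in>?B. if j = 0 then A i j else 0)"
          by (rule sum.cong) auto
        then show ?thesis by (simp add: A_def band_cut_def)
      qed
      then show ?thesis unfolding bw by (simp add: sum_distrib_right)
    qed
    have t9': "conv b (band_cut N w) k * w 0 = (\<Sum>i\<in>?B. \<Sum>j\<in>?B. (if k - i - j = 0 then 1 else 0) * A i j)"
    proof -
      have "(\<Sum>j\<in>?B. (if k - i - j = 0 then 1 else 0) * A i j) = b i * band_cut N w (k - i) * w 0" for i
      proof -
        have "(\<Sum>j\<in>?B. (if k - i - j = 0 then 1 else 0) * A i j) = (\<Sum>j\<in>?B. if j = k - i then A i j else 0)"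
          by (rule sum.cong) auto
        then show ?thesis by (auto simp: A_def band_cut_def)
      qed
      then show ?thesis unfolding bw by (simp add: sum_distrib_right)
    qed
    have t10: "b k * (w 0)\<^sup>2 = (\<Sum>i\<in>?B. \<Sum>j\<in>?B. (if j = 0 \<and> k - i - j = 0 then 1 else 0) * A i j)"
    proof -
      have "(\<Sum>j\<in>?B. (if j = 0 \<and> k - i - j = 0 then 1 else 0) * A i j) = (if i = k then b k * (w 0)\<^sup>2 else 0)" for i
      proof -
        have "(\<Sum>j\<in>?B. (if j = 0 \<and> k - i - j = 0 then 1 else 0) * A i j) = (\<Sum>j\<in>?B. if j = 0 then (if i = k then A k 0 else 0) else 0)"
          by (rule sum.cong) auto
        then show ?thesis by (simp add: A_def power2_eq_square mult.assoc)
      qed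
      then show ?thesis using k by (auto simp: abs_le_iff)
    qed
    \<comment> \<open>Grouped as the left-hand sides of \<open>first_phase_identity\<close> and
      \<open>second_phase_identity\<close>. The last summand belongs to the -1 in the numerical
      phase factor.\<close>
    define F where "F i j =
        (1/2 * (dx_symbol k * dx_symbol i * (disp (- \<tau>) i * disp \<tau> (k - i))) - 1/2 * (disp \<tau> k * dx_symbol k * dx_symbol i)
          - (if k = 0 then \<i> * \<tau> else 0) - (if i = 0 \<and> k \<noteq> 0 then \<i> * \<tau> * disp \<tau> k else 0))
        + (1/2 * (disp \<tau> k * (disp (- \<tau>) (k - i) * (disp \<tau> j * dx_symbol j * (disp \<tau> (k - i - j) * dx_symbol (k - i - j)))))
          - 1/2 * (disp \<tau> k * (dx_symbol j * dx_symbol (k - i - j)))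
          - \<i> * \<tau> * disp \<tau> k * ((if j = 0 then 1 else 0) + (if k - i - j = 0 then 1 else 0) - (if j = 0 \<and> k - i - j = 0 then 1 else 0)))
        + \<i> * \<tau> * disp \<tau> k" for i j
    have R: "R k = disp \<tau> k * w k + (\<Sum>i\<in>?B. \<Sum>j\<in>?B. F i j * A i j)" (is "_ = _ + ?S")
    proof -
      have "?S = 1/2 * dx_symbol k * (\<Sum>i\<in>?B. \<Sum>j\<in>?B. disp (- \<tau>) i * dx_symbol i * disp \<tau> (k - i) * A i j)
        - 1/2 * disp \<tau> k * dx_symbol k * (\<Sum>i\<in>?B. \<Sum>j\<in>?B. dx_symbol i * A i j)
        - (if k = 0 then \<i> * \<tau> else 0) * (\<Sum>i\<in>?B. \<Sum>j\<in>?B. A i j)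
        - (if k \<noteq> 0 then \<i> * \<tau> * disp \<tau> k else 0) * (\<Sum>i\<in>?B. \<Sum>j\<in>?B. (if i = 0 then 1 else 0) * A i j)
        + 1/2 * disp \<tau> k * (\<Sum>i\<in>?B. \<Sum>j\<in>?B. disp (- \<tau>) (k - i) * (disp \<tau> j * dx_symbol j) * (disp \<tau> (k - i - j) * dx_symbol (k - i - j)) * A i j)
        - 1/2 * disp \<tau> k * (\<Sum>i\<in>?B. \<Sum>j\<in>?B. dx_symbol j * dx_symbol (k - i - j) * A i j)
        - \<i> * \<tau> * disp \<tau> k * (\<Sum>i\<in>?B. \<Sum>j\<in>?B. (if j = 0 then 1 else 0) * A i j)
        - \<i> * \<tau> * disp \<tau> k * (\<Sum>i\<in>?B. \<Sum>j\<in>?B. (if k - i - j = 0 then 1 else 0) * A i j)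
        + \<i> * \<tau> * disp \<tau> k * (\<Sum>i\<in>?B. \<Sum>j\<in>?B. (if j = 0 \<and> k - i - j = 0 then 1 else 0) * A i j)
        + \<i> * \<tau> * disp \<tau> k * (\<Sum>i\<in>?B. \<Sum>j\<in>?B. A i j)"
        unfolding sum_distrib_left sum.distrib[symmetric] sum_subtractf[symmetric] F_def
        by (intro sum.cong refl, cases "k = 0"; simp add: algebra_simps)
      also have "\<dots> = R k - disp \<tau> k * w k"
        unfolding t2[symmetric] t3[symmetric] t4[symmetric] t5[symmetric] t6[symmetric] t7[symmetric]
          t9[symmetric] t9'[symmetric] t10[symmetric]
        using k by (cases "k = 0") (simp_all add: R_def disp_modes_def dx_modes_def band_cut_def at_zero_def sq_def dx_symbol_def power2_eq_square algebra_simps)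
      finally show ?thesis by simp
    qed
    have c: "F i j = - \<i> * disp \<tau> k * flow_kernel \<tau> (i, j, k - i - j)" for i j
      using first_phase_identity[of k i \<tau>] second_phase_identity[of \<tau> k j "k - i - j"]
      by (simp add: F_def flow_kernel_def distrib_left right_diff_distrib)
    \<comment> \<open>Pairs for which \<open>k - i = j + l\<close> or the third frequency leaves the
      band contribute zero, by the truncation in \<open>A\<close> or by the band limit of
      \<open>w\<close>.\<close>
    have "(\<Sum>q\<in>band_triples N k. flow_kernel \<tau> q * cubic_term w q) = (\<Sum>(i,j)\<in>?B \<times> ?B. flow_kernel \<tau> (i, j, k - i - j) * A i j)"
      by (rule sum.reindex_bij_witness_not_neutral[of "{}" "{p \<in> ?B \<times> ?B. case p of (i,j) \<Rightarrow> \<not> (\<bar>k - i\<bar> \<le> int N \<and> \<bar>k - i - j\<bar> \<le> int N)}"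
            _ "\<lambda>(i,j). (i, j, k - i - j)" "\<lambda>(i,j,l). (i,j)"])
        (auto simp: band_triples_def A_def cubic_term_def b_def conj_refl_def w not_le)
    then have S: "- \<i> * disp \<tau> k * (\<Sum>q\<in>band_triples N k. flow_kernel \<tau> q * cubic_term w q) =
      (\<Sum>i\<in>?B. \<Sum>j\<in>?B. - \<i> * disp \<tau> k * flow_kernel \<tau> (i, j, k - i - j) * A i j)"
      by (simp add: sum.cartesian_product sum_distrib_left case_prod_unfold mult_ac sum_negf)
    have "R k = disp \<tau> k * w k + - \<i> * disp \<tau> k * (\<Sum>q\<in>band_triples N k. flow_kernel \<tau> q * cubic_term w q)"
      unfolding R c S ..
    then show ?thesis
      using k by (simp add: flow_modes_def band_cut_def algebra_simps)
  qed
  ultimately show ?thesis by (metis ext)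
qed

section \<open>Local error\<close>

lemma sum_norm_integral_le:
  fixes f :: "'k \<Rightarrow> real \<Rightarrow> complex"
  assumes K: "finite K" and \<tau>: "\<tau> \<ge> 0" and c: "\<And>k. k \<in> K \<Longrightarrow> continuous_on {0..\<tau>} (f k)"
    and B: "\<And>s. s \<in> {0..\<tau>} \<Longrightarrow> (\<Sum>k\<in>K. norm (f k s)) \<le> B"
  shows "(\<Sum>k\<in>K. norm (integral {0..\<tau>} (f k))) \<le> \<tau> * B"
proof -
  have "(\<Sum>k\<in>K. norm (integral {0..\<tau>} (f k))) \<le> (\<Sum>k\<in>K. integral {0..\<tau>} (\<lambda>s. norm (f k s)))"
    by (intro sum_mono integral_norm_bound_integral integrable_continuous_interval continuous_intros c) auto
  also have "\<dots> = integral {0..\<tau>} (\<lambda>s. \<Sum>k\<in>K. norm (f k s))"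
    by (intro integral_sum[symmetric] K integrable_continuous_interval continuous_intros c) auto
  also have "\<dots> \<le> integral {0..\<tau>} (\<lambda>s. B)"
    by (intro integral_le integrable_continuous_interval continuous_intros c B) auto
  finally show ?thesis using \<tau> by simp
qed

text \<open>
  Minkowski's inequality, by testing with the conjugate of the integral.
\<close>

lemma L2_set_norm_integral_le:
  fixes f :: "'k \<Rightarrow> real \<Rightarrow> complex"
  assumes K: "finite K" and \<tau>: "\<tau> \<ge> 0" and c: "\<And>k. k \<in> K \<Longrightarrow> continuous_on {0..\<tau>} (f k)"
    and B: "\<And>s. s \<in> {0..\<tau>} \<Longrightarrow> L2_set (\<lambda>k. norm (f k s)) K \<le> B"
  shows "L2_set (\<lambda>k. norm (integral {0..\<tau>} (f k))) K \<le> \<tau> * B"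
proof -
  define v where "v k = integral {0..\<tau>} (f k)" for k
  define L where "L = L2_set (\<lambda>k. norm (v k)) K"
  have L0: "L \<ge> 0" by (simp add: L_def)
  have fi: "f k integrable_on {0..\<tau>}" if "k \<in> K" for k
    by (rule integrable_continuous_interval[OF c[OF that]])
  have "of_real (L\<^sup>2) = (\<Sum>k\<in>K. complex_of_real ((norm (v k))\<^sup>2))"
    by (simp add: L_def L2_set_def sum_nonneg real_sqrt_pow2)
  also have "\<dots> = (\<Sum>k\<in>K. integral {0..\<tau>} (\<lambda>s. f k s * cnj (v k)))"
  proof (rule sum.cong[OF refl])
    fix k assume "k \<in> K"
    show "complex_of_real ((norm (v k))\<^sup>2) = integral {0..\<tau>} (\<lambda>s. f k s * cnj (v k))"
      unfolding complex_norm_square by (simp add: v_def)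
  qed
  also have "\<dots> = integral {0..\<tau>} (\<lambda>s. \<Sum>k\<in>K. f k s * cnj (v k))"
    by (intro integral_sum[symmetric] K integrable_continuous_interval continuous_intros c) auto
  finally have "L\<^sup>2 = norm (integral {0..\<tau>} (\<lambda>s. \<Sum>k\<in>K. f k s * cnj (v k)))"
    by (metis norm_of_real abs_of_nonneg zero_le_power2)
  also have "\<dots> \<le> integral {0..\<tau>} (\<lambda>s. L * B)"
  proof (rule integral_norm_bound_integral)
    show "(\<lambda>s. \<Sum>k\<in>K. f k s * cnj (v k)) integrable_on {0..\<tau>}"
      by (intro integrable_continuous_interval continuous_intros c) auto
    fix s assume s: "s \<in> {0..\<tau>}"
    have "norm (\<Sum>k\<in>K. f k s * cnj (v k)) \<le> (\<Sum>k\<in>K. \<bar>norm (f k s)\<bar> * \<bar>norm (v k)\<bar>)"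
      by (rule sum_norm_le) (simp add: norm_mult)
    also have "\<dots> \<le> L2_set (\<lambda>k. norm (f k s)) K * L" unfolding L_def by (rule L2_set_mult_ineq)
    also have "\<dots> \<le> B * L" by (rule mult_right_mono[OF B[OF s] L0])
    finally show "norm (\<Sum>k\<in>K. f k s * cnj (v k)) \<le> L * B" by (simp add: mult.commute)
  qed (intro integrable_continuous_interval continuous_intros)
  finally have "L * L \<le> L * (\<tau> * B)" using \<tau> by (simp add: power2_eq_square mult_ac)
  moreover have "\<tau> * B \<ge> 0"
    using \<tau> order_trans[OF L2_set_nonneg B[of 0]] by simp
  ultimately have "L \<le> \<tau> * B" using L0 by (cases "L = 0") auto
  then show ?thesis by (simp add: L_def v_def)
qed

section \<open>Exact and numerical phase factors\<close>

definition phase :: "real \<Rightarrow> int \<times> int \<times> int \<Rightarrow> complex" where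
  "phase s = (\<lambda>(i,j,l). cis (2 * s * (of_int ((i + j + l) * i) + of_int (j * l))))"

definition in_band :: "nat \<Rightarrow> int \<times> int \<times> int \<Rightarrow> bool" where
  "in_band N = (\<lambda>(i,j,l). \<bar>i\<bar> \<le> int N \<and> \<bar>j\<bar> \<le> int N \<and> \<bar>l\<bar> \<le> int N \<and> \<bar>j + l\<bar> \<le> int N)"

text \<open>The integrand whose time integral over one step is \<open>flow_kernel\<close>, extended
  by zero to the triples that the truncations discard. The output frequency is cut separately, by
  \<open>band_cut\<close>.\<close>

definition band_kernel :: "nat \<Rightarrow> real \<Rightarrow> int \<times> int \<times> int \<Rightarrow> complex" where
  "band_kernel N s q = (if in_band N q then (case q of (i,j,l) \<Rightarrow>
      cis (2 * s * of_int ((i + j + l) * i)) + cis (2 * s * of_int (j * l)) - 1) else 0)"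

lemma norm_phase [simp]: "norm (phase s q) = 1"
  by (simp add: phase_def split: prod.split)

lemma norm_band_kernel: "norm (band_kernel N s q) \<le> 3"
proof (cases q)
  case (fields i j l)
  have "norm (cis x + cis y - 1) \<le> 3" for x y
    using norm_triangle_ineq4[of "cis x + cis y" 1] norm_triangle_ineq[of "cis x" "cis y"] by simp
  then show ?thesis by (simp add: band_kernel_def fields)
qed

lemma cubic_band_kernel: "cubic (band_kernel N s) f k = (\<Sum>q\<in>band_triples N k. band_kernel N s q * cubic_term f q)"
proof -
  have "cubic (band_kernel N s) f k = (\<Sum>\<^sub>\<infinity>q\<in>band_triples N k. band_kernel N s q * cubic_term f q)"
    unfolding cubic_def
    by (rule infsum_cong_neutral) (auto simp: triples_def band_triples_def band_kernel_def in_band_def)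
  then show ?thesis by simp
qed

text \<open>All indices in \<open>band_triples\<close> lie in the band, which is symmetric. Exact
  modes may therefore be truncated before they are compared with the numerical ones.\<close>

lemma cubic_band_cut: "cubic (band_kernel N s) (band_cut N f) = cubic (band_kernel N s) f"
proof
  fix k show "cubic (band_kernel N s) (band_cut N f) k = cubic (band_kernel N s) f k"
    unfolding cubic_band_kernel by (rule sum.cong) (auto simp: band_triples_def cubic_term_def band_cut_def)
qed

lemma integral_cis: "integral {0..\<tau>} (\<lambda>s. cis (2 * s * of_int n)) = phase_int \<tau> n" if "\<tau> \<ge> 0"
proof (cases "n = 0")
  case True
  then show ?thesis using that by (simp add: phase_int_def scaleR_conv_of_real)
next
  case False
  let ?F = "\<lambda>s::real. exp (2 * \<i> * of_real s * of_int n) / (2 * \<i> * of_int n)"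
  have "((\<lambda>s. cis (2 * s * of_int n)) has_integral (?F \<tau> - ?F 0)) {0..\<tau>}"
  proof (rule fundamental_theorem_of_calculus[OF that])
    fix x
    have "((\<lambda>s. exp (2 * \<i> * s * of_int n) / (2 * \<i> * of_int n)) has_field_derivative
        exp (2 * \<i> * of_real x * of_int n)) (at (of_real x))"
      using False by (auto intro!: derivative_eq_intros)
    from has_vector_derivative_real_field[OF this]
    show "(?F has_vector_derivative cis (2 * x * of_int n)) (at x within {0..\<tau>})"
      by (simp add: cis_conv_exp mult_ac)
  qed
  then show ?thesis
    using False by (simp add: integral_unique phase_int_def diff_divide_distrib)
qed

lemma continuous_on_cis_mult [continuous_intros]: "continuous_on A (\<lambda>s. cis (2 * s * a))"
  by (intro continuous_intros continuous_on_compose2[OF continuous_on_cis]) 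

lemma flow_modes_integral:
  assumes \<tau>: "\<tau> \<ge> 0" and k: "\<bar>k\<bar> \<le> int N"
  shows "flow_modes \<tau> N w k = disp \<tau> k * (w k - \<i> * integral {0..\<tau>} (\<lambda>s. cubic (band_kernel N s) w k))"
    and "continuous_on A (\<lambda>s. cubic (band_kernel N s) w k)"
proof -
  have bk: "(\<lambda>s. band_kernel N s (i,j,l)) =
      (\<lambda>s. cis (2 * s * of_int ((i + j + l) * i)) + cis (2 * s * of_int (j * l)) - 1)"
    if "(i,j,l) \<in> band_triples N k" for i j l
    using that by (auto simp: band_kernel_def in_band_def band_triples_def)
  have c: "continuous_on A (\<lambda>s. band_kernel N s q)" if q: "q \<in> band_triples N k" for q A
  proof (cases q)
    case (fields i j l)
    have "continuous_on A (\<lambda>s. cis (2 * s * of_int ((i + j + l) * i)) + cis (2 * s * of_int (j * l)) - 1)"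
      by (intro continuous_intros)
    then show ?thesis using bk[of i j l] q by (simp only: fields)
  qed
  show "continuous_on A (\<lambda>s. cubic (band_kernel N s) w k)"
    unfolding cubic_band_kernel by (intro continuous_intros c)
  have i: "integral {0..\<tau>} (\<lambda>s. band_kernel N s q) = flow_kernel \<tau> q" if q: "q \<in> band_triples N k" for q
  proof (cases q)
    case (fields i j l)
    have "integral {0..\<tau>} (\<lambda>s. cis (2 * s * of_int ((i + j + l) * i)) + cis (2 * s * of_int (j * l)) - 1) =
        integral {0..\<tau>} (\<lambda>s. cis (2 * s * of_int ((i + j + l) * i))) + integral {0..\<tau>} (\<lambda>s. cis (2 * s * of_int (j * l))) - integral {0..\<tau>} (\<lambda>s. 1)"
      by (subst integral_diff integral_add, (intro integrable_continuous_interval continuous_intros)+)+ simp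
    then show ?thesis using bk[of i j l] q \<tau> unfolding fields
      by (simp only: integral_cis[OF \<tau>]) (simp add: flow_kernel_def scaleR_conv_of_real)
  qed
  have "integral {0..\<tau>} (\<lambda>s. cubic (band_kernel N s) w k) = (\<Sum>q\<in>band_triples N k. integral {0..\<tau>} (\<lambda>s. band_kernel N s q * cubic_term w q))"
    unfolding cubic_band_kernel
    by (intro integral_sum integrable_continuous_interval continuous_intros c) auto
  also have "\<dots> = (\<Sum>q\<in>band_triples N k. flow_kernel \<tau> q * cubic_term w q)"
    by (rule sum.cong) (auto simp: i)
  finally show "flow_modes \<tau> N w k = disp \<tau> k * (w k - \<i> * integral {0..\<tau>} (\<lambda>s. cubic (band_kernel N s) w k))"
    using k by (simp add: flow_modes_def band_cut_def)
qed

text \<open>For \<open>k = i + j + l\<close> the phase that remains after twisting all factors is s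
  (k^2 + i^2 - j^2 - l^2) = 2 s k i + 2 s j l; to see this, insert (j + l)^2 = (k - i)^2.\<close>

lemma cubic_twist:
  "disp (- s) k * cubic (\<lambda>_. 1) f k = cubic (phase s) (\<lambda>k. disp (- s) k * f k) k"
proof -
  have "disp (- s) k * (1 * cubic_term f q) = phase s q * cubic_term (\<lambda>k. disp (- s) k * f k) q" if q: "q \<in> triples k" for q
  proof (cases q)
    case (fields i j l)
    have k: "k = i + j + l" using q by (simp add: triples_def fields)
    have "disp (- s) k = phase s q * (cnj (disp (- s) (- i)) * disp (- s) j * disp (- s) l)"
      by (simp add: disp_cis phase_def fields k cis_mult cis_cnj power2_eq_square algebra_simps)
    then show ?thesis by (simp add: cubic_term_def fields mult_ac)
  qed
  then have "(\<Sum>\<^sub>\<infinity>q\<in>triples k. disp (- s) k * (1 * cubic_term f q)) = cubic (phase s) (\<lambda>k. disp (- s) k * f k) k"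
    unfolding cubic_def by (rule infsum_cong)
  then show ?thesis by (simp add: cubic_def infsum_cmult_right')
qed

section \<open>Pointwise bounds of the kernel error\<close>

lemma norm_cis_minus_one_le_2: "norm (cis x - 1) \<le> 2"
  using norm_triangle_ineq4[of "cis x" 1] by simp

text \<open>Interpolation between the bound by the modulus of \<open>x\<close>, used up to modulus
  1, and the trivial bound 2, used beyond.\<close>

lemma norm_cis_minus_one_le:
  assumes "0 \<le> a" "a \<le> 1"
  shows "norm (cis x - 1) \<le> 2 * \<bar>x\<bar> powr a"
proof -
  have 2: "norm (cis x - 1) \<le> 2" by (rule norm_cis_minus_one_le_2)
  have l: "norm (cis x - 1) \<le> \<bar>x\<bar>"
    using dist_exp_i_1[of x] abs_sin_x_le_abs_x[of "x/2"] by (simp add: cis_conv_exp)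
  show "norm (cis x - 1) \<le> 2 * \<bar>x\<bar> powr a"
  proof (cases "\<bar>x\<bar> \<le> 1")
    case True
    show ?thesis
    proof (cases "x = 0")
      case False
      have "\<bar>x\<bar> powr 1 \<le> \<bar>x\<bar> powr a" using True False assms by (intro powr_mono') auto
      then have "\<bar>x\<bar> \<le> \<bar>x\<bar> powr a" by simp
      then show ?thesis using l powr_ge_zero[of "\<bar>x\<bar>" a] by linarith
    qed simp
  next
    case False
    then have "1 \<le> \<bar>x\<bar> powr a" using assms by (intro ge_one_powr_ge_zero) auto
    then show ?thesis using 2 by linarith
  qed
qed

lemma kernel_difference_in_band:
  assumes "in_band N (i,j,l)"
  shows "norm (phase s (i,j,l) - band_kernel N s (i,j,l)) =
    norm (cis (2 * s * of_int ((i + j + l) * i)) - 1) * norm (cis (2 * s * of_int (j * l)) - 1)"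
proof -
  have "phase s (i,j,l) = cis (2 * s * of_int ((i + j + l) * i)) * cis (2 * s * of_int (j * l))"
    by (simp add: phase_def cis_mult algebra_simps)
  then have "phase s (i,j,l) - band_kernel N s (i,j,l) =
      (cis (2 * s * of_int ((i + j + l) * i)) - 1) * (cis (2 * s * of_int (j * l)) - 1)"
    using assms by (simp add: band_kernel_def algebra_simps)
  then show ?thesis by (simp add: norm_mult)
qed

text \<open>Outside the band the numerical kernel is zero and the error is the whole phase factor.
  Some input is then at least N / 2 in modulus; the factor 2 is lost to the condition on
  \<open>j + l\<close>.\<close>

lemma kernel_difference_out_band:
  assumes "\<not> in_band N (i,j,l)"
  shows "norm (phase s (i,j,l) - band_kernel N s (i,j,l)) = 1"
    and "(real N)\<^sup>2 \<le> 4 * W i \<or> (real N)\<^sup>2 \<le> 4 * W j \<or> (real N)\<^sup>2 \<le> 4 * W l"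
proof -
  show "norm (phase s (i,j,l) - band_kernel N s (i,j,l)) = 1" using assms by (simp add: band_kernel_def)
  have h: "(real N)\<^sup>2 \<le> 4 * W a" if "int N \<le> 2 * \<bar>a\<bar>" for a
  proof -
    have "real N \<le> 2 * \<bar>real_of_int a\<bar>" using that by linarith
    then have "(real N)\<^sup>2 \<le> (2 * \<bar>real_of_int a\<bar>)\<^sup>2" by (rule power_mono) simp
    then show ?thesis by (simp add: power_mult_distrib)
  qed
  have "int N \<le> 2 * \<bar>i\<bar> \<or> int N \<le> 2 * \<bar>j\<bar> \<or> int N \<le> 2 * \<bar>l\<bar>"
    using assms by (auto simp: in_band_def)
  then show "(real N)\<^sup>2 \<le> 4 * W i \<or> (real N)\<^sup>2 \<le> 4 * W j \<or> (real N)\<^sup>2 \<le> 4 * W l" using h by blast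
qed

text \<open>One product dominates every input weight and the phase \<open>k * i\<close>, because its
  expansion contains the sum of the three squares. A power of it splits evenly over the three
  functions.\<close>

lemma W_product_ge:
  "W i \<le> W i * W j * W l" "W j \<le> W i * W j * W l" "W l \<le> W i * W j * W l"
  "\<bar>of_int ((i + j + l) * i)\<bar> \<le> 2 * (W i * W j * W l)"
proof -
  have a: "x \<le> x * y" if "x \<ge> 0" "y \<ge> 1" for x y :: real using that mult_left_mono[of 1 y x] by simp
  have g: "W a \<ge> 1" "W a \<ge> 0" for a :: int by auto
  have gg: "W a * W b \<ge> 1" for a b :: int using mult_mono[OF g(1)[of a] g(1)[of b]] by simp
  show 1: "W i \<le> W i * W j * W l" using a[OF g(2) gg, of i j l] by (simp add: mult_ac)
  show 2: "W j \<le> W i * W j * W l" using a[OF g(2) gg, of j i l] by (simp add: mult_ac)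
  show 3: "W l \<le> W i * W j * W l" using a[OF g(2) gg, of l i j] by (simp add: mult_ac)
  define x y z where "x = real_of_int i" and "y = real_of_int j" and "z = real_of_int l"
  have nn: "x\<^sup>2 * y\<^sup>2 \<ge> 0" "x\<^sup>2 * z\<^sup>2 \<ge> 0" "y\<^sup>2 * z\<^sup>2 \<ge> 0" "x\<^sup>2 * y\<^sup>2 * z\<^sup>2 \<ge> 0" by auto
  have "W i * W j * W l \<ge> x\<^sup>2 + y\<^sup>2 + z\<^sup>2"
    using nn by (simp add: x_def y_def z_def algebra_simps)
  moreover have "\<bar>(x + y + z) * x\<bar> \<le> 2 * (x\<^sup>2 + y\<^sup>2 + z\<^sup>2)"
  proof -
    have "2 * (x * a) \<le> x\<^sup>2 + a\<^sup>2" "- 2 * (x * a) \<le> x\<^sup>2 + a\<^sup>2" for a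
      using zero_le_power2[of "x - a"] zero_le_power2[of "x + a"] by (simp_all add: power2_diff power2_sum)
    note h = this
    have eq: "(x + y + z) * x = x\<^sup>2 + x * y + x * z" by (simp add: power2_eq_square algebra_simps)
    have lin: "X + p + q \<le> 2 * (X + Y + Z) \<and> - (X + p + q) \<le> 2 * (X + Y + Z)"
      if "2 * p \<le> X + Y" "- 2 * p \<le> X + Y" "2 * q \<le> X + Z" "- 2 * q \<le> X + Z" "0 \<le> X" "0 \<le> Y" "0 \<le> Z"
      for X Y Z p q :: real using that by auto
    show ?thesis unfolding abs_le_iff eq by (rule lin) (use h[of y] h[of z] in auto)
  qed
  ultimately show "\<bar>of_int ((i + j + l) * i)\<bar> \<le> 2 * (W i * W j * W l)"
    by (simp add: x_def y_def z_def)
qed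

text \<open>Only the factor with \<open>k * i\<close> is turned into a power of \<tau>, the other
  one is bounded by 2. A small exponent \<eta> is enough, at the price of a weight
  \<open>W powr \<eta>\<close> on each function, which l^1 can afford while
  \<open>\<gamma> - 2 * \<eta> > 1/2\<close>. The constant is 16 = 2 * 2 * 4.\<close>

lemma kernel_difference_l1:
  assumes s: "0 \<le> s" "s \<le> \<tau>" and N: "N \<ge> 1" and \<eta>: "0 \<le> \<eta>" "\<eta> \<le> 1"
  shows "norm (phase s (i,j,l) - band_kernel N s (i,j,l)) \<le>
    16 * (\<tau> powr \<eta> + real N powr (- 2 * \<eta>)) * (W i powr \<eta> * W j powr \<eta> * W l powr \<eta>)"
proof -
  let ?P = "W i * W j * W l"
  have P: "?P \<ge> 0" by auto
  have Pp: "?P powr \<eta> = W i powr \<eta> * W j powr \<eta> * W l powr \<eta>" by (simp add: powr_mult)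
  have four: "4 powr \<eta> \<le> (4::real)" using powr_mono[of \<eta> 1 "4::real"] \<eta> by simp
  show ?thesis
  proof (cases "in_band N (i,j,l)")
    case True
    let ?A = "2 * s * of_int ((i + j + l) * i) :: real"
    have "\<bar>?A\<bar> = 2 * s * \<bar>of_int ((i + j + l) * i)\<bar>" using s by (simp add: abs_mult)
    also have "\<dots> \<le> 2 * \<tau> * (2 * ?P)" using s P by (intro mult_mono W_product_ge) auto
    finally have A: "\<bar>?A\<bar> \<le> 4 * (\<tau> * ?P)" by simp
    have "norm (phase s (i,j,l) - band_kernel N s (i,j,l)) \<le> (2 * \<bar>?A\<bar> powr \<eta>) * 2"
      unfolding kernel_difference_in_band[OF True]
      by (intro mult_mono norm_cis_minus_one_le norm_cis_minus_one_le_2 \<eta>) auto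
    also have "\<bar>?A\<bar> powr \<eta> \<le> (4 * (\<tau> * ?P)) powr \<eta>" by (intro powr_mono2 \<eta> A) auto
    also have "\<dots> = 4 powr \<eta> * (\<tau> powr \<eta> * ?P powr \<eta>)" using s by (simp add: powr_mult)
    also have "\<dots> \<le> 4 * (\<tau> powr \<eta> * ?P powr \<eta>)" using four by (intro mult_right_mono) auto
    finally have "norm (phase s (i,j,l) - band_kernel N s (i,j,l)) \<le> 16 * \<tau> powr \<eta> * ?P powr \<eta>" by simp
    also have "\<dots> \<le> 16 * (\<tau> powr \<eta> + real N powr (- 2 * \<eta>)) * ?P powr \<eta>" by (intro mult_right_mono) auto
    finally show ?thesis by (simp add: Pp)
  next
    case False
    have "(real N)\<^sup>2 \<le> 4 * ?P"
      using kernel_difference_out_band(2)[OF False]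
    proof -
      have "(real N)\<^sup>2 \<le> 4 * ?P" if "(real N)\<^sup>2 \<le> 4 * x" "x \<le> ?P" for x
        by (rule order_trans[OF that(1) mult_left_mono[OF that(2)]]) simp
      then show ?thesis
        using kernel_difference_out_band(2)[OF False] W_product_ge(1-3)[where i = i and j = j and l = l] by blast
    qed
    then have "((real N)\<^sup>2) powr \<eta> \<le> (4 * ?P) powr \<eta>" by (intro powr_mono2 \<eta>) auto
    also have "\<dots> = 4 powr \<eta> * ?P powr \<eta>" by (simp add: powr_mult)
    also have "\<dots> \<le> 4 * ?P powr \<eta>" using four by (intro mult_right_mono) auto
    finally have "real N powr (2 * \<eta>) \<le> 4 * ?P powr \<eta>" using N by (simp add: powr_powr flip: powr_numeral)
    then have "real N powr (- 2 * \<eta>) * real N powr (2 * \<eta>) \<le> real N powr (- 2 * \<eta>) * (4 * ?P powr \<eta>)"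
      by (intro mult_left_mono) auto
    then have "1 \<le> 4 * real N powr (- 2 * \<eta>) * ?P powr \<eta>" using N by (simp flip: powr_add)
    also have "\<dots> \<le> 16 * (\<tau> powr \<eta> + real N powr (- 2 * \<eta>)) * ?P powr \<eta>" by (intro mult_right_mono) auto
    finally show ?thesis using kernel_difference_out_band(1)[OF False] by (simp add: Pp)
  qed
qed

text \<open>Both factors are turned into powers with exponent \<alpha>, which yields \<tau> to the
  power 2 \<alpha> and the kernel of \<open>resonance_kernel\<close>. Outside the band one large
  input, carrying the full weight of H^\<gamma>, pays for N to the power -\<gamma>, independently of
  \<tau>.\<close>

lemma kernel_difference_l2:
  assumes s: "0 \<le> s" "s \<le> \<tau>" and N: "N \<ge> 1" and \<alpha>: "0 < \<alpha>" "\<alpha> \<le> 1" and \<gamma>: "0 \<le> \<gamma>" "\<gamma> \<le> 1"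
  shows "norm (phase s (i,j,l) - band_kernel N s (i,j,l)) \<le>
    16 * \<tau> powr (2 * \<alpha>) * ((\<bar>of_int (i + j + l)\<bar> * \<bar>of_int i\<bar> * \<bar>of_int j\<bar> * \<bar>of_int l\<bar>) powr \<alpha>)
    + 2 * real N powr (- \<gamma>) * (W i powr (\<gamma>/2) + W j powr (\<gamma>/2) + W l powr (\<gamma>/2))"
proof (cases "in_band N (i,j,l)")
  case True
  let ?A = "2 * s * of_int ((i + j + l) * i) :: real" and ?B = "2 * s * of_int (j * l) :: real"
  let ?Q = "\<bar>of_int (i + j + l)\<bar> * \<bar>of_int i\<bar> * \<bar>of_int j\<bar> * \<bar>of_int l\<bar> :: real"
  have "norm (phase s (i,j,l) - band_kernel N s (i,j,l)) \<le> (2 * \<bar>?A\<bar> powr \<alpha>) * (2 * \<bar>?B\<bar> powr \<alpha>)"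
    unfolding kernel_difference_in_band[OF True]
    using \<alpha> by (intro mult_mono norm_cis_minus_one_le) auto
  also have "\<dots> = 4 * (\<bar>?A\<bar> * \<bar>?B\<bar>) powr \<alpha>" by (simp add: powr_mult)
  also have "\<bar>?A\<bar> * \<bar>?B\<bar> = (2 * s)\<^sup>2 * ?Q"
  proof -
    have "\<bar>2 * s * (a * b)\<bar> * \<bar>2 * s * (c * d)\<bar> = (2 * s)\<^sup>2 * (\<bar>a\<bar> * \<bar>b\<bar> * \<bar>c\<bar> * \<bar>d\<bar>)" for a b c d
      by (simp add: abs_mult power2_eq_square mult_ac)
    then show ?thesis by (simp only: of_int_mult)
  qed
  also have "((2 * s)\<^sup>2 * ?Q) powr \<alpha> \<le> ((2 * \<tau>)\<^sup>2 * ?Q) powr \<alpha>"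
    using s \<alpha> by (intro powr_mono2 mult_right_mono power_mono) auto
  also have "\<dots> = ((2 * \<tau>)\<^sup>2) powr \<alpha> * ?Q powr \<alpha>" by (rule powr_mult)
  also have "((2 * \<tau>)\<^sup>2) powr \<alpha> = 4 powr \<alpha> * \<tau> powr (2 * \<alpha>)"
    using s by (cases "\<tau> = 0") (auto simp: power_mult_distrib powr_mult powr_powr simp flip: powr_numeral)
  also have "4 * (4 powr \<alpha> * \<tau> powr (2 * \<alpha>) * ?Q powr \<alpha>) \<le> 4 * (4 * \<tau> powr (2 * \<alpha>) * ?Q powr \<alpha>)"
    using powr_mono[of \<alpha> 1 "4::real"] \<alpha> by (intro mult_left_mono mult_right_mono) auto
  finally have "norm (phase s (i,j,l) - band_kernel N s (i,j,l)) \<le> 16 * \<tau> powr (2 * \<alpha>) * ?Q powr \<alpha>" by simp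
  moreover have "0 \<le> 2 * real N powr (- \<gamma>) * (W i powr (\<gamma>/2) + W j powr (\<gamma>/2) + W l powr (\<gamma>/2))" by simp
  ultimately show ?thesis by linarith
next
  case False
  have h: "1 \<le> 2 * real N powr (- \<gamma>) * W a powr (\<gamma>/2)" if "(real N)\<^sup>2 \<le> 4 * W a" for a :: int
  proof -
    have "((real N)\<^sup>2) powr (\<gamma>/2) \<le> (4 * W a) powr (\<gamma>/2)" using that \<gamma> by (intro powr_mono2) auto
    also have "\<dots> = 4 powr (\<gamma>/2) * W a powr (\<gamma>/2)" by (rule powr_mult)
    also have "\<dots> \<le> 2 * W a powr (\<gamma>/2)"
      using powr_mono[of "\<gamma>/2" "1/2" "4::real"] \<gamma> by (intro mult_right_mono) (auto simp: powr_half_sqrt)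
    finally have "real N powr \<gamma> \<le> 2 * W a powr (\<gamma>/2)" using N by (simp add: powr_powr flip: powr_numeral)
    then have "real N powr (- \<gamma>) * real N powr \<gamma> \<le> real N powr (- \<gamma>) * (2 * W a powr (\<gamma>/2))"
      by (intro mult_left_mono) auto
    then show ?thesis using N by (simp flip: powr_add)
  qed
  have nn: "0 \<le> 2 * real N powr (- \<gamma>) * W a powr (\<gamma>/2)" for a :: int by simp
  have "1 \<le> 2 * real N powr (- \<gamma>) * W i powr (\<gamma>/2) + 2 * real N powr (- \<gamma>) * W j powr (\<gamma>/2) + 2 * real N powr (- \<gamma>) * W l powr (\<gamma>/2)"
    using kernel_difference_out_band(2)[OF False] h[of i] h[of j] h[of l] nn[of i] nn[of j] nn[of l] by linarith
  moreover have "0 \<le> 16 * \<tau> powr (2 * \<alpha>) * ((\<bar>of_int (i + j + l)\<bar> * \<bar>of_int i\<bar> * \<bar>of_int j\<bar> * \<bar>of_int l\<bar>) powr \<alpha>)" by simp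
  ultimately show ?thesis using kernel_difference_out_band(1)[OF False, of s] unfolding distrib_left by linarith
qed

lemma cubic_kernel_diff:
  assumes f: "l1 f" and \<kappa>: "\<And>q. norm (\<kappa> q) \<le> B" "\<And>q. norm (\<kappa>' q) \<le> B"
    and g: "g summable_on triples k" "\<And>q. q \<in> triples k \<Longrightarrow> norm (\<kappa> q - \<kappa>' q) * norm (cubic_term f q) \<le> g q"
  shows "norm (cubic \<kappa> f k - cubic \<kappa>' f k) \<le> infsum g (triples k)"
proof -
  have "cubic \<kappa> f k - cubic \<kappa>' f k = (\<Sum>\<^sub>\<infinity>q\<in>triples k. (\<kappa> q - \<kappa>' q) * cubic_term f q)"
    unfolding cubic_def left_diff_distrib
    by (rule infsum_minus(1)[symmetric]) (rule cubic_summable(2)[OF f \<kappa>(1)], rule cubic_summable(2)[OF f \<kappa>(2)])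
  also have "norm \<dots> \<le> infsum g (triples k)"
    by (rule dominated_infsum(3)[OF g(1)]) (use g(2) in \<open>simp add: norm_mult\<close>)
  finally show ?thesis .
qed

text \<open>The embedding into l^1 applied to \<open>W k powr \<eta> * norm (f k)\<close> with
  exponent \<open>\<gamma> - 2 * \<eta>\<close>: a little regularity is kept inside the l^1
  norm.\<close>

lemma weighted_l1_of_sobolev:
  fixes f :: "int \<Rightarrow> complex"
  assumes \<eta>: "\<gamma> - 2 * \<eta> > 1/2" and f: "sobolev_summable \<gamma> f" "sobolev_sum \<gamma> f \<le> m\<^sup>2" "m \<ge> 0"
  shows "(\<lambda>k. W k powr \<eta> * norm (f k)) summable_on UNIV"
    and "(\<Sum>\<^sub>\<infinity>k. W k powr \<eta> * norm (f k)) \<le> sqrt (W_sum (\<gamma> - 2 * \<eta>)) * m"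
proof -
  have e: "W k powr (\<gamma> - 2 * \<eta>) * (W k powr \<eta> * norm (f k))\<^sup>2 = W k powr \<gamma> * (norm (f k))\<^sup>2" for k
  proof -
    have "W k powr (\<gamma> - 2 * \<eta>) * (W k powr \<eta> * norm (f k))\<^sup>2 =
        (W k powr (\<gamma> - 2 * \<eta>) * (W k powr \<eta> * W k powr \<eta>)) * (norm (f k))\<^sup>2"
      by (simp add: power2_eq_square mult_ac)
    also have "W k powr (\<gamma> - 2 * \<eta>) * (W k powr \<eta> * W k powr \<eta>) = W k powr \<gamma>"
      by (simp flip: powr_add)
    finally show ?thesis .
  qed
  note b = weighted_l1_bound[OF \<eta>, of "\<lambda>k. W k powr \<eta> * norm (f k)", unfolded e, OF _ f(1)]
  show "(\<lambda>k. W k powr \<eta> * norm (f k)) summable_on UNIV" using b(1) by simp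
  have "sqrt (sobolev_sum \<gamma> f) \<le> m" using f(2,3) by (intro real_le_lsqrt) auto
  then show "(\<Sum>\<^sub>\<infinity>k. W k powr \<eta> * norm (f k)) \<le> sqrt (W_sum (\<gamma> - 2 * \<eta>)) * m"
    using order_trans[OF b(2) mult_left_mono] by (simp add: infsum_nonneg)
qed

lemma kernel_error_l1:
  fixes f :: "int \<Rightarrow> complex"
  assumes s: "0 \<le> s" "s \<le> \<tau>" and N: "N \<ge> 1" and \<eta>: "0 \<le> \<eta>" "\<eta> \<le> 1" "\<gamma> - 2 * \<eta> > 1/2"
    and f: "sobolev_summable \<gamma> f" "sobolev_sum \<gamma> f \<le> m\<^sup>2" "m \<ge> 0"
    and K: "finite K"
  shows "(\<Sum>k\<in>K. norm (cubic (phase s) f k - cubic (band_kernel N s) f k)) \<le>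
    16 * (\<tau> powr \<eta> + real N powr (- 2 * \<eta>)) * (sqrt (W_sum (\<gamma> - 2 * \<eta>)) * m) ^ 3"
proof -
  define g where "g k = W k powr \<eta> * norm (f k)" for k
  define C where "C = 16 * (\<tau> powr \<eta> + real N powr (- 2 * \<eta>))"
  have C: "C \<ge> 0" by (simp add: C_def)
  have g0: "g k \<ge> 0" for k by (simp add: g_def)
  have wb: "g summable_on UNIV" and gs: "infsum g UNIV \<le> sqrt (W_sum (\<gamma> - 2 * \<eta>)) * m"
    using weighted_l1_of_sobolev[OF \<eta>(3) f] by (simp_all add: g_def[abs_def])
  have fl: "l1 f"
  proof (rule summable_on_comparison_test[OF wb])
    fix k
    have "1 \<le> W k powr \<eta>" using \<eta>(1) by (intro ge_one_powr_ge_zero) auto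
    then show "norm (f k) \<le> g k" using mult_right_mono[of 1 "W k powr \<eta>" "norm (f k)"] by (simp add: g_def)
  qed auto
  have rg: "(\<lambda>k. g (- k)) summable_on UNIV" using wb reflect_sum(2)[of g] by simp
  note ts = triple_sums[OF rg wb wb g0 g0 g0]
  have cs: "(\<lambda>q. C * (case q of (i,j,l) \<Rightarrow> g (- i) * g j * g l)) summable_on triples k" for k
    by (intro summable_on_cmult_right ts)
  have b: "norm (phase s q - band_kernel N s q) * norm (cubic_term f q) \<le> C * (case q of (i,j,l) \<Rightarrow> g (- i) * g j * g l)" for q
  proof (cases q)
    case (fields i j l)
    have "norm (phase s q - band_kernel N s q) * norm (cubic_term f q) \<le> (C * (W i powr \<eta> * W j powr \<eta> * W l powr \<eta>)) * norm (cubic_term f q)"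
      unfolding fields C_def using kernel_difference_l1[OF s N \<eta>(1,2)] by (rule mult_right_mono) simp
    then show ?thesis by (simp add: fields cubic_term_bound g_def mult_ac)
  qed
  have "(\<Sum>k\<in>K. norm (cubic (phase s) f k - cubic (band_kernel N s) f k)) \<le> (\<Sum>k\<in>K. C * (\<Sum>\<^sub>\<infinity>(i,j,l)\<in>triples k. g (- i) * g j * g l))"
  proof (rule sum_mono)
    fix k
    show "norm (cubic (phase s) f k - cubic (band_kernel N s) f k) \<le> C * (\<Sum>\<^sub>\<infinity>(i,j,l)\<in>triples k. g (- i) * g j * g l)"
      using cubic_kernel_diff[OF fl, of "phase s" 3 "band_kernel N s", OF _ norm_band_kernel cs b]
      by (simp add: infsum_cmult_right')
  qed
  also have "\<dots> = C * (\<Sum>k\<in>K. \<Sum>\<^sub>\<infinity>(i,j,l)\<in>triples k. g (- i) * g j * g l)" by (simp add: sum_distrib_left)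
  also have "\<dots> \<le> C * (infsum g UNIV * infsum g UNIV * infsum g UNIV)"
    using ts(4)[OF K] reflect_sum(1)[of g] C by (intro mult_left_mono) auto
  also have "\<dots> = C * (infsum g UNIV) ^ 3" by (simp add: power3_eq_cube)
  also have "\<dots> \<le> C * (sqrt (W_sum (\<gamma> - 2 * \<eta>)) * m) ^ 3"
    by (intro mult_left_mono power_mono gs C infsum_nonneg g0)
  finally show ?thesis by (simp add: C_def)
qed

text \<open>Two mechanisms are added. The phase error goes through the resonance estimate with all
  three functions in H^\<gamma>; the truncation error goes through Young's inequality with the
  weighted function in l^2 and the other two in l^1. The three positions of the weight give 6 = 2 *
  3.\<close>

lemma kernel_error_l2:
  fixes f :: "int \<Rightarrow> complex"
  assumes s: "0 \<le> s" "s \<le> \<tau>" and N: "N \<ge> 1"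
    and \<alpha>: "0 < \<alpha>" "2 * \<alpha> \<le> \<gamma>" "\<gamma> \<le> 1" "3 * \<gamma> - 4 * \<alpha> > 1" and \<gamma>: "\<gamma> > 1/2"
    and f: "sobolev_summable \<gamma> f" "sobolev_sum \<gamma> f \<le> m\<^sup>2" "m \<ge> 0"
    and R: "l1 f" "l1_norm f \<le> R" and K: "finite K"
  shows "L2_set (\<lambda>k. norm (cubic (phase s) f k - cubic (band_kernel N s) f k)) K \<le>
    16 * \<tau> powr (2 * \<alpha>) * (sqrt 27 * W_sum ((3 * \<gamma> - 4 * \<alpha>) / 2) * m ^ 3)
    + 6 * real N powr (- \<gamma>) * (R\<^sup>2 * m)"
proof -
  define x z where "x k = norm (f k)" and "z k = W k powr (\<gamma>/2) * norm (f k)" for k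
  have x0: "x k \<ge> 0" "z k \<ge> 0" for k by (auto simp: x_def z_def)
  have z2: "(z k)\<^sup>2 = W k powr \<gamma> * (norm (f k))\<^sup>2" for k
    by (simp add: z_def power_mult_distrib power2_eq_square[of "_ powr _"] flip: powr_add)
  have x: "x summable_on UNIV" "infsum x UNIV \<le> R" using R by (simp_all add: x_def[abs_def])
  have sm: "sqrt (\<Sum>\<^sub>\<infinity>k. (z k)\<^sup>2) \<le> m" unfolding z2 using f(2,3) by (intro real_le_lsqrt) auto
  have rx: "(\<lambda>k. x (- k)) summable_on UNIV" "(\<Sum>\<^sub>\<infinity>k. x (- k)) = infsum x UNIV"
    using x reflect_sum[of x] by simp_all
  have zs: "(\<lambda>k. (z k)\<^sup>2) summable_on UNIV" unfolding z2 by (rule f)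
  have rz: "(\<lambda>k. (z (- k))\<^sup>2) summable_on UNIV" "(\<Sum>\<^sub>\<infinity>k. (z (- k))\<^sup>2) = (\<Sum>\<^sub>\<infinity>k. (z k)\<^sup>2)"
    using zs reflect_sum[of "\<lambda>k. (z k)\<^sup>2"] by simp_all
  define h where "h = (\<lambda>(i,j,l). (\<bar>of_int (i + j + l)\<bar> * \<bar>of_int i\<bar> * \<bar>of_int j\<bar> * \<bar>of_int l\<bar>) powr \<alpha> * (x (- i) * x j * x l))"
  have fx: "(\<lambda>k. W k powr \<gamma> * (x k)\<^sup>2) summable_on UNIV" using f(1) by (simp add: x_def)
  have fr: "(\<lambda>k. W k powr \<gamma> * (x (- k))\<^sup>2) summable_on UNIV" "(\<Sum>\<^sub>\<infinity>k. W k powr \<gamma> * (x (- k))\<^sup>2) = (\<Sum>\<^sub>\<infinity>k. W k powr \<gamma> * (x k)\<^sup>2)"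
    using fx reflect_sum[of "\<lambda>k. W k powr \<gamma> * (x k)\<^sup>2"] by simp_all
  note res = resonance_l2[OF \<alpha> fr(1) fx fx K, folded h_def]
  let ?h1 = "\<lambda>(i,j,l). z (- i) * x j * x l" and ?h2 = "\<lambda>(i,j,l). x (- i) * z j * x l" and ?h3 = "\<lambda>(i,j,l). x (- i) * x j * z l"
  note y1 = young_l2(1,4)[OF x(1) x0(1) x(1) x0(1) rz(1) K] and y2 = young_l2(2,5)[OF rx(1) x0(1) x(1) x0(1) zs K]
    and y3 = young_l2(3,6)[OF rx(1) x0(1) x(1) x0(1) zs K]
  define A B where "A = 16 * \<tau> powr (2 * \<alpha>)" and "B = 2 * real N powr (- \<gamma>)"
  have AB: "A \<ge> 0" "B \<ge> 0" by (simp_all add: A_def B_def)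
  have gs: "(\<lambda>q. A * h q + B * (?h1 q + ?h2 q + ?h3 q)) summable_on triples k" for k
    by (intro summable_on_add summable_on_cmult_right res(1) y1(1) y2(1) y3(1))
  have b: "norm (phase s q - band_kernel N s q) * norm (cubic_term f q) \<le> A * h q + B * (?h1 q + ?h2 q + ?h3 q)" for q
  proof (cases q)
    case (fields i j l)
    have "norm (phase s q - band_kernel N s q) * norm (cubic_term f q) \<le>
      (A * ((\<bar>of_int (i + j + l)\<bar> * \<bar>of_int i\<bar> * \<bar>of_int j\<bar> * \<bar>of_int l\<bar>) powr \<alpha>)
        + B * (W i powr (\<gamma>/2) + W j powr (\<gamma>/2) + W l powr (\<gamma>/2))) * norm (cubic_term f q)"
      unfolding fields A_def B_def using \<alpha> \<gamma> by (intro mult_right_mono kernel_difference_l2 s N) auto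
    also have "\<dots> = A * h q + B * (?h1 q + ?h2 q + ?h3 q)"
      by (simp add: fields cubic_term_bound x_def z_def h_def algebra_simps)
    finally show ?thesis .
  qed
  define S where "S g k = infsum g (triples k)" for g :: "int \<times> int \<times> int \<Rightarrow> real" and k
  have point: "norm (cubic (phase s) f k - cubic (band_kernel N s) f k) \<le> A * S h k + B * (S ?h1 k + S ?h2 k + S ?h3 k)" for k
  proof -
    have "norm (cubic (phase s) f k - cubic (band_kernel N s) f k) \<le> (\<Sum>\<^sub>\<infinity>q\<in>triples k. A * h q + B * (?h1 q + ?h2 q + ?h3 q))"
      using cubic_kernel_diff[OF R(1), of "phase s" 3 "band_kernel N s", OF _ norm_band_kernel gs b] by simp
    also have "\<dots> = A * S h k + (\<Sum>\<^sub>\<infinity>q\<in>triples k. B * (?h1 q + ?h2 q + ?h3 q))"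
      unfolding S_def
      by (subst infsum_add) (intro summable_on_add summable_on_cmult_right res(1) y1(1) y2(1) y3(1), intro summable_on_add summable_on_cmult_right res(1) y1(1) y2(1) y3(1), simp add: infsum_cmult_right')
    also have "(\<Sum>\<^sub>\<infinity>q\<in>triples k. B * (?h1 q + ?h2 q + ?h3 q)) = B * (S ?h1 k + S ?h2 k + S ?h3 k)"
      unfolding S_def infsum_cmult_right'
      by (subst infsum_add infsum_add, (intro summable_on_add y1(1) y2(1) y3(1))+)+ simp
    finally show ?thesis .
  qed
  have Snn: "S h k \<ge> 0" "S ?h1 k \<ge> 0" "S ?h2 k \<ge> 0" "S ?h3 k \<ge> 0" for k
    unfolding S_def h_def by (auto intro!: infsum_nonneg mult_nonneg_nonneg x0)
  have X0: "infsum x UNIV \<ge> 0" by (intro infsum_nonneg x0)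
  have RR: "infsum x UNIV * infsum x UNIV * sqrt (\<Sum>\<^sub>\<infinity>k. (z k)\<^sup>2) \<le> R\<^sup>2 * m"
    unfolding power2_eq_square[of R] using X0 x(2) sm by (intro mult_mono) (auto intro!: mult_nonneg_nonneg infsum_nonneg)
  have s1: "L2_set (S ?h1) K \<le> R\<^sup>2 * m" using y1(2) RR unfolding S_def[abs_def] rz by linarith
  have s2: "L2_set (S ?h2) K \<le> R\<^sup>2 * m" using y2(2) RR unfolding S_def[abs_def] rx by linarith
  have s3: "L2_set (S ?h3) K \<le> R\<^sup>2 * m" using y3(2) RR unfolding S_def[abs_def] rx by linarith
  let ?Z = "\<Sum>\<^sub>\<infinity>k. W k powr (- ((3 * \<gamma> - 4 * \<alpha>) / 2))"
  let ?X = "sqrt (\<Sum>\<^sub>\<infinity>k. W k powr \<gamma> * (x k)\<^sup>2)"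
  have X: "?X \<le> m" "?X \<ge> 0" using f(2,3) by (auto intro!: real_le_lsqrt infsum_nonneg simp: x_def)
  have s0: "L2_set (S h) K \<le> sqrt 27 * ?Z * m ^ 3"
  proof -
    have "L2_set (S h) K \<le> sqrt 27 * ?Z * (?X * ?X * ?X)"
      using res(2) unfolding S_def[abs_def] fr(2) .
    also have "\<dots> \<le> sqrt 27 * ?Z * (m * m * m)"
      using X f(3) by (intro mult_left_mono mult_mono) (auto intro!: mult_nonneg_nonneg infsum_nonneg)
    finally show ?thesis by (simp add: power3_eq_cube)
  qed
  have "L2_set (\<lambda>k. norm (cubic (phase s) f k - cubic (band_kernel N s) f k)) K \<le> L2_set (\<lambda>k. A * S h k + B * (S ?h1 k + S ?h2 k + S ?h3 k)) K"
    by (intro L2_set_mono point) auto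
  also have "\<dots> \<le> L2_set (\<lambda>k. A * S h k) K + L2_set (\<lambda>k. B * (S ?h1 k + S ?h2 k + S ?h3 k)) K"
    by (rule L2_set_triangle_ineq)
  also have "\<dots> = A * L2_set (S h) K + B * L2_set (\<lambda>k. S ?h1 k + S ?h2 k + S ?h3 k) K"
    by (simp only: L2_set_right_distrib[OF AB(1)] L2_set_right_distrib[OF AB(2)])
  also have "\<dots> \<le> A * (sqrt 27 * ?Z * m ^ 3) + B * (R\<^sup>2 * m + R\<^sup>2 * m + R\<^sup>2 * m)"
    by (intro add_mono mult_left_mono AB s0 order_trans[OF L2_set_triangle_ineq] s1 s2 s3)
  finally show ?thesis by (simp add: A_def B_def mult_ac)
qed

lemma sum_cut_diff:
  assumes w: "\<And>k. \<bar>k\<bar> > int N \<Longrightarrow> w k = 0"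
  shows "l1_norm (\<lambda>k. band_cut N f k - w k) = band_l1 N (\<lambda>k. f k - w k)"
    and "sqrt (\<Sum>\<^sub>\<infinity>k. (norm (band_cut N f k - w k))\<^sup>2) = band_l2 N (\<lambda>k. f k - w k)"
proof -
  have "l1_norm (\<lambda>k. band_cut N f k - w k) = (\<Sum>\<^sub>\<infinity>k\<in>{- int N..int N}. norm (f k - w k))"
    by (rule infsum_cong_neutral) (use w in \<open>auto simp: band_cut_def not_le abs_le_iff\<close>)
  then show "l1_norm (\<lambda>k. band_cut N f k - w k) = band_l1 N (\<lambda>k. f k - w k)" by simp
  have "(\<Sum>\<^sub>\<infinity>k. (norm (band_cut N f k - w k))\<^sup>2) = (\<Sum>\<^sub>\<infinity>k\<in>{- int N..int N}. (norm (f k - w k))\<^sup>2)"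
    by (rule infsum_cong_neutral) (use w in \<open>auto simp: band_cut_def not_le abs_le_iff\<close>)
  then show "sqrt (\<Sum>\<^sub>\<infinity>k. (norm (band_cut N f k - w k))\<^sup>2) = band_l2 N (\<lambda>k. f k - w k)"
    by (simp add: L2_set_def)
qed

lemma sum_cut_le:
  assumes "l1 f" shows "l1_norm (band_cut N f) \<le> l1_norm f"
  by (rule infsum_mono[OF l1_cut assms]) (auto simp: band_cut_def)

section \<open>One step of the scheme against one step of the solution\<close>

context nls_modes
begin

definition R0 :: real where
  "R0 = sqrt (W_sum \<gamma>) * m"

abbreviation G :: "real \<Rightarrow> int \<Rightarrow> complex" where
  "G t \<equiv> cubic (\<lambda>_. 1) (c t)"

lemma l1_c: "t \<in> {0..T} \<Longrightarrow> l1 (c t)"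
  by (rule weighted_l1_bound(1)[OF \<gamma>(1) _ weighted_summable]) auto

lemma l1_bound_c: assumes t: "t \<in> {0..T}" shows "l1_norm (c t) \<le> R0"
proof -
  have "l1_norm (c t) \<le> sqrt (W_sum \<gamma>) * sqrt (sobolev_sum \<gamma> (c t))"
    by (rule weighted_l1_bound(2)[OF \<gamma>(1) _ weighted_summable[OF t]]) simp
  also have "sqrt (sobolev_sum \<gamma> (c t)) \<le> m"
    by (rule real_le_lsqrt) (use weighted_bound[OF t] m in simp_all)
  finally show ?thesis unfolding R0_def by (auto simp: mult_left_mono infsum_nonneg)
qed

lemma R0_nonneg: "R0 \<ge> 0"
  unfolding R0_def using m by (intro mult_nonneg_nonneg real_sqrt_ge_zero infsum_nonneg) auto

lemma l1_G: assumes "t \<in> {0..T}" shows "l1 (G t)" "l1_norm (G t) \<le> R0 ^ 3"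
proof -
  note l = l1_cubic[OF l1_c[OF assms], of "\<lambda>_. 1" 1]
  show "l1 (G t)" using l by simp
  have "l1_norm (G t) \<le> l1_norm (c t) ^ 3" using l by simp
  also have "\<dots> \<le> R0 ^ 3" by (intro power_mono l1_bound_c assms infsum_nonneg) auto
  finally show "l1_norm (G t) \<le> R0 ^ 3" .
qed

lemma continuous_on_G: "continuous_on {0..T} (\<lambda>s. G s k)"
  unfolding continuous_on_def
proof
  fix t assume t: "t \<in> {0..T}"
  show "((\<lambda>s. G s k) \<longlongrightarrow> G t k) (at t within {0..T})"
    by (rule tendsto_of_l1[of "{0..T}" G t, OF l1_G(1) t fourier_modes_cubic_continuous[OF l1_c l1_bound_c c_continuous[OF t] t]])
qed

lemma continuous_on_shifted_G:
  assumes "t \<ge> 0" "t + \<tau> \<le> T"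
  shows "continuous_on {0..\<tau>} (\<lambda>s. disp (- s) k * G (t + s) k)"
  by (intro continuous_intros continuous_on_compose2[OF continuous_on_G, of _ "\<lambda>s. t + s"]) (use assms in auto)

text \<open>Duhamel's formula restarted at \<open>t\<close>. After multiplication by the inverse
  group the solution is an initial value plus an integral from 0, so its increment is the integral
  over the step alone.\<close>

lemma twisted_duhamel:
  assumes t: "0 \<le> t" "0 \<le> s" "t + s \<le> T"
  shows "disp (- s) k * c (t + s) k = c t k - \<i> * integral {0..s} (\<lambda>r. disp (- r) k * G (t + r) k)"
proof -
  define g where "g r = disp (- r) k * G r k" for r
  have cg: "continuous_on {0..T} g" unfolding g_def by (intro continuous_intros continuous_on_G)
  have D: "c t k = disp t k * (c 0 k - \<i> * integral {0..t} g)" if "t \<in> {0..T}" for t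
  proof -
    have "integral {0..t} (\<lambda>s. disp (t - s) k * G s k) = integral {0..t} (\<lambda>s. disp t k * g s)"
      using disp_add[of t k] by (intro integral_cong) (simp add: g_def mult.assoc[symmetric])
    then show ?thesis using duhamel[OF that, of k] by (simp add: algebra_simps)
  qed
  have "integral {0..t} g + integral {t..t+s} g = integral {0..t+s} g"
    by (rule Henstock_Kurzweil_Integration.integral_combine) (use t in \<open>auto intro!: integrable_continuous_interval continuous_on_subset[OF cg]\<close>)
  moreover have "integral {t..t+s} g = disp (- t) k * integral {0..s} (\<lambda>r. disp (- r) k * G (t + r) k)"
  proof -
    have "integral {t..t+s} g = integral {0..s} (g \<circ> (+) t)"
      using integral_shift_Icc_real[of 0 s g t] by (simp add: add.commute)
    also have "g \<circ> (+) t = (\<lambda>r. disp (- t) k * (disp (- r) k * G (t + r) k))"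
      by (rule ext) (simp add: g_def disp_add mult.assoc[symmetric])
    finally show ?thesis by simp
  qed
  ultimately have I: "integral {0..t+s} g = integral {0..t} g + disp (- t) k * integral {0..s} (\<lambda>r. disp (- r) k * G (t + r) k)"
    by simp
  have "disp (- s) k * c (t + s) k = disp t k * (c 0 k - \<i> * integral {0..t+s} g)"
    using D[of "t + s"] t disp_add[of "- s" k "t + s"] by (simp add: mult.assoc[symmetric])
  also have "\<dots> = disp t k * (c 0 k - \<i> * integral {0..t} g) - \<i> * (disp t k * disp (- t) k * integral {0..s} (\<lambda>r. disp (- r) k * G (t + r) k))"
    unfolding I by (simp add: algebra_simps)
  also have "disp t k * disp (- t) k = 1" by (simp add: disp_add)
  finally show ?thesis using D[of t] t by simp
qed

text \<open>In the twisted unknown the linear part has disappeared. The increment is an integral of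
  the cubic term, which is bounded in l^1 by \<open>R0 ^ 3\<close>, so no derivative is
  lost.\<close>

lemma twisted_increment:
  assumes t: "0 \<le> t" "0 \<le> s" "t + s \<le> T"
  shows "l1_norm (\<lambda>k. disp (- s) k * c (t + s) k - c t k) \<le> s * R0 ^ 3"
proof (rule summable_bounded_sums(2))
  fix K :: "int set" assume K: "finite K"
  have "(\<Sum>k\<in>K. norm (disp (- s) k * c (t + s) k - c t k)) = (\<Sum>k\<in>K. norm (integral {0..s} (\<lambda>r. disp (- r) k * G (t + r) k)))"
    by (simp add: twisted_duhamel[OF t] norm_mult)
  also have "\<dots> \<le> s * R0 ^ 3"
  proof (rule sum_norm_integral_le[OF K t(2)])
    show "continuous_on {0..s} (\<lambda>r. disp (- r) k * G (t + r) k)" for k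
      by (rule continuous_on_shifted_G[OF t(1,3)])
    fix r assume r: "r \<in> {0..s}"
    then have tr: "t + r \<in> {0..T}" using t by auto
    have "(\<Sum>k\<in>K. norm (disp (- r) k * G (t + r) k)) = (\<Sum>k\<in>K. norm (G (t + r) k))" by (simp add: norm_mult)
    also have "\<dots> \<le> l1_norm (G (t + r))"
      by (rule finite_sum_le_infsum[OF l1_G(1)[OF tr] K]) auto
    also have "\<dots> \<le> R0 ^ 3" by (rule l1_G(2)[OF tr])
    finally show "(\<Sum>k\<in>K. norm (disp (- r) k * G (t + r) k)) \<le> R0 ^ 3" .
  qed
  finally show "(\<Sum>k\<in>K. norm (disp (- s) k * c (t + s) k - c t k)) \<le> s * R0 ^ 3" .
qed auto

text \<open>The Lipschitz constant \<open>3 * R0\<^sup>2\<close> of the cubic term meets the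
  increment, at most \<open>\<tau> * R0 ^ 3\<close>. The l^1 bound also serves for l^2, whose norm
  is smaller.\<close>

lemma freezing_error:
  assumes t: "0 \<le> t" "0 \<le> s" "s \<le> \<tau>" "t + \<tau> \<le> T" and K: "finite K"
  shows "(\<Sum>k\<in>K. norm (disp (- s) k * G (t + s) k - cubic (phase s) (c t) k)) \<le> 3 * R0 ^ 5 * \<tau>"
proof -
  have tT: "t \<in> {0..T}" "t + s \<in> {0..T}" using t by auto
  have "(\<Sum>k\<in>K. norm (cubic (phase s) (\<lambda>k. disp (- s) k * c (t + s) k) k - cubic (phase s) (c t) k))
     \<le> 3 * 1 * R0\<^sup>2 * l1_norm (\<lambda>k. disp (- s) k * c (t + s) k - c t k)"
    by (rule cubic_diff(1)) (use l1_c[OF tT(1)] l1_c[OF tT(2)] l1_bound_c[OF tT(1)] l1_bound_c[OF tT(2)] K in \<open>simp_all add: norm_mult\<close>)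
  also have "\<dots> \<le> 3 * 1 * R0\<^sup>2 * (s * R0 ^ 3)"
    using t by (intro mult_left_mono twisted_increment) auto
  also have "\<dots> = 3 * R0 ^ 5 * s" by (simp add: power_numeral_reduce)
  also have "\<dots> \<le> 3 * R0 ^ 5 * \<tau>" using R0_nonneg t by (intro mult_left_mono) auto
  finally show ?thesis by (simp add: cubic_twist)
qed

text \<open>The integrand of the error is split into freezing, kernel error and stability. The
  kernel error \<delta> is left open because its rate differs between the two norms. The factor 9 is
  3 from the telescoping times the bound 3 of \<open>band_kernel\<close>; only an l^1 radius
  \<open>R\<close> enters the l^2 bound.\<close>

lemma step_error:
  fixes w :: "int \<Rightarrow> complex"
  assumes t: "0 \<le> t" "0 \<le> \<tau>" "t + \<tau> \<le> T" and N: "N \<ge> 1"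
    and w: "\<And>k. \<bar>k\<bar> > int N \<Longrightarrow> w k = 0" "band_l1 N w \<le> R" "R0 \<le> R"
  defines "K \<equiv> {- int N..int N}"
  shows "(\<And>s. s \<in> {0..\<tau>} \<Longrightarrow> (\<Sum>k\<in>K. norm (cubic (phase s) (c t) k - cubic (band_kernel N s) (c t) k)) \<le> \<delta>) \<Longrightarrow>
      (\<Sum>k\<in>K. norm (c (t + \<tau>) k - flow_modes \<tau> N w k)) \<le>
      (1 + 9 * R\<^sup>2 * \<tau>) * (\<Sum>k\<in>K. norm (c t k - w k)) + \<tau> * (3 * R0 ^ 5 * \<tau> + \<delta>)"
    and "(\<And>s. s \<in> {0..\<tau>} \<Longrightarrow> L2_set (\<lambda>k. norm (cubic (phase s) (c t) k - cubic (band_kernel N s) (c t) k)) K \<le> \<delta>) \<Longrightarrow>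
      L2_set (\<lambda>k. norm (c (t + \<tau>) k - flow_modes \<tau> N w k)) K \<le>
      (1 + 9 * R\<^sup>2 * \<tau>) * L2_set (\<lambda>k. norm (c t k - w k)) K + \<tau> * (3 * R0 ^ 5 * \<tau> + \<delta>)"
proof -
  have K: "finite K" by (simp add: K_def)
  have tT: "t \<in> {0..T}" using t by auto
  define F where "F k s = disp (- s) k * G (t + s) k - cubic (band_kernel N s) w k" for k s
  have kK: "\<bar>k\<bar> \<le> int N" if "k \<in> K" for k using that by (auto simp: K_def)
  have cF: "continuous_on {0..\<tau>} (F k)" if "k \<in> K" for k
    unfolding F_def by (intro continuous_intros continuous_on_shifted_G[OF t(1,3)] flow_modes_integral(2)[OF t(2) kK[OF that]])
  have err: "norm (c (t + \<tau>) k - flow_modes \<tau> N w k) \<le> norm (c t k - w k) + norm (integral {0..\<tau>} (F k))" if k: "k \<in> K" for k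
  proof -
    \<comment> \<open>The unimodular factor leaves the norm unchanged and brings both the solution
      and the scheme into twisted form.\<close>
    have "disp (- \<tau>) k * (c (t + \<tau>) k - flow_modes \<tau> N w k) = disp (- \<tau>) k * c (t + \<tau>) k - (disp (- \<tau>) k * disp \<tau> k) * (w k - \<i> * integral {0..\<tau>} (\<lambda>s. cubic (band_kernel N s) w k))"
      unfolding flow_modes_integral(1)[OF t(2) kK[OF k]] by (simp add: algebra_simps)
    also have "\<dots> = (c t k - w k) - \<i> * (integral {0..\<tau>} (\<lambda>s. disp (- s) k * G (t + s) k) - integral {0..\<tau>} (\<lambda>s. cubic (band_kernel N s) w k))"
      unfolding twisted_duhamel[OF t] disp_add by (simp add: algebra_simps)
    also have "integral {0..\<tau>} (\<lambda>s. disp (- s) k * G (t + s) k) - integral {0..\<tau>} (\<lambda>s. cubic (band_kernel N s) w k) = integral {0..\<tau>} (F k)"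
      unfolding F_def by (rule integral_diff[symmetric])
        (intro integrable_continuous_interval continuous_on_shifted_G[OF t(1,3)] flow_modes_integral(2)[OF t(2) kK[OF k]])+
    finally have "norm (disp (- \<tau>) k * (c (t + \<tau>) k - flow_modes \<tau> N w k)) = norm ((c t k - w k) - \<i> * integral {0..\<tau>} (F k))" by simp
    also have "\<dots> \<le> norm (c t k - w k) + norm (\<i> * integral {0..\<tau>} (F k))" by (rule norm_triangle_ineq4)
    finally show ?thesis by (simp add: norm_mult)
  qed
  have lw: "l1 w" by (rule l1_band_limited) (rule w, assumption)
  have wR: "l1_norm w \<le> R"
  proof -
    have "l1_norm w = (\<Sum>\<^sub>\<infinity>k\<in>{- int N..int N}. norm (w k))"
      by (rule infsum_cong_neutral) (use w(1) in \<open>auto simp: not_le abs_le_iff\<close>)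
    then show ?thesis using w(2) by simp
  qed
  have cR: "l1_norm (band_cut N (c t)) \<le> R"
    using sum_cut_le[OF l1_c[OF tT], of N] l1_bound_c[OF tT] w(3) by linarith
  have cd: "l1_norm (\<lambda>k. band_cut N (c t) k - w k) = (\<Sum>k\<in>K. norm (c t k - w k))"
    "sqrt (\<Sum>\<^sub>\<infinity>k. (norm (band_cut N (c t) k - w k))\<^sup>2) = L2_set (\<lambda>k. norm (c t k - w k)) K"
    unfolding K_def by (rule sum_cut_diff, rule w(1), assumption)+
  have Td: "(\<Sum>k\<in>K. norm (cubic (band_kernel N s) (c t) k - cubic (band_kernel N s) w k)) \<le> 9 * R\<^sup>2 * (\<Sum>k\<in>K. norm (c t k - w k))"
    "L2_set (\<lambda>k. norm (cubic (band_kernel N s) (c t) k - cubic (band_kernel N s) w k)) K \<le> 9 * R\<^sup>2 * L2_set (\<lambda>k. norm (c t k - w k)) K" for s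
    using cubic_diff[where f = "band_cut N (c t)" and g = w and \<kappa> = "band_kernel N s" and B = 3 and R = R and K = K,
        OF l1_cut cR lw wR norm_band_kernel K]
    unfolding cd cubic_band_cut by simp_all
  have split: "norm (F k s) \<le> norm (disp (- s) k * G (t + s) k - cubic (phase s) (c t) k) +
     norm (cubic (phase s) (c t) k - cubic (band_kernel N s) (c t) k) + norm (cubic (band_kernel N s) (c t) k - cubic (band_kernel N s) w k)" for k s
    unfolding F_def by (rule order_trans[OF _ add_mono[OF norm_triangle_ineq order_refl]], rule order_trans[OF _ norm_triangle_ineq]) simp
  {
    assume d: "\<And>s. s \<in> {0..\<tau>} \<Longrightarrow> (\<Sum>k\<in>K. norm (cubic (phase s) (c t) k - cubic (band_kernel N s) (c t) k)) \<le> \<delta>"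
    let ?E = "\<Sum>k\<in>K. norm (c t k - w k)"
    have "(\<Sum>k\<in>K. norm (integral {0..\<tau>} (F k))) \<le> \<tau> * (3 * R0 ^ 5 * \<tau> + \<delta> + 9 * R\<^sup>2 * ?E)"
    proof (rule sum_norm_integral_le[OF K t(2) cF])
      fix s assume s: "s \<in> {0..\<tau>}"
      have "(\<Sum>k\<in>K. norm (F k s)) \<le> (\<Sum>k\<in>K. norm (disp (- s) k * G (t + s) k - cubic (phase s) (c t) k)) +
         (\<Sum>k\<in>K. norm (cubic (phase s) (c t) k - cubic (band_kernel N s) (c t) k)) + (\<Sum>k\<in>K. norm (cubic (band_kernel N s) (c t) k - cubic (band_kernel N s) w k))"
        unfolding sum.distrib[symmetric] by (intro sum_mono split)
      also have "\<dots> \<le> 3 * R0 ^ 5 * \<tau> + \<delta> + 9 * R\<^sup>2 * ?E"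
        using s t Td(1)[of s] by (intro add_mono freezing_error d K) auto
      finally show "(\<Sum>k\<in>K. norm (F k s)) \<le> 3 * R0 ^ 5 * \<tau> + \<delta> + 9 * R\<^sup>2 * ?E" .
    qed
    moreover have "(\<Sum>k\<in>K. norm (c (t + \<tau>) k - flow_modes \<tau> N w k)) \<le> ?E + (\<Sum>k\<in>K. norm (integral {0..\<tau>} (F k)))"
      unfolding sum.distrib[symmetric] by (intro sum_mono err)
    ultimately show "(\<Sum>k\<in>K. norm (c (t + \<tau>) k - flow_modes \<tau> N w k)) \<le> (1 + 9 * R\<^sup>2 * \<tau>) * ?E + \<tau> * (3 * R0 ^ 5 * \<tau> + \<delta>)"
      by (simp add: algebra_simps)
  }
  {
    assume d: "\<And>s. s \<in> {0..\<tau>} \<Longrightarrow> L2_set (\<lambda>k. norm (cubic (phase s) (c t) k - cubic (band_kernel N s) (c t) k)) K \<le> \<delta>"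
    let ?E = "L2_set (\<lambda>k. norm (c t k - w k)) K"
    have "L2_set (\<lambda>k. norm (integral {0..\<tau>} (F k))) K \<le> \<tau> * (3 * R0 ^ 5 * \<tau> + \<delta> + 9 * R\<^sup>2 * ?E)"
    proof (rule L2_set_norm_integral_le[OF K t(2) cF])
      fix s assume s: "s \<in> {0..\<tau>}"
      have "L2_set (\<lambda>k. norm (F k s)) K \<le> L2_set (\<lambda>k. norm (disp (- s) k * G (t + s) k - cubic (phase s) (c t) k) +
         norm (cubic (phase s) (c t) k - cubic (band_kernel N s) (c t) k) + norm (cubic (band_kernel N s) (c t) k - cubic (band_kernel N s) w k)) K"
        by (intro L2_set_mono split) auto
      also have "\<dots> \<le> 3 * R0 ^ 5 * \<tau> + \<delta> + 9 * R\<^sup>2 * ?E"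
      proof (intro order_trans[OF L2_set_triangle_ineq] add_mono d s)
        have "L2_set (\<lambda>k. norm (disp (- s) k * G (t + s) k - cubic (phase s) (c t) k)) K \<le> (\<Sum>k\<in>K. norm (disp (- s) k * G (t + s) k - cubic (phase s) (c t) k))"
          by (rule L2_set_le_sum) auto
        also have "\<dots> \<le> 3 * R0 ^ 5 * \<tau>" using s t by (intro freezing_error K) auto
        finally show "L2_set (\<lambda>k. norm (disp (- s) k * G (t + s) k - cubic (phase s) (c t) k)) K \<le> 3 * R0 ^ 5 * \<tau>" .
        show "L2_set (\<lambda>k. norm (cubic (band_kernel N s) (c t) k - cubic (band_kernel N s) w k)) K \<le> 9 * R\<^sup>2 * ?E"
          using Td(2)[of s] by simp
      qed
      finally show "L2_set (\<lambda>k. norm (F k s)) K \<le> 3 * R0 ^ 5 * \<tau> + \<delta> + 9 * R\<^sup>2 * ?E" .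
    qed
    moreover have "L2_set (\<lambda>k. norm (c (t + \<tau>) k - flow_modes \<tau> N w k)) K \<le> ?E + L2_set (\<lambda>k. norm (integral {0..\<tau>} (F k))) K"
      by (rule order_trans[OF L2_set_mono[OF err] L2_set_triangle_ineq]) auto
    ultimately show "L2_set (\<lambda>k. norm (c (t + \<tau>) k - flow_modes \<tau> N w k)) K \<le> (1 + 9 * R\<^sup>2 * \<tau>) * ?E + \<tau> * (3 * R0 ^ 5 * \<tau> + \<delta>)"
      by (simp add: algebra_simps)
  }
qed

end

section \<open>Trigonometric interpolation\<close>

text \<open>With the index shifted by \<open>M\<close> the sum is geometric. Its ratio
  \<open>z\<close> is a root of unity of order dividing 2 M + 1, so the sum vanishes unless
  \<open>z = 1\<close>.\<close>

lemma wave_sum_roots: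
  "(\<Sum>n = - int M..int M. wave j (2 * pi * of_int n / (2 * real M + 1))) = (if (2 * int M + 1) dvd j then of_nat (2 * M + 1) else 0)"
proof -
  define L where "L = 2 * M + 1"
  have L: "L > 0" "real L = 2 * real M + 1" "int L = 2 * int M + 1" by (simp_all add: L_def)
  define z where "z = cis (2 * pi * of_int j / real L)"
  have pw: "wave j (2 * pi * of_int (int p - int M) / real L) = wave j (- (2 * pi * real M / real L)) * z ^ p" for p
    unfolding z_def Complex.DeMoivre wave_cis cis_mult using L by (simp add: field_simps)
  have "(\<Sum>n = - int M..int M. wave j (2 * pi * of_int n / real L)) = (\<Sum>p<L. wave j (2 * pi * of_int (int p - int M) / real L))"
    by (rule sum.reindex_bij_witness[of _ "\<lambda>p. int p - int M" "\<lambda>n. nat (n + int M)"]) (auto simp: L_def)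
  also have "\<dots> = wave j (- (2 * pi * real M / real L)) * (\<Sum>p<L. z ^ p)"
    by (simp only: pw sum_distrib_left)
  finally have eq: "(\<Sum>n = - int M..int M. wave j (2 * pi * of_int n / real L)) = wave j (- (2 * pi * real M / real L)) * (\<Sum>p<L. z ^ p)" .
  have zL: "z ^ L = 1"
  proof -
    have "real L * (2 * pi * of_int j / real L) = 2 * pi * of_int j" using L by simp
    then show ?thesis unfolding z_def Complex.DeMoivre by (simp only: cis_multiple_2pi Ints_of_int)
  qed
  show ?thesis
  proof (cases "(2 * int M + 1) dvd j")
    case True
    then obtain r where r: "j = int L * r" by (auto simp: L(3) dvd_def)
    have "wave j (2 * pi * of_int n / real L) = 1" for n
    proof -
      have "of_int j * (2 * pi * of_int n / real L) = 2 * pi * of_int (r * n)" using L(1) by (simp add: r)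
      then show ?thesis unfolding wave_cis by (simp only: cis_multiple_2pi Ints_of_int)
    qed
    then show ?thesis using True by (simp add: L(2)[symmetric])
  next
    case False
    have "z \<noteq> 1"
    proof
      assume "z = 1"
      then have "exp (\<i> * of_real (2 * pi * of_int j / real L)) = 1" by (simp add: z_def cis_conv_exp)
      then obtain n :: int where "2 * pi * of_int j / real L = of_int (2 * n) * pi" by (auto simp: exp_eq_1)
      then have "real_of_int j = of_int n * real L" using L(1) by (simp add: field_simps)
      then have "j = n * int L" by (metis of_int_eq_iff of_int_mult of_int_of_nat_eq)
      then show False using False by (simp add: L(3))
    qed
    then have "(\<Sum>p<L. z ^ p) = 0" using zL by (simp add: geometric_sum)
    then show ?thesis using eq False by (simp add: L(2)[symmetric])
  qed
qed

lemma has_sum_finite_sum: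
  fixes f :: "'a \<Rightarrow> 'b \<Rightarrow> complex"
  assumes "finite F" "\<And>i. i \<in> F \<Longrightarrow> (f i has_sum s i) A"
  shows "((\<lambda>x. \<Sum>i\<in>F. f i x) has_sum (\<Sum>i\<in>F. s i)) A"
  using assms by (induction F rule: finite_induct) (auto intro: has_sum_add)

text \<open>On 4 N + 1 nodes, frequencies congruent modulo 4 N + 1 cannot be told apart, so the
  coefficient of the interpolant at \<open>k\<close> is the sum over the residue class of
  \<open>k\<close>.\<close>

definition alias_modes :: "nat \<Rightarrow> (int \<Rightarrow> complex) \<Rightarrow> int \<Rightarrow> complex" where
  "alias_modes N c = band_cut N (\<lambda>k. \<Sum>\<^sub>\<infinity>m\<in>{m. (4 * int N + 1) dvd (m - k)}. c m)"

lemma FS_finite: "FS (band_cut M a) x = (\<Sum>k = - int M..int M. a k * wave k x)"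
proof -
  have "FS (band_cut M a) x = (\<Sum>\<^sub>\<infinity>k\<in>{- int M..int M}. a k * wave k x)"
    unfolding FS_def by (rule infsum_cong_neutral) (auto simp: band_cut_def)
  then show ?thesis by simp
qed

text \<open>The finite sum over the nodes is exchanged with the absolutely convergent Fourier
  series, and \<open>wave_sum_roots\<close> leaves the frequencies congruent to
  \<open>k\<close>.\<close>

lemma interpolation_modes:
  assumes f: "f \<in> torus_Hs s" "s > 1/2"
  shows "low_pass N (trig_interp (2 * N) f) = FS (alias_modes N (fourier_coeff f))"
proof -
  let ?c = "fourier_coeff f" and ?L = "4 * int N + 1"
  have c: "l1 ?c" by (rule torus_Hs_l1[OF f])
  define x where "x n = 2 * pi * of_int n / (2 * real (2 * N) + 1)" for n :: int
  define a where "a k = 1 / (2 * of_nat (2 * N) + 1) * (\<Sum>n = - int (2 * N)..int (2 * N). wave (- k) (x n) * FS ?c (x n))" for k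
  have "trig_interp (2 * N) f = FS (band_cut (2 * N) a)"
  proof
    fix y
    have "wave (- k) z = exp (- (\<i> * of_int k * of_real z))" for k z by (simp add: wave_def)
    then show "trig_interp (2 * N) f y = FS (band_cut (2 * N) a) y"
      unfolding FS_finite trig_interp_def continuous_rep_torus_Hs[OF f] Let_def a_def x_def
      by (intro sum.cong refl) (simp only: mult.commute[of _ "wave _ y"], simp add: wave_def mult_ac)
  qed
  then have "low_pass N (trig_interp (2 * N) f) = FS (band_cut N (band_cut (2 * N) a))"
    by (simp add: operators_FS)
  moreover have "band_cut N (band_cut (2 * N) a) = alias_modes N ?c"
  proof -
    have "a k = (\<Sum>\<^sub>\<infinity>m\<in>{m. ?L dvd (m - k)}. ?c m)" for k
    proof -
      have h: "((\<lambda>m. wave (- k) (x n) * (?c m * wave m (x n))) has_sum (wave (- k) (x n) * FS ?c (x n))) UNIV" for n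
        unfolding FS_def by (intro has_sum_cmult_right has_sum_infsum FS_summable(2)[OF c])
      have "((\<lambda>m. \<Sum>n = - int (2 * N)..int (2 * N). wave (- k) (x n) * (?c m * wave m (x n))) has_sum
         (\<Sum>n = - int (2 * N)..int (2 * N). wave (- k) (x n) * FS ?c (x n))) UNIV"
        by (rule has_sum_finite_sum) (simp, rule h)
      from has_sum_cmult_right[OF this, of "1 / (2 * of_nat (2 * N) + 1)"]
      have "((\<lambda>m. 1 / (2 * of_nat (2 * N) + 1) * (\<Sum>n = - int (2 * N)..int (2 * N). wave (- k) (x n) * (?c m * wave m (x n)))) has_sum a k) UNIV"
        by (simp only: a_def)
      moreover have "1 / (2 * of_nat (2 * N) + 1) * (\<Sum>n = - int (2 * N)..int (2 * N). wave (- k) (x n) * (?c m * wave m (x n)))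
         = (if ?L dvd (m - k) then ?c m else 0)" for m
      proof -
        have "(\<Sum>n = - int (2 * N)..int (2 * N). wave (- k) (x n) * (?c m * wave m (x n))) =
            ?c m * (\<Sum>n = - int (2 * N)..int (2 * N). wave (m - k) (x n))"
          unfolding sum_distrib_left
        proof (rule sum.cong[OF refl])
          fix n show "wave (- k) (x n) * (?c m * wave m (x n)) = ?c m * wave (m - k) (x n)"
            using wave_mult[of m "x n" "- k"] by (simp add: mult_ac)
        qed
        moreover have nz: "2 * of_nat (2 * N) + 1 = complex_of_nat (2 * (2 * N) + 1)" "complex_of_nat (2 * (2 * N) + 1) \<noteq> 0"
          by (simp, rule of_nat_neq_0[of "2 * (2 * N)", unfolded Suc_eq_plus1])
        moreover have "(\<Sum>n = - int (2 * N)..int (2 * N). wave (m - k) (x n)) = (if ?L dvd (m - k) then of_nat (2 * (2 * N) + 1) else 0)"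
          using wave_sum_roots[where M = "2 * N" and j = "m - k"] by (simp add: x_def)
        ultimately show ?thesis
          by (simp only: nz(1)) (use nz(2) in \<open>simp del: of_nat_Suc of_nat_add of_nat_mult\<close>)
      qed
      ultimately have "((\<lambda>m. if ?L dvd (m - k) then ?c m else 0) has_sum a k) UNIV" by simp
      then have "a k = (\<Sum>\<^sub>\<infinity>m. if ?L dvd (m - k) then ?c m else 0)" by (simp add: infsumI)
      also have "\<dots> = (\<Sum>\<^sub>\<infinity>m\<in>{m. ?L dvd (m - k)}. ?c m)"
        by (rule infsum_cong_neutral) auto
      finally show ?thesis .
    qed
    then show ?thesis by (auto simp: alias_modes_def band_cut_def)
  qed
  ultimately show ?thesis by simp
qed

text \<open>Two frequencies in the band differ by at most 2 N < 4 N + 1. Sums over the residue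
  classes of all \<open>k\<close> in the band are therefore bounded by one sum over all
  frequencies.\<close>

lemma alias_classes_disjoint:
  assumes "k \<in> {- int N..int N}" "k' \<in> {- int N..int N}" "(4 * int N + 1) dvd (m - k)" "(4 * int N + 1) dvd (m - k')"
  shows "k = k'"
proof (rule ccontr)
  assume "k \<noteq> k'"
  have "(4 * int N + 1) dvd (k' - k)" using dvd_diff[OF assms(3,4)] by simp
  then have "4 * int N + 1 \<le> \<bar>k' - k\<bar>" using \<open>k \<noteq> k'\<close> zdvd_imp_le[of "4 * int N + 1" "\<bar>k' - k\<bar>"] by simp
  then show False using assms(1,2) by auto
qed

lemma alias_l1:
  fixes c :: "int \<Rightarrow> complex"
  assumes c: "l1 c"
  shows "band_l1 N (alias_modes N c) \<le> l1_norm c"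
proof -
  let ?A = "\<lambda>k. {m. (4 * int N + 1) dvd (m - k)}"
  have s: "(\<lambda>m. norm (c m)) summable_on A" for A using c summable_on_subset_banach by blast
  have "band_l1 N (alias_modes N c) \<le> (\<Sum>k\<in>{- int N..int N}. \<Sum>\<^sub>\<infinity>m\<in>?A k. norm (c m))"
    by (intro sum_mono) (auto simp: alias_modes_def band_cut_def intro!: norm_infsum_bound s)
  also have "\<dots> = (\<Sum>\<^sub>\<infinity>m\<in>(\<Union>k\<in>{- int N..int N}. ?A k). norm (c m))"
    by (rule sum_infsum) (use s alias_classes_disjoint in auto)
  also have "\<dots> \<le> l1_norm c"
    by (rule infsum_mono2[OF s s]) auto
  finally show ?thesis .
qed

lemma alias_error:
  fixes c :: "int \<Rightarrow> complex"
  assumes c: "l1 c" and k: "k \<in> {- int N..int N}"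
  shows "norm (c k - alias_modes N c k) \<le> (\<Sum>\<^sub>\<infinity>m\<in>{m. (4 * int N + 1) dvd (m - k)} - {k}. norm (c m))"
proof -
  let ?A = "{m. (4 * int N + 1) dvd (m - k)}"
  have s: "c summable_on A" "(\<lambda>m. norm (c m)) summable_on A" for A
    using c summable_on_subset_banach abs_summable_summable[OF c] by blast+
  have "infsum c ?A = infsum c (insert k (?A - {k}))" by (rule arg_cong[where f = "infsum c"]) auto
  also have "\<dots> = c k + infsum c (?A - {k})" by (subst infsum_insert) (auto intro: s)
  finally have "c k - alias_modes N c k = - infsum c (?A - {k})"
    using k by (auto simp: alias_modes_def band_cut_def)
  then show ?thesis using norm_infsum_bound[OF s(2), of "?A - {k}"] by simp
qed

text \<open>The other members of the residue class are at distance at least 4 N + 1 from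
  \<open>k\<close>, so the aliased frequencies all come from outside the band.\<close>

lemma alias_tail:
  assumes "k \<in> {- int N..int N}" "m \<in> {m. (4 * int N + 1) dvd (m - k)} - {k}"
  shows "\<bar>m\<bar> > int N"
proof -
  have "4 * int N + 1 \<le> \<bar>m - k\<bar>" using assms(2) zdvd_imp_le[of "4 * int N + 1" "\<bar>m - k\<bar>"] by auto
  then show ?thesis using assms(1) by auto
qed

lemma tail_weight:
  assumes "\<bar>m\<bar> > int N" "N \<ge> 1" "a \<ge> 0"
  shows "1 \<le> real N powr (- 2 * a) * W m powr a"
proof -
  have "real N \<le> \<bar>real_of_int m\<bar>" using assms(1) by linarith
  then have "(real N)\<^sup>2 \<le> \<bar>real_of_int m\<bar>\<^sup>2" by (rule power_mono) simp
  then have "((real N)\<^sup>2) powr a \<le> W m powr a" using assms by (intro powr_mono2) auto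
  then have "real N powr (2 * a) \<le> W m powr a" using assms by (simp add: powr_powr flip: powr_numeral)
  then have "real N powr (- 2 * a) * real N powr (2 * a) \<le> real N powr (- 2 * a) * W m powr a"
    by (intro mult_left_mono) auto
  then show ?thesis using assms by (simp flip: powr_add)
qed

text \<open>Aliased frequencies lie outside the band, where the factor of
  \<open>tail_weight\<close>, at least 1, can be inserted under the sum. Disjointness of the classes
  prevents any multiplicity.\<close>

lemma alias_error_l1:
  fixes c :: "int \<Rightarrow> complex"
  assumes c: "l1 c" and g: "(\<lambda>k. W k powr \<eta> * norm (c k)) summable_on UNIV" and N: "N \<ge> 1" and \<eta>: "\<eta> \<ge> 0"
  shows "band_l1 N (\<lambda>k. c k - alias_modes N c k) \<le> real N powr (- 2 * \<eta>) * (\<Sum>\<^sub>\<infinity>k. W k powr \<eta> * norm (c k))"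
proof -
  let ?A = "\<lambda>k. {m. (4 * int N + 1) dvd (m - k)} - {k}"
  have s: "(\<lambda>m. norm (c m)) summable_on A" for A using c summable_on_subset_banach by blast
  have gs: "(\<lambda>m. real N powr (- 2 * \<eta>) * (W m powr \<eta> * norm (c m))) summable_on A" for A
    using g by (intro summable_on_cmult_right) (rule summable_on_subset_banach, auto)
  have "band_l1 N (\<lambda>k. c k - alias_modes N c k) \<le> (\<Sum>k\<in>{- int N..int N}. \<Sum>\<^sub>\<infinity>m\<in>?A k. norm (c m))"
    by (intro sum_mono alias_error c)
  also have "\<dots> = (\<Sum>\<^sub>\<infinity>m\<in>(\<Union>k\<in>{- int N..int N}. ?A k). norm (c m))"
    by (rule sum_infsum) (use s alias_classes_disjoint in auto)
  also have "\<dots> \<le> (\<Sum>\<^sub>\<infinity>m\<in>(\<Union>k\<in>{- int N..int N}. ?A k). real N powr (- 2 * \<eta>) * (W m powr \<eta> * norm (c m)))"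
  proof (rule infsum_mono[OF s gs])
    fix m assume "m \<in> (\<Union>k\<in>{- int N..int N}. ?A k)"
    then have "1 \<le> real N powr (- 2 * \<eta>) * W m powr \<eta>" using alias_tail tail_weight[OF _ N \<eta>] by blast
    from mult_right_mono[OF this, of "norm (c m)"]
    show "norm (c m) \<le> real N powr (- 2 * \<eta>) * (W m powr \<eta> * norm (c m))" by (simp add: mult.assoc)
  qed
  also have "\<dots> \<le> (\<Sum>\<^sub>\<infinity>m. real N powr (- 2 * \<eta>) * (W m powr \<eta> * norm (c m)))"
    by (rule infsum_mono2[OF gs gs]) auto
  finally show ?thesis by (simp add: infsum_cmult_right')
qed

text \<open>The class of \<open>k\<close> without \<open>k\<close> itself is an arithmetic
  progression with steps of order N, so the sum of its weights gains N to the power -2 \<gamma> over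
  the full sum, uniformly in \<open>k\<close>.\<close>

lemma alias_kernel:
  assumes k: "k \<in> {- int N..int N}" and N: "N \<ge> 1" and \<gamma>: "\<gamma> > 1/2"
  shows "(\<Sum>\<^sub>\<infinity>m\<in>{m. (4 * int N + 1) dvd (m - k)} - {k}. W m powr (- \<gamma>)) \<le> real N powr (- 2 * \<gamma>) * W_sum \<gamma>"
proof -
  let ?L = "4 * int N + 1"
  have sW: "(\<lambda>k::int. W k powr (- \<gamma>)) summable_on A" for A
    using summable_W[OF \<gamma>] summable_on_subset_banach by blast
  have "(\<Sum>\<^sub>\<infinity>m\<in>{m. ?L dvd (m - k)} - {k}. W m powr (- \<gamma>)) = (\<Sum>\<^sub>\<infinity>j\<in>- {0}. W (k + ?L * j) powr (- \<gamma>))"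
    by (rule infsum_reindex_bij_witness[of _ "\<lambda>j. k + ?L * j" "\<lambda>m. (m - k) div ?L"]) auto
  also have "\<dots> \<le> (\<Sum>\<^sub>\<infinity>j\<in>- {0}. real N powr (- 2 * \<gamma>) * W j powr (- \<gamma>))"
  proof (rule infsum_mono)
    have "(\<lambda>m. W m powr (- \<gamma>)) summable_on ({m. ?L dvd (m - k)} - {k})" by (rule sW)
    also have "?this \<longleftrightarrow> (\<lambda>j. W (k + ?L * j) powr (- \<gamma>)) summable_on (- {0})"
      by (rule summable_on_reindex_bij_witness[of _ "\<lambda>j. k + ?L * j" "\<lambda>m. (m - k) div ?L"]) auto
    finally show "(\<lambda>j. W (k + ?L * j) powr (- \<gamma>)) summable_on (- {0})" .
    show "(\<lambda>j. real N powr (- 2 * \<gamma>) * W j powr (- \<gamma>)) summable_on (- {0})" by (intro summable_on_cmult_right sW)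
    fix j :: int assume j: "j \<in> - {0}"
    \<comment> \<open>The shift by \<open>k\<close> is at most \<open>int N * \<bar>j\<bar>\<close>
      in modulus, which leaves three of the four multiples.\<close>
    have "3 * int N * \<bar>j\<bar> \<le> \<bar>k + ?L * j\<bar>"
    proof -
      have "?L * \<bar>j\<bar> = \<bar>?L * j\<bar>" by (simp add: abs_mult)
      moreover have "int N * 1 \<le> int N * \<bar>j\<bar>" using j by (intro mult_left_mono) auto
      moreover have "\<bar>k\<bar> \<le> int N" using k by auto
      ultimately show ?thesis by (simp add: algebra_simps)
    qed
    then have "real_of_int (3 * int N * \<bar>j\<bar>) \<le> real_of_int \<bar>k + ?L * j\<bar>" by (simp only: of_int_le_iff)
    then have "(3 * real N * \<bar>real_of_int j\<bar>)\<^sup>2 \<le> (real_of_int \<bar>k + ?L * j\<bar>)\<^sup>2" by (intro power_mono) auto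
    then have a: "9 * (real N)\<^sup>2 * (real_of_int j)\<^sup>2 \<le> (real_of_int (k + ?L * j))\<^sup>2" by (simp add: power_mult_distrib)
    have "1 \<le> \<bar>j\<bar>" using j by auto
    then have "1 \<le> \<bar>real_of_int j\<bar>" by linarith
    then have "1\<^sup>2 \<le> \<bar>real_of_int j\<bar>\<^sup>2" by (rule power_mono) simp
    then have "1 \<le> (real_of_int j)\<^sup>2" by simp
    \<comment> \<open>As \<open>j\<close> is nonzero, 1 + j^2 \<le> 9 j^2.\<close>
    then have "(real N)\<^sup>2 * W j \<le> (real N)\<^sup>2 * (9 * (real_of_int j)\<^sup>2)" by (intro mult_left_mono) auto
    then have "(real N)\<^sup>2 * W j \<le> W (k + ?L * j)" using a by linarith
    then have "W (k + ?L * j) powr (- \<gamma>) \<le> ((real N)\<^sup>2 * W j) powr (- \<gamma>)"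
      using N \<gamma> by (intro powr_mono2') auto
    also have "\<dots> = ((real N)\<^sup>2) powr (- \<gamma>) * W j powr (- \<gamma>)" by (rule powr_mult)
    also have "((real N)\<^sup>2) powr (- \<gamma>) = real N powr (- 2 * \<gamma>)" using N by (simp add: powr_powr flip: powr_numeral)
    finally show "W (k + ?L * j) powr (- \<gamma>) \<le> real N powr (- 2 * \<gamma>) * W j powr (- \<gamma>)" .
  qed
  also have "\<dots> = real N powr (- 2 * \<gamma>) * (\<Sum>\<^sub>\<infinity>j\<in>- {0}. W j powr (- \<gamma>))" by (rule infsum_cmult_right')
  also have "\<dots> \<le> real N powr (- 2 * \<gamma>) * W_sum \<gamma>"
    by (intro mult_left_mono infsum_mono2 sW) auto
  finally show ?thesis .
qed

text \<open>Cauchy-Schwarz inside each residue class: the weights are summed by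
  \<open>alias_kernel\<close>, and the weighted squares add up over the disjoint classes to at most
  the Sobolev sum. This keeps the full rate N to the power -\<gamma>.\<close>

lemma alias_error_l2:
  fixes c :: "int \<Rightarrow> complex"
  assumes c: "l1 c" and N: "N \<ge> 1" and \<gamma>: "\<gamma> > 1/2"
    and w: "sobolev_summable \<gamma> c" "sobolev_sum \<gamma> c \<le> m\<^sup>2" "m \<ge> 0"
  shows "band_l2 N (\<lambda>k. c k - alias_modes N c k) \<le> real N powr (- \<gamma>) * (sqrt (W_sum \<gamma>) * m)"
proof -
  let ?A = "\<lambda>k. {m. (4 * int N + 1) dvd (m - k)} - {k}"
  define Z where "Z = W_sum \<gamma>"
  have Z: "Z \<ge> 0" unfolding Z_def by (intro infsum_nonneg) auto
  have ws: "(\<lambda>k. W k powr \<gamma> * (norm (c k))\<^sup>2) summable_on A" for A using w(1) summable_on_subset_banach by blast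
  have sq: "(W k powr t)\<^sup>2 = W k powr (2 * t)" for k :: int and t :: real
    by (simp add: power2_eq_square flip: powr_add)
  have 1: "(\<lambda>k::int. (W k powr (- \<gamma>/2))\<^sup>2) summable_on A" for A
    using summable_W[OF \<gamma>] by (simp add: sq) (rule summable_on_subset_banach, auto)
  have 2: "(\<lambda>k::int. (W k powr (\<gamma>/2) * norm (c k))\<^sup>2) summable_on A" for A
    using ws by (simp add: sq power_mult_distrib)
  have e: "W k powr (- \<gamma>/2) * (W k powr (\<gamma>/2) * norm (c k)) = norm (c k)" for k :: int
    using less_imp_neq[OF W_pos[of k]] by (simp add: mult.assoc[symmetric] flip: powr_add)
  note CS = infsum_Cauchy_Schwarz(2)[OF 1 2, unfolded e]
  have pt: "(norm (c k - alias_modes N c k))\<^sup>2 \<le> real N powr (- 2 * \<gamma>) * Z * (\<Sum>\<^sub>\<infinity>m\<in>?A k. W m powr \<gamma> * (norm (c m))\<^sup>2)"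
    if k: "k \<in> {- int N..int N}" for k
  proof -
    have "(norm (c k - alias_modes N c k))\<^sup>2 \<le> (\<Sum>\<^sub>\<infinity>m\<in>?A k. norm (c m))\<^sup>2"
      by (intro power_mono alias_error c k) auto
    also have "\<dots> \<le> (\<Sum>\<^sub>\<infinity>m\<in>?A k. W m powr (- \<gamma>)) * (\<Sum>\<^sub>\<infinity>m\<in>?A k. W m powr \<gamma> * (norm (c m))\<^sup>2)"
      using CS[of "?A k"] by (simp add: sq power_mult_distrib)
    also have "\<dots> \<le> (real N powr (- 2 * \<gamma>) * Z) * (\<Sum>\<^sub>\<infinity>m\<in>?A k. W m powr \<gamma> * (norm (c m))\<^sup>2)"
      unfolding Z_def by (intro mult_right_mono alias_kernel k N \<gamma> infsum_nonneg) auto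
    finally show ?thesis .
  qed
  have "(\<Sum>k\<in>{- int N..int N}. (norm (c k - alias_modes N c k))\<^sup>2) \<le>
     (\<Sum>k\<in>{- int N..int N}. real N powr (- 2 * \<gamma>) * Z * (\<Sum>\<^sub>\<infinity>m\<in>?A k. W m powr \<gamma> * (norm (c m))\<^sup>2))"
    by (intro sum_mono pt)
  also have "\<dots> = real N powr (- 2 * \<gamma>) * Z * (\<Sum>k\<in>{- int N..int N}. \<Sum>\<^sub>\<infinity>m\<in>?A k. W m powr \<gamma> * (norm (c m))\<^sup>2)"
    by (rule sum_distrib_left[symmetric])
  also have "(\<Sum>k\<in>{- int N..int N}. \<Sum>\<^sub>\<infinity>m\<in>?A k. W m powr \<gamma> * (norm (c m))\<^sup>2) = (\<Sum>\<^sub>\<infinity>m\<in>(\<Union>k\<in>{- int N..int N}. ?A k). W m powr \<gamma> * (norm (c m))\<^sup>2)"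
    by (rule sum_infsum) (use ws alias_classes_disjoint in auto)
  also have "real N powr (- 2 * \<gamma>) * Z * (\<Sum>\<^sub>\<infinity>m\<in>(\<Union>k\<in>{- int N..int N}. ?A k). W m powr \<gamma> * (norm (c m))\<^sup>2) \<le> real N powr (- 2 * \<gamma>) * Z * m\<^sup>2"
    using Z by (intro mult_left_mono order_trans[OF infsum_mono2[OF ws ws] w(2)]) auto
  also have "\<dots> = (real N powr (- \<gamma>) * (sqrt Z * m))\<^sup>2"
    using Z by (simp add: power_mult_distrib power2_eq_square[of "_ powr _"] flip: powr_add)
  finally have "sqrt (\<Sum>k\<in>{- int N..int N}. (norm (c k - alias_modes N c k))\<^sup>2) \<le> \<bar>real N powr (- \<gamma>) * (sqrt Z * m)\<bar>"
    using real_sqrt_le_mono by fastforce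
  then show ?thesis using Z w(3) by (simp add: L2_set_def Z_def)
qed

section \<open>Almost conservation of mass\<close>

text \<open>
  The sum runs over quadruples with \<open>k + k' = j + l\<close>, and exchanging \<open>(k, k')\<close> with \<open>(j, l)\<close>
  conjugates each term.
\<close>

lemma cubic_mass_real:
  fixes w :: "int \<Rightarrow> complex"
  shows "Im (\<Sum>k\<in>{- int N..int N}. cnj (w k) * cubic (band_kernel N 0) w k) = 0"
proof -
  let ?B = "{- int N..int N}"
  define Q where "Q = {(k,k',j,l). \<bar>k\<bar> \<le> int N \<and> \<bar>k'\<bar> \<le> int N \<and> \<bar>j\<bar> \<le> int N \<and> \<bar>l\<bar> \<le> int N \<and> \<bar>j + l\<bar> \<le> int N \<and> k + k' = j + l}"
  define F where "F = (\<lambda>(k,k',j,l). cnj (w k) * cnj (w k') * w j * w l)"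
  have one: "band_kernel N 0 q * cubic_term w q = cubic_term w q" if "q \<in> band_triples N k" for q k
    using that by (auto simp: band_kernel_def in_band_def band_triples_def)
  have "(\<Sum>k\<in>?B. cnj (w k) * cubic (band_kernel N 0) w k) = (\<Sum>k\<in>?B. \<Sum>q\<in>band_triples N k. cnj (w k) * cubic_term w q)"
    unfolding cubic_band_kernel by (simp add: one sum_distrib_left cong: sum.cong)
  also have "\<dots> = (\<Sum>(k,q)\<in>Sigma ?B (band_triples N). cnj (w k) * cubic_term w q)"
    by (rule sum.Sigma) auto
  also have "\<dots> = sum F Q"
    by (rule sum.reindex_bij_witness[of _ "\<lambda>(k,k',j,l). (k, - k', j, l)" "\<lambda>(k,i,j,l). (k, - i, j, l)"])
      (auto simp: Q_def F_def band_triples_def cubic_term_def abs_le_iff)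
  finally have S: "(\<Sum>k\<in>?B. cnj (w k) * cubic (band_kernel N 0) w k) = sum F Q" .
  have "sum F Q = (\<Sum>q\<in>Q. cnj (F q))"
    by (rule sum.reindex_bij_witness[of _ "\<lambda>(k,k',j,l). (j,l,k,k')" "\<lambda>(k,k',j,l). (j,l,k,k')"])
      (auto simp: Q_def F_def)
  then have "sum F Q = cnj (sum F Q)" by simp
  moreover have "Im z = 0" if "z = cnj z" for z
    using arg_cong[OF that, of Im] by simp
  ultimately show ?thesis unfolding S by blast
qed

text \<open>At fixed N all phases are at most of size s N^2, so the kernel is Lipschitz in time. The
  constant grows with N, which is harmless as long as only finitely many N are treated this
  way.\<close>

lemma band_kernel_increment:
  assumes "0 \<le> s"
  shows "norm (band_kernel N s q - band_kernel N 0 q) \<le> 16 * s * (real N)\<^sup>2"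
proof (cases "in_band N q")
  case False
  then show ?thesis using assms by (simp add: band_kernel_def)
next
  case True
  obtain i j l where q: "q = (i,j,l)" by (cases q)
  have b: "\<bar>i\<bar> \<le> int N" "\<bar>j\<bar> \<le> int N" "\<bar>l\<bar> \<le> int N" "\<bar>j + l\<bar> \<le> int N" using True by (auto simp: in_band_def q)
  have e: "norm (cis (2 * s * of_int n) - 1) \<le> 4 * s * real_of_int \<bar>n\<bar>" for n
    using norm_cis_minus_one_le[of 1 "2 * s * of_int n"] assms by (simp add: abs_mult)
  have n1: "real_of_int \<bar>(i + j + l) * i\<bar> \<le> 2 * (real N)\<^sup>2"
  proof -
    have "\<bar>(i + j + l) * i\<bar> \<le> (2 * int N) * int N" unfolding abs_mult using b by (intro mult_mono) auto
    then have "real_of_int \<bar>(i + j + l) * i\<bar> \<le> real_of_int ((2 * int N) * int N)" by (simp only: of_int_le_iff)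
    then show ?thesis by (simp add: power2_eq_square)
  qed
  have n2: "real_of_int \<bar>j * l\<bar> \<le> (real N)\<^sup>2"
  proof -
    have "\<bar>j * l\<bar> \<le> int N * int N" unfolding abs_mult using b by (intro mult_mono) auto
    then have "real_of_int \<bar>j * l\<bar> \<le> real_of_int (int N * int N)" by (simp only: of_int_le_iff)
    then show ?thesis by (simp add: power2_eq_square)
  qed
  have "band_kernel N s q - band_kernel N 0 q = (cis (2 * s * of_int ((i + j + l) * i)) - 1) + (cis (2 * s * of_int (j * l)) - 1)"
    using True by (simp add: band_kernel_def q)
  also have "norm \<dots> \<le> 4 * s * real_of_int \<bar>(i + j + l) * i\<bar> + 4 * s * real_of_int \<bar>j * l\<bar>"
    by (intro norm_triangle_mono e)
  also have "\<dots> \<le> 4 * s * (2 * (real N)\<^sup>2) + 4 * s * (real N)\<^sup>2"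
    using assms by (intro add_mono mult_left_mono n1 n2) auto
  also have "\<dots> \<le> 16 * s * (real N)\<^sup>2" using assms by (simp add: mult_left_mono)
  finally show ?thesis .
qed

text \<open>The coefficient of \<tau>^2 in the expanded square of an Euler step plus remainder:
  \<open>X ^ 6\<close> from the Euler step, the middle term from the cross product, and the last one
  from the remainder, whose \<tau>^4 is lowered to \<tau>^2 by
  \<open>\<tau> \<le> 1\<close>.\<close>

definition mass_const :: "nat \<Rightarrow> real \<Rightarrow> real" where
  "mass_const N X = X ^ 6 + 2 * (X + X ^ 3) * (16 * (real N)\<^sup>2 * X ^ 3) + (16 * (real N)\<^sup>2 * X ^ 3)\<^sup>2"

text \<open>Up to a unimodular factor the step is the explicit Euler step
  \<open>w k - \<i> * \<tau> * S k\<close> plus a remainder \<open>E\<close> of order \<tau>^2. The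
  first-order change of mass in the Euler step is the imaginary part that vanishes by
  \<open>cubic_mass_real\<close>, so only terms with \<tau>^2 remain.\<close>

lemma mass_step:
  fixes w :: "int \<Rightarrow> complex"
  assumes \<tau>: "0 \<le> \<tau>" "\<tau> \<le> 1" and w: "\<And>k. \<bar>k\<bar> > int N \<Longrightarrow> w k = 0"
    and X: "band_l1 N w \<le> X"
  shows "(\<Sum>k\<in>{- int N..int N}. (norm (flow_modes \<tau> N w k))\<^sup>2) \<le> (\<Sum>k\<in>{- int N..int N}. (norm (w k))\<^sup>2) + mass_const N X * \<tau>\<^sup>2"
proof -
  let ?K = "{- int N..int N}"
  have X0: "X \<ge> 0" using order_trans[OF sum_nonneg X] by simp
  define S where "S k = cubic (band_kernel N 0) w k" for k
  define E where "E k = integral {0..\<tau>} (\<lambda>s. cubic (band_kernel N s) w k - S k)" for k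
  define Y where "Y = 16 * (real N)\<^sup>2 * X ^ 3"
  have Y0: "Y \<ge> 0" using X0 by (simp add: Y_def)
  have lw: "l1 w" by (rule l1_band_limited) (rule w, assumption)
  have wX: "l1_norm w \<le> X"
  proof -
    have "l1_norm w = (\<Sum>\<^sub>\<infinity>k\<in>?K. norm (w k))"
      by (rule infsum_cong_neutral) (use w in \<open>auto simp: not_le abs_le_iff\<close>)
    then show ?thesis using X by simp
  qed
  have w3: "l1_norm w ^ 3 \<le> X ^ 3" by (intro power_mono wX infsum_nonneg) auto
  have S1: "(\<Sum>k\<in>?K. norm (S k)) \<le> X ^ 3"
  proof -
    have "norm (band_kernel N 0 q) \<le> 1" for q by (cases q) (auto simp: band_kernel_def)
    from cubic_summable(4)[where \<kappa> = "band_kernel N 0" and B = 1 and K = ?K, OF lw this] show ?thesis using w3 by (simp add: S_def)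
  qed
  have E1: "(\<Sum>k\<in>?K. norm (E k)) \<le> \<tau> * (Y * \<tau>)"
    unfolding E_def
  proof (rule sum_norm_integral_le[OF _ \<tau>(1)])
    show "continuous_on {0..\<tau>} (\<lambda>s. cubic (band_kernel N s) w k - S k)" if "k \<in> ?K" for k
      using that by (intro continuous_intros flow_modes_integral(2)[OF \<tau>(1)]) auto
    fix s assume s: "s \<in> {0..\<tau>}"
    have "cubic (band_kernel N s) w k - S k = cubic (\<lambda>q. band_kernel N s q - band_kernel N 0 q) w k" for k
      unfolding S_def cubic_def left_diff_distrib
      by (rule infsum_minus(1)[symmetric]) (rule cubic_summable(2)[OF lw norm_band_kernel])+
    then have "(\<Sum>k\<in>?K. norm (cubic (band_kernel N s) w k - S k)) = (\<Sum>k\<in>?K. norm (cubic (\<lambda>q. band_kernel N s q - band_kernel N 0 q) w k))" by simp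
    also have "\<dots> \<le> (16 * s * (real N)\<^sup>2) * l1_norm w ^ 3"
      using s by (intro cubic_summable(4)[OF lw band_kernel_increment]) auto
    also have "\<dots> \<le> (16 * \<tau> * (real N)\<^sup>2) * X ^ 3"
      using s w3 \<tau> by (intro mult_mono) (auto intro!: zero_le_power infsum_nonneg)
    finally show "(\<Sum>k\<in>?K. norm (cubic (band_kernel N s) w k - S k)) \<le> Y * \<tau>" by (simp add: Y_def mult_ac)
  qed simp
  have E2: "L2_set (\<lambda>k. norm (E k)) ?K \<le> Y * \<tau>\<^sup>2"
    using E1 L2_set_le_sum[of ?K "\<lambda>k. norm (E k)"] by (simp add: power2_eq_square mult_ac)
  have S2: "L2_set (\<lambda>k. norm (S k)) ?K \<le> X ^ 3"
    using S1 L2_set_le_sum[of ?K "\<lambda>k. norm (S k)"] by simp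
  have w2: "L2_set (\<lambda>k. norm (w k)) ?K \<le> X"
    using X L2_set_le_sum[of ?K "\<lambda>k. norm (w k)"] by simp
  define a where "a k = w k - \<i> * \<tau> * S k" for k
  have flow: "norm (flow_modes \<tau> N w k) \<le> norm (a k) + norm (E k)" if "k \<in> ?K" for k
  proof -
    have k: "\<bar>k\<bar> \<le> int N" using that by auto
    have "E k = integral {0..\<tau>} (\<lambda>s. cubic (band_kernel N s) w k) - integral {0..\<tau>} (\<lambda>s. S k)"
      unfolding E_def by (intro integral_diff integrable_continuous_interval flow_modes_integral(2)[OF \<tau>(1) k] continuous_intros)
    then have "integral {0..\<tau>} (\<lambda>s. cubic (band_kernel N s) w k) = \<tau> * S k + E k" using \<tau> by (simp add: scaleR_conv_of_real)
    then have "flow_modes \<tau> N w k = disp \<tau> k * (a k - \<i> * E k)"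
      unfolding flow_modes_integral(1)[OF \<tau>(1) k] a_def by (simp add: algebra_simps)
    then show ?thesis using norm_triangle_ineq4[of "a k" "\<i> * E k"] by (simp add: norm_mult)
  qed
  have a2: "(\<Sum>k\<in>?K. (norm (a k))\<^sup>2) = (\<Sum>k\<in>?K. (norm (w k))\<^sup>2) + \<tau>\<^sup>2 * (\<Sum>k\<in>?K. (norm (S k))\<^sup>2)"
  proof -
    have "(norm (a k))\<^sup>2 = (norm (w k))\<^sup>2 + \<tau>\<^sup>2 * (norm (S k))\<^sup>2 + 2 * \<tau> * Im (cnj (w k) * S k)" for k
      unfolding a_def cmod_power2 by (simp add: power2_eq_square algebra_simps)
    then have "(\<Sum>k\<in>?K. (norm (a k))\<^sup>2) = (\<Sum>k\<in>?K. (norm (w k))\<^sup>2) + \<tau>\<^sup>2 * (\<Sum>k\<in>?K. (norm (S k))\<^sup>2) + 2 * \<tau> * Im (\<Sum>k\<in>?K. cnj (w k) * S k)"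
      by (simp add: sum.distrib sum_distrib_left)
    then show ?thesis using cubic_mass_real[where N = N and w = w] by (simp add: S_def)
  qed
  let ?A = "L2_set (\<lambda>k. norm (a k)) ?K" and ?E = "L2_set (\<lambda>k. norm (E k)) ?K"
  have A: "?A \<le> X + X ^ 3"
  proof -
    have "?A \<le> L2_set (\<lambda>k. norm (w k) + norm (\<i> * \<tau> * S k)) ?K"
      unfolding a_def by (intro L2_set_mono norm_triangle_ineq4) auto
    also have "\<dots> \<le> L2_set (\<lambda>k. norm (w k)) ?K + L2_set (\<lambda>k. norm (\<i> * \<tau> * S k)) ?K" by (rule L2_set_triangle_ineq)
    also have "L2_set (\<lambda>k. norm (\<i> * \<tau> * S k)) ?K = \<tau> * L2_set (\<lambda>k. norm (S k)) ?K"
      using \<tau> by (simp add: norm_mult L2_set_right_distrib)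
    also have "\<dots> \<le> 1 * X ^ 3" using \<tau> S2 by (intro mult_mono) auto
    finally show ?thesis using w2 by simp
  qed
  have "(\<Sum>k\<in>?K. (norm (flow_modes \<tau> N w k))\<^sup>2) = (L2_set (\<lambda>k. norm (flow_modes \<tau> N w k)) ?K)\<^sup>2"
    by (simp add: L2_set_def sum_nonneg)
  also have "\<dots> \<le> (?A + ?E)\<^sup>2"
    by (intro power_mono order_trans[OF L2_set_mono[OF flow] L2_set_triangle_ineq]) auto
  also have "\<dots> = ?A\<^sup>2 + 2 * ?A * ?E + ?E\<^sup>2" by (simp add: power2_sum)
  also have "\<dots> \<le> ((\<Sum>k\<in>?K. (norm (w k))\<^sup>2) + \<tau>\<^sup>2 * (X ^ 3)\<^sup>2) + 2 * (X + X ^ 3) * (Y * \<tau>\<^sup>2) + (Y * \<tau>\<^sup>2)\<^sup>2"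
  proof (intro add_mono)
    have "?A\<^sup>2 = (\<Sum>k\<in>?K. (norm (a k))\<^sup>2)" by (simp add: L2_set_def sum_nonneg)
    moreover have "(\<Sum>k\<in>?K. (norm (S k))\<^sup>2) = (L2_set (\<lambda>k. norm (S k)) ?K)\<^sup>2" by (simp add: L2_set_def sum_nonneg)
    moreover have "(L2_set (\<lambda>k. norm (S k)) ?K)\<^sup>2 \<le> (X ^ 3)\<^sup>2" by (intro power_mono S2) simp
    ultimately show "?A\<^sup>2 \<le> (\<Sum>k\<in>?K. (norm (w k))\<^sup>2) + \<tau>\<^sup>2 * (X ^ 3)\<^sup>2"
      unfolding a2 by (simp add: mult_left_mono)
    show "2 * ?A * ?E \<le> 2 * (X + X ^ 3) * (Y * \<tau>\<^sup>2)" using A E2 X0 by (intro mult_mono) auto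
    show "?E\<^sup>2 \<le> (Y * \<tau>\<^sup>2)\<^sup>2" by (intro power_mono E2) simp
  qed
  also have "(Y * \<tau>\<^sup>2)\<^sup>2 \<le> Y\<^sup>2 * \<tau>\<^sup>2"
  proof -
    have "\<tau>\<^sup>2 * \<tau>\<^sup>2 \<le> 1 * \<tau>\<^sup>2" using \<tau> by (intro mult_right_mono) (auto simp: power_le_one)
    then have "Y\<^sup>2 * (\<tau>\<^sup>2 * \<tau>\<^sup>2) \<le> Y\<^sup>2 * \<tau>\<^sup>2" by (intro mult_left_mono) auto
    then show ?thesis by (simp add: power2_eq_square mult_ac)
  qed
  finally have fin: "(\<Sum>k\<in>?K. (norm (flow_modes \<tau> N w k))\<^sup>2) \<le>
      (\<Sum>k\<in>?K. (norm (w k))\<^sup>2) + \<tau>\<^sup>2 * (X ^ 3)\<^sup>2 + 2 * (X + X ^ 3) * (Y * \<tau>\<^sup>2) + Y\<^sup>2 * \<tau>\<^sup>2" by simp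
  have "mass_const N X = (X ^ 3)\<^sup>2 + 2 * (X + X ^ 3) * Y + Y\<^sup>2"
    by (simp add: mass_const_def Y_def flip: power_mult)
  with fin show ?thesis by (simp only: distrib_right mult.assoc mult.commute[of "\<tau>\<^sup>2"] add.assoc)
qed

lemma mass_const_mono:
  assumes "N \<le> N'" "0 \<le> X" "X \<le> X'"
  shows "mass_const N X \<le> mass_const N' X'"
  unfolding mass_const_def
  using assms by (intro add_mono mult_mono power_mono) (auto intro!: mult_mono power_mono add_nonneg_nonneg)

lemma mass_const_nonneg: "X \<ge> 0 \<Longrightarrow> mass_const N X \<ge> 0"
  by (simp add: mass_const_def)

lemma sum_le_sqrt_mass:
  assumes "(\<Sum>k\<in>{- int N..int N}. (norm (w k))\<^sup>2) \<le> \<rho>\<^sup>2" "\<rho> \<ge> 0"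
  shows "band_l1 N w \<le> (2 * real N + 1) * \<rho>"
proof -
  have "norm (w k) \<le> \<rho>" if "k \<in> {- int N..int N}" for k
  proof -
    have "(norm (w k))\<^sup>2 \<le> (\<Sum>k\<in>{- int N..int N}. (norm (w k))\<^sup>2)"
      using that by (intro member_le_sum) auto
    then have "(norm (w k))\<^sup>2 \<le> \<rho>\<^sup>2" using assms(1) by linarith
    then show ?thesis using assms(2) by (rule power2_le_imp_le)
  qed
  then have "band_l1 N w \<le> of_nat (card {- int N..int N}) * \<rho>"
    by (rule sum_bounded_above)
  then show ?thesis by (simp add: nat_add_distrib add.commute)
qed

lemma discrete_gronwall:
  fixes x :: "nat \<Rightarrow> real"
  assumes "a \<ge> 0" "b \<ge> 0" "x 0 \<ge> 0" and step: "\<And>i. i < n \<Longrightarrow> x (Suc i) \<le> (1 + a) * x i + b"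
  shows "x n \<le> exp (a * real n) * (x 0 + real n * b)"
  using step
proof (induction n)
  case (Suc n)
  let ?e = "exp (a * real n)"
  have IH: "x n \<le> ?e * (x 0 + real n * b)" using Suc by simp
  have p: "0 \<le> x 0 + real n * b" using assms by simp
  have e1: "(1 + a) * ?e \<le> exp (a * real (Suc n))"
    using mult_right_mono[OF exp_ge_add_one_self[of a], of ?e] by (simp add: algebra_simps exp_add)
  have e2: "1 \<le> exp (a * real (Suc n))" using assms(1) by simp
  have "x (Suc n) \<le> (1 + a) * x n + b" using Suc.prems by simp
  also have "\<dots> \<le> (1 + a) * (?e * (x 0 + real n * b)) + b" using IH assms(1) by (intro add_right_mono mult_left_mono) auto
  also have "\<dots> = ((1 + a) * ?e) * (x 0 + real n * b) + 1 * b" by simp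
  also have "\<dots> \<le> exp (a * real (Suc n)) * (x 0 + real n * b) + exp (a * real (Suc n)) * b"
    using p e1 e2 assms(2) by (intro add_mono mult_right_mono) auto
  also have "\<dots> = exp (a * real (Suc n)) * (x 0 + real (Suc n) * b)" by (simp add: algebra_simps)
  finally show ?case .
qed simp

section \<open>Global error\<close>

primrec num_modes :: "real \<Rightarrow> nat \<Rightarrow> (int \<Rightarrow> complex) \<Rightarrow> nat \<Rightarrow> int \<Rightarrow> complex" where
  "num_modes \<tau> N c 0 = alias_modes N c"
| "num_modes \<tau> N c (Suc n) = flow_modes \<tau> N (num_modes \<tau> N c n)"

lemma num_modes_band: "\<bar>k\<bar> > int N \<Longrightarrow> num_modes \<tau> N c n k = 0"
  by (cases n) (auto simp: alias_modes_def flow_modes_def band_cut_def)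

lemma num_solution_FS:
  assumes "u0 \<in> torus_Hs s" "s > 1/2"
  shows "num_solution \<tau> N u0 n = FS (num_modes \<tau> N (fourier_coeff u0) n)"
proof (induction n)
  case 0
  then show ?case using interpolation_modes[OF assms] by simp
next
  case (Suc n)
  then show ?case using num_flow_FS[OF num_modes_band] by simp
qed

text \<open>Outside the band the error is \<open>c\<close> itself, and there the weight of
  H^\<gamma> is worth a factor N to the power -\<gamma>.\<close>

lemma L2_tail_split:
  fixes c w :: "int \<Rightarrow> complex"
  assumes c: "l1 c" and w: "\<And>k. \<bar>k\<bar> > int N \<Longrightarrow> w k = 0" and N: "N \<ge> 1" and \<gamma>: "\<gamma> \<ge> 0"
    and wt: "sobolev_summable \<gamma> c" "sobolev_sum \<gamma> c \<le> m\<^sup>2" "m \<ge> 0"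
  shows "l1 (\<lambda>k. c k - w k)"
    and "sqrt (\<Sum>\<^sub>\<infinity>k. (norm (c k - w k))\<^sup>2) \<le> band_l2 N (\<lambda>k. c k - w k) + real N powr (- \<gamma>) * m"
proof -
  let ?K = "{- int N..int N}"
  have lw: "l1 w" by (rule l1_band_limited) (rule w, assumption)
  show l: "l1 (\<lambda>k. c k - w k)"
    by (rule summable_on_comparison_test[OF summable_on_add[OF c lw]]) (auto simp: norm_triangle_ineq4)
  have s: "(\<lambda>k. (norm (c k - w k))\<^sup>2) summable_on A" for A
    using l1_square_summable[OF l] summable_on_subset_banach by blast
  have ws: "(\<lambda>k. W k powr \<gamma> * (norm (c k))\<^sup>2) summable_on A" for A using wt(1) summable_on_subset_banach by blast
  have "(\<Sum>\<^sub>\<infinity>k. (norm (c k - w k))\<^sup>2) = (\<Sum>\<^sub>\<infinity>k\<in>?K \<union> - ?K. (norm (c k - w k))\<^sup>2)" by simp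
  also have "\<dots> = (\<Sum>\<^sub>\<infinity>k\<in>?K. (norm (c k - w k))\<^sup>2) + (\<Sum>\<^sub>\<infinity>k\<in>- ?K. (norm (c k - w k))\<^sup>2)"
    by (rule infsum_Un_disjoint) (auto intro: s)
  also have "(\<Sum>\<^sub>\<infinity>k\<in>?K. (norm (c k - w k))\<^sup>2) = (L2_set (\<lambda>k. norm (c k - w k)) ?K)\<^sup>2"
    by (simp add: L2_set_def sum_nonneg)
  also have "(\<Sum>\<^sub>\<infinity>k\<in>- ?K. (norm (c k - w k))\<^sup>2) \<le> (\<Sum>\<^sub>\<infinity>k\<in>- ?K. real N powr (- 2 * \<gamma>) * (W k powr \<gamma> * (norm (c k))\<^sup>2))"
  proof (rule infsum_mono[OF s])
    show "(\<lambda>k. real N powr (- 2 * \<gamma>) * (W k powr \<gamma> * (norm (c k))\<^sup>2)) summable_on - ?K"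
      by (intro summable_on_cmult_right ws)
    fix k assume "k \<in> - ?K"
    then have k: "\<bar>k\<bar> > int N" by auto
    from mult_right_mono[OF tail_weight[OF k N \<gamma>], of "(norm (c k))\<^sup>2"]
    show "(norm (c k - w k))\<^sup>2 \<le> real N powr (- 2 * \<gamma>) * (W k powr \<gamma> * (norm (c k))\<^sup>2)"
      by (simp add: w[OF k] mult.assoc)
  qed
  also have "\<dots> = real N powr (- 2 * \<gamma>) * (\<Sum>\<^sub>\<infinity>k\<in>- ?K. W k powr \<gamma> * (norm (c k))\<^sup>2)" by (rule infsum_cmult_right')
  also have "\<dots> \<le> real N powr (- 2 * \<gamma>) * m\<^sup>2"
    by (intro mult_left_mono order_trans[OF infsum_mono2[OF ws ws] wt(2)]) auto
  also have "\<dots> = (real N powr (- \<gamma>) * m)\<^sup>2"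
    by (simp add: power_mult_distrib power2_eq_square[of "_ powr _"] flip: powr_add)
  finally have "(\<Sum>\<^sub>\<infinity>k. (norm (c k - w k))\<^sup>2) \<le> (L2_set (\<lambda>k. norm (c k - w k)) ?K)\<^sup>2 + (real N powr (- \<gamma>) * m)\<^sup>2" by simp
  then have "sqrt (\<Sum>\<^sub>\<infinity>k. (norm (c k - w k))\<^sup>2) \<le> sqrt ((L2_set (\<lambda>k. norm (c k - w k)) ?K)\<^sup>2 + (real N powr (- \<gamma>) * m)\<^sup>2)"
    by (rule real_sqrt_le_mono)
  also have "\<dots> \<le> L2_set (\<lambda>k. norm (c k - w k)) ?K + real N powr (- \<gamma>) * m"
    by (rule sqrt_sum_squares_le_sum) (use wt(3) in auto)
  finally show "sqrt (\<Sum>\<^sub>\<infinity>k. (norm (c k - w k))\<^sup>2) \<le> L2_set (\<lambda>k. norm (c k - w k)) ?K + real N powr (- \<gamma>) * m" .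
qed

section \<open>Error and mass bounds over the whole time interval\<close>

context nls_modes
begin

text \<open>
  \<open>\<eta>\<close> is the rate of the \<open>l\<^sup>1\<close> bootstrap, \<open>Q\<close> bounds the \<open>l\<^sup>1\<close> norm of the solution with weight
  \<open>W powr \<eta>\<close>, \<open>A\<close> is the constant of the \<open>l\<^sup>1\<close> error bound, and \<open>\<rho>\<close> bounds the \<open>l\<^sup>2\<close> norm of the numerical
  solution as long as its mass has not grown by more than \<open>1\<close>.
\<close>

definition \<eta> :: real where "\<eta> = (\<gamma> - 1/2) / 4"

definition Q :: real where "Q = sqrt (W_sum (\<gamma> - 2 * \<eta>)) * m"

definition A :: real where "A = exp (9 * (R0 + 1)\<^sup>2 * T) * (Q + T * (3 * R0 ^ 5 + 16 * Q ^ 3))"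

definition \<rho> :: real where "\<rho> = sqrt (R0\<^sup>2 + 1)"

text \<open>The choice of \<eta> places \<open>\<gamma> - 2 * \<eta>\<close> at the midpoint of
  \<gamma> and 1/2.\<close>

lemma \<eta>: "0 < \<eta>" "\<eta> \<le> 1" "\<gamma> - 2 * \<eta> > 1/2"
  using \<gamma> by (auto simp: \<eta>_def field_simps)

lemma Q_nonneg: "Q \<ge> 0"
  unfolding Q_def using m by (intro mult_nonneg_nonneg real_sqrt_ge_zero infsum_nonneg) auto

lemma A_nonneg: "A \<ge> 0"
  unfolding A_def using Q_nonneg R0_nonneg T by (intro mult_nonneg_nonneg add_nonneg_nonneg) auto

lemma initial_l1_error:
  assumes N: "N \<ge> 1"
  shows "band_l1 N (\<lambda>k. c 0 k - alias_modes N (c 0) k) \<le> real N powr (- 2 * \<eta>) * Q"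
proof -
  have t: "0 \<in> {0..T}" using T by simp
  note wb = weighted_l1_of_sobolev[OF \<eta>(3) weighted_summable[OF t] weighted_bound[OF t] m, folded Q_def]
  have "band_l1 N (\<lambda>k. c 0 k - alias_modes N (c 0) k) \<le> real N powr (- 2 * \<eta>) * (\<Sum>\<^sub>\<infinity>k. W k powr \<eta> * norm (c 0 k))"
    using wb(1) \<eta> by (intro alias_error_l1 l1_c[OF t] N) auto
  also have "\<dots> \<le> real N powr (- 2 * \<eta>) * Q"
    using wb(2) by (intro mult_left_mono) auto
  finally show ?thesis .
qed

abbreviation modes :: "real \<Rightarrow> nat \<Rightarrow> nat \<Rightarrow> int \<Rightarrow> complex" where
  "modes \<tau> N n \<equiv> num_modes \<tau> N (c 0) n"

text \<open>Strong induction. Errors of at most 1 at all earlier steps keep the numerical solution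
  in the l^1 ball of radius \<open>R0 + 1\<close>, so the step estimate holds up to \<open>n\<close>
  with one Lipschitz constant. Gronwall's inequality then bounds the error at \<open>n\<close> by
  \<open>A\<close> times the small quantity, which reproduces the bound 1.\<close>

lemma l1_error_bound:
  assumes \<tau>: "0 < \<tau>" "\<tau> \<le> 1" and N: "N \<ge> 1" and small: "A * (\<tau> powr \<eta> + real N powr (- 2 * \<eta>)) \<le> 1"
    and n: "real n * \<tau> \<le> T"
  shows "band_l1 N (\<lambda>k. c (real n * \<tau>) k - modes \<tau> N n k) \<le> 1"
  using n
proof (induction n rule: less_induct)
  case (less n)
  define D where "D = \<tau> powr \<eta> + real N powr (- 2 * \<eta>)"
  define E where "E i = band_l1 N (\<lambda>k. c (real i * \<tau>) k - modes \<tau> N i k)" for i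
  have iT: "real i * \<tau> \<le> real n * \<tau>" if "i \<le> n" for i using that \<tau> by (intro mult_right_mono) auto
  have D: "\<tau> powr \<eta> \<le> D" "real N powr (- 2 * \<eta>) \<le> D" "D \<ge> 0" by (simp_all add: D_def)
  \<comment> \<open>As \<open>\<tau> \<le> 1\<close> and \<open>\<eta> \<le> 1\<close>, the freezing
    error of order \<tau> is absorbed by the slower rate.\<close>
  have t\<eta>: "\<tau> \<le> \<tau> powr \<eta>" using powr_mono'[of \<eta> 1 \<tau>] \<eta> \<tau> by simp
  define b where "b = 3 * R0 ^ 5 * D + 16 * D * Q ^ 3"
  have b: "b \<ge> 0" unfolding b_def using R0_nonneg Q_nonneg D by auto
  have step: "E (Suc i) \<le> (1 + 9 * (R0 + 1)\<^sup>2 * \<tau>) * E i + \<tau> * b" if i: "i < n" for i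
  proof -
    let ?t = "real i * \<tau>"
    have Si: "?t + \<tau> = real (Suc i) * \<tau>" by (simp add: algebra_simps)
    have ti: "0 \<le> ?t" "?t + \<tau> \<le> T" "?t \<in> {0..T}"
      using order_trans[OF iT[of "Suc i"] less.prems] order_trans[OF iT[of i] less.prems] i \<tau> unfolding Si by simp_all
    have wi: "band_l1 N (modes \<tau> N i) \<le> R0 + 1"
    proof -
      have "band_l1 N (modes \<tau> N i) \<le> band_l1 N (c ?t) + E i"
        unfolding E_def sum.distrib[symmetric] by (intro sum_mono) (metis norm_minus_commute norm_triangle_sub)
      also have "band_l1 N (c ?t) \<le> l1_norm (c ?t)"
        by (rule finite_sum_le_infsum[OF l1_c[OF ti(3)]]) auto
      also have "\<dots> \<le> R0" by (rule l1_bound_c[OF ti(3)])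
      also have "E i \<le> 1" unfolding E_def using less.IH[OF i] iT[of i] i less.prems by auto
      finally show ?thesis by simp
    qed
    have "E (Suc i) \<le> (1 + 9 * (R0 + 1)\<^sup>2 * \<tau>) * E i + \<tau> * (3 * R0 ^ 5 * \<tau> + 16 * D * Q ^ 3)"
      unfolding E_def num_modes.simps Si[symmetric]
    proof (rule step_error(1)[OF ti(1) _ ti(2) N num_modes_band wi])
      fix s assume "s \<in> {0..\<tau>}"
      then show "band_l1 N (\<lambda>k. cubic (phase s) (c ?t) k - cubic (band_kernel N s) (c ?t) k) \<le> 16 * D * Q ^ 3"
        unfolding D_def Q_def
        using \<eta> m by (intro kernel_error_l1[where \<gamma> = \<gamma>] N weighted_summable[OF ti(3)] weighted_bound[OF ti(3)]) auto
    qed (use \<tau> in auto)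
    also have "\<dots> \<le> (1 + 9 * (R0 + 1)\<^sup>2 * \<tau>) * E i + \<tau> * b"
      unfolding b_def using \<tau> R0_nonneg t\<eta> D by (intro add_left_mono mult_left_mono add_right_mono) auto
    finally show ?thesis .
  qed
  have E0: "E 0 \<ge> 0" "E 0 \<le> D * Q"
  proof -
    show "E 0 \<ge> 0" by (simp add: E_def sum_nonneg)
    have "E 0 \<le> real N powr (- 2 * \<eta>) * Q" using initial_l1_error[OF N] by (simp add: E_def)
    also have "\<dots> \<le> D * Q" by (intro mult_right_mono D Q_nonneg)
    finally show "E 0 \<le> D * Q" .
  qed
  have "E n \<le> exp (9 * (R0 + 1)\<^sup>2 * \<tau> * real n) * (E 0 + real n * (\<tau> * b))"
    by (rule discrete_gronwall) (use \<tau> b E0 step in auto)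
  also have "\<dots> \<le> exp (9 * (R0 + 1)\<^sup>2 * T) * (D * Q + T * b)"
  proof (rule mult_mono)
    have "9 * (R0 + 1)\<^sup>2 * (real n * \<tau>) \<le> 9 * (R0 + 1)\<^sup>2 * T" using less.prems by (intro mult_left_mono) auto
    then show "exp (9 * (R0 + 1)\<^sup>2 * \<tau> * real n) \<le> exp (9 * (R0 + 1)\<^sup>2 * T)" by (simp add: mult_ac)
    show "E 0 + real n * (\<tau> * b) \<le> D * Q + T * b"
      by (intro add_mono E0(2)) (use mult_right_mono[OF less.prems b] in \<open>simp add: mult_ac\<close>)
  qed (use \<tau> b E0 in auto)
  also have "\<dots> = A * D" by (simp add: A_def b_def algebra_simps)
  also have "\<dots> \<le> 1" using small by (simp add: D_def)
  finally show ?case by (simp add: E_def)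
qed

lemma initial_mass:
  shows "(\<Sum>k\<in>{- int N..int N}. (norm (modes \<tau> N 0 k))\<^sup>2) \<le> R0\<^sup>2"
proof -
  have t: "0 \<in> {0..T}" using T by simp
  let ?K = "{- int N..int N}"
  have "L2_set (\<lambda>k. norm (modes \<tau> N 0 k)) ?K \<le> (\<Sum>k\<in>?K. norm (modes \<tau> N 0 k))" by (rule L2_set_le_sum) auto
  also have "\<dots> \<le> R0" using alias_l1[OF l1_c[OF t], of N] l1_bound_c[OF t] by simp
  finally have "(L2_set (\<lambda>k. norm (modes \<tau> N 0 k)) ?K)\<^sup>2 \<le> R0\<^sup>2" by (intro power_mono) auto
  then show ?thesis by (simp add: L2_set_def sum_nonneg)
qed

text \<open>Mass and l^1 norm are propagated together: a mass of at most
  \<open>\<rho>\<^sup>2\<close> bounds the l^1 norm by the number of modes times \<rho>, and this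
  norm fixes the constant of the next step. Over at most \<open>T / \<tau>\<close> steps the
  increments \<open>C * \<tau>\<^sup>2\<close> add up to at most
  \<open>T * C * \<tau> \<le> 1\<close>, exactly the room left in \<rho>. By monotonicity
  \<open>C\<close>, taken at \<open>N0\<close>, serves all smaller N.\<close>

lemma mass_bound:
  assumes \<tau>: "0 < \<tau>" "\<tau> \<le> 1" and N: "N \<le> N0" and C: "C = mass_const N0 ((2 * real N0 + 1) * \<rho>)" "T * C * \<tau> \<le> 1"
    and n: "real n * \<tau> \<le> T"
  shows "(\<Sum>k\<in>{- int N..int N}. (norm (modes \<tau> N n k))\<^sup>2) \<le> R0\<^sup>2 + real n * (C * \<tau>\<^sup>2)"
    and "band_l1 N (modes \<tau> N n) \<le> (2 * real N0 + 1) * \<rho>"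
proof -
  let ?K = "{- int N..int N}" and ?X = "(2 * real N0 + 1) * \<rho>"
  have \<rho>0: "\<rho> \<ge> 0" "\<rho>\<^sup>2 = R0\<^sup>2 + 1"
    unfolding \<rho>_def by (intro real_sqrt_ge_zero real_sqrt_pow2 add_nonneg_nonneg; simp)+
  have X0: "?X \<ge> 0" using \<rho>0 by simp
  have C0: "C \<ge> 0" unfolding C using X0 by (rule mass_const_nonneg)
  have sb: "(\<Sum>k\<in>?K. norm (modes \<tau> N n k)) \<le> ?X"
    if "(\<Sum>k\<in>?K. (norm (modes \<tau> N n k))\<^sup>2) \<le> R0\<^sup>2 + real n * (C * \<tau>\<^sup>2)" "real n * \<tau> \<le> T" for n
  proof -
    have "real n * \<tau> * (C * \<tau>) \<le> T * (C * \<tau>)" using that(2) C0 \<tau> by (intro mult_right_mono) auto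
    then have "real n * (C * \<tau>\<^sup>2) \<le> 1" using C(2) by (simp add: power2_eq_square mult_ac)
    then have "(\<Sum>k\<in>?K. (norm (modes \<tau> N n k))\<^sup>2) \<le> \<rho>\<^sup>2" using that(1) \<rho>0 by linarith
    from sum_le_sqrt_mass[OF this \<rho>0(1)]
    have "(\<Sum>k\<in>?K. norm (modes \<tau> N n k)) \<le> (2 * real N + 1) * \<rho>" .
    also have "\<dots> \<le> ?X" using N \<rho>0 by (intro mult_right_mono) auto
    finally show ?thesis .
  qed
  show mass: "(\<Sum>k\<in>?K. (norm (modes \<tau> N n k))\<^sup>2) \<le> R0\<^sup>2 + real n * (C * \<tau>\<^sup>2)"
    using n
  proof (induction n)
    case 0
    then show ?case using initial_mass by simp
  next
    case (Suc n)
    have nT: "real n * \<tau> \<le> T" using Suc.prems \<tau> by (simp add: algebra_simps)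
    have IH: "(\<Sum>k\<in>?K. (norm (modes \<tau> N n k))\<^sup>2) \<le> R0\<^sup>2 + real n * (C * \<tau>\<^sup>2)" by (rule Suc.IH[OF nT])
    have "(\<Sum>k\<in>?K. (norm (modes \<tau> N (Suc n) k))\<^sup>2) \<le> (\<Sum>k\<in>?K. (norm (modes \<tau> N n k))\<^sup>2) + mass_const N ?X * \<tau>\<^sup>2"
      unfolding num_modes.simps by (rule mass_step) (use \<tau> sb[OF IH nT] num_modes_band in auto)
    also have "mass_const N ?X * \<tau>\<^sup>2 \<le> C * \<tau>\<^sup>2"
      unfolding C by (intro mult_right_mono mass_const_mono N X0) (use \<rho>0 in auto)
    finally show ?case using IH by (simp add: algebra_simps)
  qed
  show "(\<Sum>k\<in>?K. norm (modes \<tau> N n k)) \<le> ?X" by (rule sb[OF mass n])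
qed

definition K2 :: "real \<Rightarrow> real" where
  "K2 \<alpha> = sqrt 27 * W_sum ((3 * \<gamma> - 4 * \<alpha>) / 2) * m ^ 3"

text \<open>Gronwall's factor times the sum of the interpolation error and \<open>T\<close> times
  the errors per unit time: freezing, phase and truncation. \<open>R\<close> occurs only in the
  exponent.\<close>

definition C2 :: "real \<Rightarrow> real \<Rightarrow> real" where
  "C2 R \<alpha> = exp (9 * R\<^sup>2 * T) * (sqrt (W_sum \<gamma>) * m + T * (3 * R0 ^ 5 + 16 * K2 \<alpha> + 6 * (R0\<^sup>2 * m)))"

lemma K2_nonneg: "K2 \<alpha> \<ge> 0"
  unfolding K2_def using m by (intro mult_nonneg_nonneg infsum_nonneg) auto

lemma l2_error_bound:
  assumes \<tau>: "0 < \<tau>" "\<tau> \<le> 1" and N: "N \<ge> 1" and R: "R0 \<le> R" and n: "real n * \<tau> \<le> T"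
    and \<alpha>: "0 < \<alpha>" "2 * \<alpha> \<le> \<gamma>" "3 * \<gamma> - 4 * \<alpha> > 1"
    and w: "\<And>i. i \<le> n \<Longrightarrow> band_l1 N (modes \<tau> N i) \<le> R"
  shows "band_l2 N (\<lambda>k. c (real n * \<tau>) k - modes \<tau> N n k) \<le> C2 R \<alpha> * (\<tau> powr (2 * \<alpha>) + real N powr (- \<gamma>))"
proof -
  define D where "D = \<tau> powr (2 * \<alpha>) + real N powr (- \<gamma>)"
  define E where "E i = band_l2 N (\<lambda>k. c (real i * \<tau>) k - modes \<tau> N i k)" for i
  have iT: "real i * \<tau> \<le> real n * \<tau>" if "i \<le> n" for i using that \<tau> by (intro mult_right_mono) auto
  have D: "\<tau> powr (2 * \<alpha>) \<le> D" "real N powr (- \<gamma>) \<le> D" "D \<ge> 0" by (simp_all add: D_def)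
  \<comment> \<open>Since \<open>2 * \<alpha> \<le> \<gamma> \<le> 1\<close>, the first-order
    freezing error is dominated by the phase error.\<close>
  have t\<alpha>: "\<tau> \<le> \<tau> powr (2 * \<alpha>)" using powr_mono'[of "2 * \<alpha>" 1 \<tau>] \<alpha> \<gamma> \<tau> by simp
  define b where "b = (3 * R0 ^ 5 + 16 * K2 \<alpha> + 6 * (R0\<^sup>2 * m)) * D"
  have b: "b \<ge> 0" unfolding b_def using R0_nonneg K2_nonneg m D by (intro mult_nonneg_nonneg add_nonneg_nonneg) auto
  have step: "E (Suc i) \<le> (1 + 9 * R\<^sup>2 * \<tau>) * E i + \<tau> * b" if i: "i < n" for i
  proof -
    let ?t = "real i * \<tau>"
    have Si: "?t + \<tau> = real (Suc i) * \<tau>" by (simp add: algebra_simps)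
    have ti: "0 \<le> ?t" "?t + \<tau> \<le> T" "?t \<in> {0..T}"
      using order_trans[OF iT[of "Suc i"] n] order_trans[OF iT[of i] n] i \<tau> unfolding Si by simp_all
    have wi: "band_l1 N (modes \<tau> N i) \<le> R" using w i by simp
    let ?\<delta> = "16 * \<tau> powr (2 * \<alpha>) * K2 \<alpha> + 6 * real N powr (- \<gamma>) * (R0\<^sup>2 * m)"
    have "E (Suc i) \<le> (1 + 9 * R\<^sup>2 * \<tau>) * E i + \<tau> * (3 * R0 ^ 5 * \<tau> + ?\<delta>)"
      unfolding E_def num_modes.simps Si[symmetric]
    proof (rule step_error(2)[OF ti(1) _ ti(2) N num_modes_band wi R])
      fix s assume "s \<in> {0..\<tau>}"
      then show "band_l2 N (\<lambda>k. cubic (phase s) (c ?t) k - cubic (band_kernel N s) (c ?t) k) \<le> ?\<delta>"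
        unfolding K2_def
        using \<alpha> \<gamma> m by (intro kernel_error_l2 N weighted_summable[OF ti(3)] weighted_bound[OF ti(3)] l1_c[OF ti(3)] l1_bound_c[OF ti(3)]) auto
    qed (use \<tau> in auto)
    also have "\<dots> \<le> (1 + 9 * R\<^sup>2 * \<tau>) * E i + \<tau> * b"
    proof (intro add_left_mono mult_left_mono)
      have "3 * R0 ^ 5 * \<tau> + ?\<delta> \<le> 3 * R0 ^ 5 * D + (16 * D * K2 \<alpha> + 6 * D * (R0\<^sup>2 * m))"
        using R0_nonneg K2_nonneg m t\<alpha> D by (intro add_mono mult_left_mono mult_right_mono) auto
      then show "3 * R0 ^ 5 * \<tau> + ?\<delta> \<le> b" by (simp add: b_def algebra_simps)
    qed (use \<tau> in auto)
    finally show ?thesis .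
  qed
  let ?Z = "sqrt (W_sum \<gamma>) * m"
  have Z0: "?Z \<ge> 0" using m by (intro mult_nonneg_nonneg real_sqrt_ge_zero infsum_nonneg) auto
  have E0: "E 0 \<ge> 0" "E 0 \<le> D * ?Z"
  proof -
    have t: "0 \<in> {0..T}" using T by simp
    show "E 0 \<ge> 0" by (simp add: E_def)
    have "E 0 \<le> real N powr (- \<gamma>) * ?Z"
      using alias_error_l2[OF l1_c[OF t] N \<gamma>(1) weighted_summable[OF t] weighted_bound[OF t] m] by (simp add: E_def)
    also have "\<dots> \<le> D * ?Z" by (intro mult_right_mono D Z0)
    finally show "E 0 \<le> D * ?Z" .
  qed
  have "E n \<le> exp (9 * R\<^sup>2 * \<tau> * real n) * (E 0 + real n * (\<tau> * b))"
    by (rule discrete_gronwall) (use \<tau> b E0 step in auto)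
  also have "\<dots> \<le> exp (9 * R\<^sup>2 * T) * (D * ?Z + T * b)"
  proof (rule mult_mono)
    have "9 * R\<^sup>2 * (real n * \<tau>) \<le> 9 * R\<^sup>2 * T" using n by (intro mult_left_mono) auto
    then show "exp (9 * R\<^sup>2 * \<tau> * real n) \<le> exp (9 * R\<^sup>2 * T)" by (simp add: mult_ac)
    show "E 0 + real n * (\<tau> * b) \<le> D * ?Z + T * b"
      by (intro add_mono E0(2)) (use mult_right_mono[OF n b] in \<open>simp add: mult_ac\<close>)
  qed (use \<tau> b E0 in auto)
  also have "\<dots> = C2 R \<alpha> * D" by (simp add: C2_def b_def algebra_simps)
  finally show ?thesis by (simp add: E_def D_def)
qed

lemma C2_nonneg: "C2 R \<alpha> \<ge> 0"
  unfolding C2_def using m T R0_nonneg K2_nonneg[of \<alpha>]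
  by (intro mult_nonneg_nonneg add_nonneg_nonneg real_sqrt_ge_zero infsum_nonneg) auto

end

text \<open>An instance of the locale for all admissible parameters. The constants
  \<open>R0\<close>, \<open>A\<close>, \<open>\<rho>\<close> and \<open>C2\<close> do not depend on
  \<open>c\<close>, so they can be read off the zero solution before any solution is given, as the
  order of the quantifiers demands.\<close>

lemma nls_modes_zero:
  assumes "1/2 < \<gamma>" "\<gamma> \<le> 1" "T > 0" "m \<ge> 0"
  shows "nls_modes \<gamma> T m (\<lambda>_ _. 0)"
  by unfold_locales (use assms in \<open>auto simp: cubic_def cubic_term_def case_prod_unfold\<close>)

text \<open>The threshold \<open>N0\<close> depends on \<open>A\<close> and \<eta> only and is fixed
  before the step size. From \<open>N0\<close> on, the bootstrap applies for small \<tau>; below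
  \<open>N0\<close>, the mass argument applies with the constant \<open>C\<close> belonging to
  \<open>N0\<close>, and \<tau> has to be small in terms of this constant.\<close>

lemma uniform_l1_bound:
  assumes \<gamma>: "1/2 < \<gamma>" "\<gamma> \<le> 1" and T: "T > 0" and m: "m \<ge> 0"
  obtains \<tau>\<^sub>0 R where "\<tau>\<^sub>0 > 0" "\<tau>\<^sub>0 \<le> 1" "nls_modes.R0 \<gamma> m \<le> R"
    "\<And>c \<tau> N n. nls_modes \<gamma> T m c \<Longrightarrow> 0 < \<tau> \<Longrightarrow> \<tau> \<le> \<tau>\<^sub>0 \<Longrightarrow> N \<ge> 1 \<Longrightarrow> real n * \<tau> \<le> T \<Longrightarrow>
      (band_l1 N (num_modes \<tau> N (c 0) n)) \<le> R"
proof -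
  interpret z: nls_modes \<gamma> T m "\<lambda>_ _. 0"
    by (rule nls_modes_zero[OF \<gamma> T m])
  \<comment> \<open>Each summand of the smallness condition will be at most \<open>1 / B\<close>, so
    \<open>B\<close> has to be at least \<open>2 * A\<close>; the \<open>+ 2\<close> keeps it
    positive when \<open>A = 0\<close>.\<close>
  define B where "B = 2 * z.A + 2"
  have B: "B \<ge> 2" "z.A / B \<le> 1/2" using z.A_nonneg by (auto simp: B_def field_simps)
  define N0 where "N0 = nat \<lceil>B powr (1 / (2 * z.\<eta>))\<rceil>"
  define C where "C = mass_const N0 ((2 * real N0 + 1) * z.\<rho>)"
  define R where "R = max (z.R0 + 1) ((2 * real N0 + 1) * z.\<rho>)"
  \<comment> \<open>The entry with \<open>B\<close> gives
    \<open>\<tau> powr \<eta> \<le> 1 / B\<close>, the last one gives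
    \<open>T * C * \<tau> \<le> 1\<close>; the summand 1 in its denominator covers
    \<open>C = 0\<close>.\<close>
  define \<tau>\<^sub>0 where "\<tau>\<^sub>0 = min 1 (min (B powr (- 1 / z.\<eta>)) (1 / (T * C + 1)))"
  have "z.\<rho> \<ge> 0" unfolding z.\<rho>_def by (intro real_sqrt_ge_zero add_nonneg_nonneg) auto
  then have C: "C \<ge> 0" unfolding C_def by (intro mass_const_nonneg) auto
  then have TC: "T * C + 1 > 0" using T by (intro add_nonneg_pos) auto
  have bound: "band_l1 N (num_modes \<tau> N (c 0) n) \<le> R"
    if c: "nls_modes \<gamma> T m c" and \<tau>: "0 < \<tau>" "\<tau> \<le> \<tau>\<^sub>0" and N: "N \<ge> 1" and n: "real n * \<tau> \<le> T" for c \<tau> N n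
  proof -
    interpret nls_modes \<gamma> T m c by (rule c)
    have \<tau>1: "\<tau> \<le> 1" "\<tau> \<le> B powr (- 1 / \<eta>)" "\<tau> \<le> 1 / (T * C + 1)" using \<tau> by (auto simp: \<tau>\<^sub>0_def)
    show ?thesis
    proof (cases "N0 \<le> N")
      case True
      have "\<tau> powr \<eta> \<le> (B powr (- 1 / \<eta>)) powr \<eta>" using \<tau> \<tau>1 \<eta>(1) by (intro powr_mono2) auto
      also have "\<dots> = B powr (- 1)" using \<eta>(1) by (simp only: powr_powr) simp
      also have "\<dots> = 1 / B" using B by (simp add: powr_minus_divide)
      finally have t: "\<tau> powr \<eta> \<le> 1 / B" .
      have "B powr (1 / (2 * \<eta>)) \<le> real N0" unfolding N0_def by linarith
      then have "B powr (1 / (2 * \<eta>)) \<le> real N" using True by linarith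
      then have "(B powr (1 / (2 * \<eta>))) powr (2 * \<eta>) \<le> real N powr (2 * \<eta>)" using \<eta>(1) by (intro powr_mono2) auto
      then have "B \<le> real N powr (2 * \<eta>)" using \<eta>(1) B by (simp add: powr_powr)
      then have "real N powr (- 2 * \<eta>) \<le> 1 / B" using B N by (simp add: powr_minus_divide frac_le)
      with t have "A * (\<tau> powr \<eta> + real N powr (- 2 * \<eta>)) \<le> A * (1 / B + 1 / B)"
        using A_nonneg by (intro mult_left_mono) auto
      also have "\<dots> \<le> 1" using B by simp
      finally have small: "A * (\<tau> powr \<eta> + real N powr (- 2 * \<eta>)) \<le> 1" .
      have tT: "real n * \<tau> \<in> {0..T}" using n \<tau> by auto
      let ?t = "real n * \<tau>"
      have "band_l1 N (modes \<tau> N n) \<le> band_l1 N (c ?t) + band_l1 N (\<lambda>k. c ?t k - modes \<tau> N n k)"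
        unfolding sum.distrib[symmetric] by (intro sum_mono) (metis norm_minus_commute norm_triangle_sub)
      also have "band_l1 N (c ?t) \<le> l1_norm (c ?t)"
        by (rule finite_sum_le_infsum[OF l1_c[OF tT]]) auto
      also have "\<dots> \<le> R0" by (rule l1_bound_c[OF tT])
      also have "band_l1 N (\<lambda>k. c ?t k - modes \<tau> N n k) \<le> 1"
        by (rule l1_error_bound[OF \<tau>(1) \<tau>1(1) N small n])
      finally show ?thesis by (simp add: R_def)
    next
      case False
      have "T * C * \<tau> \<le> T * C * (1 / (T * C + 1))" using \<tau>1(3) T C by (intro mult_left_mono) auto
      also have "\<dots> \<le> 1" using TC by (simp add: field_simps)
      finally have "T * C * \<tau> \<le> 1" .
      then have "band_l1 N (modes \<tau> N n) \<le> (2 * real N0 + 1) * \<rho>"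
        using False by (intro mass_bound(2)[OF \<tau>(1) \<tau>1(1) _ C_def _ n]) auto
      then show ?thesis by (simp add: R_def)
    qed
  qed
  show ?thesis
  proof (rule that[of \<tau>\<^sub>0 R])
    show "\<tau>\<^sub>0 > 0" using B TC by (simp add: \<tau>\<^sub>0_def)
    show "\<tau>\<^sub>0 \<le> 1" by (simp add: \<tau>\<^sub>0_def)
    show "z.R0 \<le> R" by (simp add: R_def)
  qed (rule bound)
qed

lemma torus_L2_norm_cong_AE:
  assumes "f \<in> borel_measurable borel" "g \<in> borel_measurable borel" "AE x in lborel. f x = g x"
  shows "torus_L2_norm f = torus_L2_norm g"
proof -
  have [measurable]: "f \<in> borel_measurable borel" "g \<in> borel_measurable borel" by fact+
  have "(LINT x:{0..2*pi}|lborel. (cmod (f x))\<^sup>2) = (LINT x:{0..2*pi}|lborel. (cmod (g x))\<^sup>2)"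
    unfolding set_lebesgue_integral_def
    by (rule integral_cong_AE) (use assms(3) in \<open>auto elim!: eventually_mono\<close>)
  then show ?thesis by (simp add: torus_L2_norm_def)
qed

theorem theorem2p1:
  fixes T \<gamma> M :: real
  assumes "T > 0" and "1/2 < \<gamma>" and "\<gamma> \<le> 1"
  shows "\<exists>\<tau>\<^sub>0>0. \<forall>\<epsilon>>0. \<exists>C>0. \<forall>u0 u.
           nls_solution \<gamma> T u0 u \<and> Linf_Hs_norm \<gamma> T u = ereal M \<longrightarrow>
           (\<forall>(\<tau>::real) (N::nat) (n::nat).
              0 < \<tau> \<and> \<tau> \<le> \<tau>\<^sub>0 \<and> N \<ge> 1 \<and> real n * \<tau> \<le> T \<longrightarrow>
              torus_L2_norm (\<lambda>x. u (real n * \<tau>) x - num_solution \<tau> N u0 n x)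
                \<le> C * \<tau> powr (3/2 * \<gamma> - 1/2 - \<epsilon>) + C * real N powr (-\<gamma>))"
proof -
  define m where "m = \<bar>M\<bar> / sqrt (2 * pi)"
  have m: "m \<ge> 0" by (simp add: m_def)
  interpret z: nls_modes \<gamma> T m "\<lambda>_ _. 0"
    by (rule nls_modes_zero[OF assms(2,3,1) m])
  obtain \<tau>\<^sub>0 R where \<tau>0: "\<tau>\<^sub>0 > 0" "\<tau>\<^sub>0 \<le> 1" and R: "z.R0 \<le> R"
    and bound: "\<And>c \<tau> N n. nls_modes \<gamma> T m c \<Longrightarrow> 0 < \<tau> \<Longrightarrow> \<tau> \<le> \<tau>\<^sub>0 \<Longrightarrow> N \<ge> 1 \<Longrightarrow> real n * \<tau> \<le> T \<Longrightarrow>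
      (band_l1 N (num_modes \<tau> N (c 0) n)) \<le> R"
    using uniform_l1_bound[OF assms(2,3,1) m] by blast
  show ?thesis
  proof (rule exI[of _ \<tau>\<^sub>0], intro conjI allI impI \<tau>0(1))
    fix \<epsilon> :: real assume \<epsilon>: "\<epsilon> > 0"
    \<comment> \<open>A large \<epsilon> would make \<alpha> negative. Since 3/2 \<gamma> - 1/2 >
      1/4, the cap 1/8 keeps it positive, and a smaller loss only improves the rate because
      \<open>\<tau> \<le> 1\<close>.\<close>
    define \<epsilon>' where "\<epsilon>' = min \<epsilon> (1/8)"
    have \<epsilon>': "0 < \<epsilon>'" "\<epsilon>' \<le> \<epsilon>" "\<epsilon>' \<le> 1/8" using \<epsilon> by (auto simp: \<epsilon>'_def)
    \<comment> \<open>This gives \<open>3 * \<gamma> - 4 * \<alpha> = 1 + 2 * \<epsilon>'\<close>,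
      just inside the range of the resonance estimate.\<close>
    define \<alpha> where "\<alpha> = (3/2 * \<gamma> - 1/2 - \<epsilon>') / 2"
    have \<alpha>: "0 < \<alpha>" "2 * \<alpha> \<le> \<gamma>" "3 * \<gamma> - 4 * \<alpha> > 1" using assms(2,3) \<epsilon>' by (auto simp: \<alpha>_def field_simps)
    \<comment> \<open>The summand \<open>m\<close> accounts for the solution outside the band; the
      final 1 makes \<open>C\<close> positive in every case.\<close>
    define C where "C = sqrt (2 * pi) * (z.C2 R \<alpha> + m) + 1"
    have C: "C > 0" "sqrt (2 * pi) * (z.C2 R \<alpha> + m) \<le> C"
      unfolding C_def using m z.C2_nonneg[of R \<alpha>] by (auto intro!: add_nonneg_pos mult_nonneg_nonneg)
    have "torus_L2_norm (\<lambda>x. u (real n * \<tau>) x - num_solution \<tau> N u0 n x)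
       \<le> C * \<tau> powr (3/2 * \<gamma> - 1/2 - \<epsilon>) + C * real N powr (-\<gamma>)"
      if u: "nls_solution \<gamma> T u0 u" "Linf_Hs_norm \<gamma> T u = ereal M" and \<tau>: "0 < \<tau>" "\<tau> \<le> \<tau>\<^sub>0" and N: "N \<ge> 1" and n: "real n * \<tau> \<le> T"
      for u0 u \<tau> N n
    proof -
      define c where "c = (\<lambda>t. fourier_coeff (u t))"
      have modes: "nls_modes \<gamma> T m c" and c0: "c 0 = fourier_coeff u0"
        using nls_solution_modes[OF u assms] by (simp_all add: c_def m_def)
      interpret nls_modes \<gamma> T m c by (rule modes)
      let ?t = "real n * \<tau>" and ?w = "num_modes \<tau> N (c 0) n" and ?K = "{- int N..int N}"
      have t: "?t \<in> {0..T}" using n \<tau> by auto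
      have u0: "u0 \<in> torus_Hs \<gamma>" and ut: "u ?t \<in> torus_Hs \<gamma>" using u(1) t by (auto simp: nls_solution_def)
      have w: "(\<Sum>k\<in>?K. norm (num_modes \<tau> N (c 0) i k)) \<le> R" if "i \<le> n" for i
      proof (rule bound[OF modes \<tau> N])
        have "real i * \<tau> \<le> real n * \<tau>" using that \<tau> by (intro mult_right_mono) auto
        then show "real i * \<tau> \<le> T" using n by linarith
      qed
      have \<tau>1: "\<tau> \<le> 1" using \<tau> \<tau>0 by linarith
      have E: "L2_set (\<lambda>k. norm (c ?t k - ?w k)) ?K \<le> C2 R \<alpha> * (\<tau> powr (2 * \<alpha>) + real N powr (- \<gamma>))"
        by (rule l2_error_bound[OF \<tau>(1) \<tau>1 N R n \<alpha> w])
      note split = L2_tail_split[OF l1_c[OF t] num_modes_band N _ weighted_summable[OF t] weighted_bound[OF t] m]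
      have l: "l1 (\<lambda>k. c ?t k - ?w k)"
        and S: "sqrt (\<Sum>\<^sub>\<infinity>k. (norm (c ?t k - ?w k))\<^sup>2) \<le> L2_set (\<lambda>k. norm (c ?t k - ?w k)) ?K + real N powr (- \<gamma>) * m"
        using split assms(2) by auto
      have lw: "l1 ?w" by (rule l1_band_limited[OF num_modes_band])
      have num: "num_solution \<tau> N u0 n = FS ?w" using num_solution_FS[OF u0 assms(2)] by (simp add: c0)
      have "torus_L2_norm (\<lambda>x. u ?t x - num_solution \<tau> N u0 n x) = torus_L2_norm (FS (\<lambda>k. c ?t k - ?w k))"
      proof (rule torus_L2_norm_cong_AE)
        have [measurable]: "u ?t \<in> borel_measurable borel" "FS ?w \<in> borel_measurable borel"
          using ut measurable_FS[OF lw] by (auto simp: torus_Hs_def)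
        show "(\<lambda>x. u ?t x - num_solution \<tau> N u0 n x) \<in> borel_measurable borel"
          unfolding num by measurable
        show "FS (\<lambda>k. c ?t k - ?w k) \<in> borel_measurable borel" by (rule measurable_FS[OF l])
        show "AE x in lborel. u ?t x - num_solution \<tau> N u0 n x = FS (\<lambda>k. c ?t k - ?w k) x"
          using torus_Hs_AE_FS[OF ut assms(2)] unfolding num FS_diff[OF l1_c[OF t] lw, symmetric]
          by eventually_elim (simp add: c_def)
      qed
      also have "\<dots> = sqrt (2 * pi) * sqrt (\<Sum>\<^sub>\<infinity>k. (norm (c ?t k - ?w k))\<^sup>2)"
        by (simp add: torus_L2_norm_FS[OF l] real_sqrt_mult)
      also have "\<dots> \<le> sqrt (2 * pi) * (C2 R \<alpha> * (\<tau> powr (2 * \<alpha>) + real N powr (- \<gamma>)) + real N powr (- \<gamma>) * m)"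
        using S E by (intro mult_left_mono) auto
      also have "\<dots> \<le> sqrt (2 * pi) * ((C2 R \<alpha> + m) * (\<tau> powr (2 * \<alpha>) + real N powr (- \<gamma>)))"
        using m by (intro mult_left_mono) (auto simp: algebra_simps)
      also have "\<dots> = (sqrt (2 * pi) * (C2 R \<alpha> + m)) * (\<tau> powr (2 * \<alpha>) + real N powr (- \<gamma>))" by simp
      also have "\<dots> \<le> C * (\<tau> powr (3/2 * \<gamma> - 1/2 - \<epsilon>) + real N powr (- \<gamma>))"
      proof -
        have "\<tau> powr (2 * \<alpha>) \<le> \<tau> powr (3/2 * \<gamma> - 1/2 - \<epsilon>)"
          using \<tau> \<tau>1 \<epsilon>' by (intro powr_mono') (auto simp: \<alpha>_def)
        then show ?thesis using C by (intro mult_mono) auto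
      qed
      finally show ?thesis by (simp add: distrib_left)
    qed
    then show "\<exists>C>0. \<forall>u0 u. nls_solution \<gamma> T u0 u \<and> Linf_Hs_norm \<gamma> T u = ereal M \<longrightarrow>
           (\<forall>(\<tau>::real) (N::nat) (n::nat).
              0 < \<tau> \<and> \<tau> \<le> \<tau>\<^sub>0 \<and> N \<ge> 1 \<and> real n * \<tau> \<le> T \<longrightarrow>
              torus_L2_norm (\<lambda>x. u (real n * \<tau>) x - num_solution \<tau> N u0 n x)
                \<le> C * \<tau> powr (3/2 * \<gamma> - 1/2 - \<epsilon>) + C * real N powr (-\<gamma>))"
      using C(1) by blast
  qed
qed

end
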